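(* Let $n,m\ge 1$ be integers. Then $$\sum_{\nu\vdash nm} a_{n,m}^\nu = \langle 1, N^m\rangle_{\mathfrak{S}_n} = \#\, T(n,m)/{\sim},$$ where $T(n,m)/{\sim}$ is the set of permutation equivalence classes of matrices in $M(n,m)$ that are permutation equivalent to their transpose.
   Context: $M(n,m)$ is the set of $n\times n$ matrices with non-negative integer entries all of whose row sums and column sums equal $m$. Two matrices $A,B\in M(n,m)$ are permutation equivalent, written $A\sim B$, if $A$ can be transformed into $B$ by row and column permutations (independently of each other). $T(n,m)=\{A\in M(n,m)\mid A\sim A^{\mathsf{T}}\}$, where $A^{\mathsf{T}}$ is the transpose. $\mathfrak{S}_n$ is identified with the group of $n\times n$ permutation matrices ($\sigma$ has entry $1$ in positions $(\sigma(j),j)$ and $0$ elsewhere), and $N^m:\mathfrak{S}_n\to\mathbb{Z}$ is the class function $N^m(\sigma)=\#\{A\in M(n,m)\mid\sigma A^{\mathsf{T}}=A\}$. $\langle\chi,\phi\rangle_G=\frac1{|G|}\sum_{g\in G}\chi(g)\overline{\phi(g)}$, and $1$ denotes the trivial character. Plethysm is the unique binary operation $(f,g)\mapsto f[g]$ on the ring $\Lambda$ of symmetric functions over $\mathbb{Q}$ such that $p_k[p_l]=p_{kl}$ for power sums ($k,l\ge1$), $g\mapsto p_k[g]$ is a $\mathbb{Q}$-algebra homomorphism for each $k\ge1$, and $f\mapsto f[g]$ is a $\mathbb{Q}$-algebra homomorphism for each $g\in\Lambda$. The coefficients $a_{n,m}^\nu$ are defined by $s_n[s_m]=\sum_{\nu\vdash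 nm}a_{n,m}^\nu s_\nu$, where $s_\nu$ are Schur functions and $s_k=s_{(k)}$. Equivalently, $a_{n,m}^\nu=\langle\chi^\nu,\operatorname{Ind}_{\mathfrak{S}_m\wr\mathfrak{S}_n}^{\mathfrak{S}_{nm}}1\rangle$, where $\chi^\nu$ is the irreducible character of $\mathfrak{S}_{nm}$ indexed by $\nu$ and $\mathfrak{S}_m\wr\mathfrak{S}_n\le\mathfrak{S}_{nm}$ is the stabilizer of the set partition of $\{1,\dots,nm\}$ into the blocks $\{(i-1)m+1,\dots,im\}$, $1\le i\le n$. *)

theory Defs
  imports
    Complex_Main
    "HOL-Library.Multiset"
    "HOL-Library.FuncSet"
    "HOL-Combinatorics.Permutations"
    "Jordan_Normal_Form.Matrix"
begin

section \<open>Matrices with constant row and column sums\<close>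

definition M_mats :: "nat \<Rightarrow> nat \<Rightarrow> nat mat set" where
  "M_mats n m = {A \<in> carrier_mat n n.
     (\<forall>i<n. (\<Sum>j<n. A $$ (i, j)) = m) \<and> (\<forall>j<n. (\<Sum>i<n. A $$ (i, j)) = m)}"

definition sym_group :: "nat \<Rightarrow> (nat \<Rightarrow> nat) set" where
  "sym_group n = {\<sigma>. \<sigma> permutes {..<n}}"

definition perm_mat :: "nat \<Rightarrow> (nat \<Rightarrow> nat) \<Rightarrow> nat mat" where
  "perm_mat n \<sigma> = mat n n (\<lambda>(i, j). if i = \<sigma> j then 1 else 0)"

definition perm_equiv :: "nat \<Rightarrow> nat mat \<Rightarrow> nat mat \<Rightarrow> bool" where
  "perm_equiv n A B \<longleftrightarrow>
     (\<exists>\<sigma>\<in>sym_group n. \<exists>\<tau>\<in>sym_group n. B = mat n n (\<lambda>(i, j). A $$ (\<sigma> i, \<tau> j)))"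

definition perm_equiv_rel :: "nat \<Rightarrow> nat \<Rightarrow> (nat mat \<times> nat mat) set" where
  "perm_equiv_rel n m = {(A, B). A \<in> M_mats n m \<and> B \<in> M_mats n m \<and> perm_equiv n A B}"

definition T_mats :: "nat \<Rightarrow> nat \<Rightarrow> nat mat set" where
  "T_mats n m = {A \<in> M_mats n m. perm_equiv n A (transpose_mat A)}"

definition N_fun :: "nat \<Rightarrow> nat \<Rightarrow> (nat \<Rightarrow> nat) \<Rightarrow> int" where
  "N_fun n m \<sigma> = int (card {A \<in> M_mats n m. perm_mat n \<sigma> * transpose_mat A = A})"

definition char_inner :: "'g set \<Rightarrow> ('g \<Rightarrow> complex) \<Rightarrow> ('g \<Rightarrow> complex) \<Rightarrow> complex" where
  "char_inner G \<chi> \<phi> = 1 / of_nat (card G) * (\<Sum>g\<in>G. \<chi> g * cnj (\<phi> g))"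


section \<open>Formal power series in infinitely many variables\<close>

text \<open>
  Formal power series over the rationals in variables indexed by the natural numbers.
  A monomial is encoded as the multiset of the indices of its variables, so that the product
  of monomials is the sum of multisets and the degree is the size.
\<close>

typedef mser = "UNIV :: (nat multiset \<Rightarrow> rat) set"
  morphisms mcoeff Abs_mser ..

setup_lifting type_definition_mser

lemma mser_eqI: "(\<And>X. mcoeff f X = mcoeff g X) \<Longrightarrow> f = g"
  by transfer auto

lemma double_diff_mset: "A \<subseteq># X \<Longrightarrow> X - (X - A) = (A :: 'a multiset)"
  by (auto simp: multiset_eq_iff subseteq_mset_def)

lemma finite_submsets: "finite {A. A \<subseteq># (X :: 'a multiset)}"
proof (induction X)
  case (add x X)
  have "A \<in> {A. A \<subseteq># X} \<union> add_mset x ` {A. A \<subseteq># X}" if "A \<subseteq># add_mset x X" for A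
  proof (cases "x \<in># A")
    case True
    then obtain B where "A = add_mset x B" by (metis mset_add)
    with that show ?thesis by simp
  next
    case False
    have "A \<subseteq># X"
      unfolding subseteq_mset_def
    proof
      fix a
      show "count A a \<le> count X a"
        using that False
        by (cases "a = x") (auto simp: subseteq_mset_def not_in_iff dest: spec[of _ a])
    qed
    then show ?thesis by simp
  qed
  then have "{A. A \<subseteq># add_mset x X} \<subseteq> {A. A \<subseteq># X} \<union> add_mset x ` {A. A \<subseteq># X}"
    by blast
  then show ?case
    using add.IH finite_subset by blast
qed simp

instantiation mser :: comm_ring_1
begin

lift_definition zero_mser :: mser is "\<lambda>_. 0" .

lift_definition one_mser :: mser is "\<lambda>X. if X = {#} then 1 else 0" .

lift_definition plus_mser :: "mser \<Rightarrow> mser \<Rightarrow> mser" is "\<lambda>f g X. f X + g X" .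

lift_definition minus_mser :: "mser \<Rightarrow> mser \<Rightarrow> mser" is "\<lambda>f g X. f X - g X" .

lift_definition uminus_mser :: "mser \<Rightarrow> mser" is "\<lambda>f X. - f X" .

lift_definition times_mser :: "mser \<Rightarrow> mser \<Rightarrow> mser" is
  "\<lambda>f g X. \<Sum>A | A \<subseteq># X. f A * g (X - A)" .

instance
proof
  fix f g h :: mser
  show "f + g + h = f + (g + h)" "f + g = g + f" "0 + f = f" "- f + f = 0" "f - g = f + - g"
    by (transfer; auto simp: fun_eq_iff)+
  show "f * g = g * f"
  proof (transfer, rule ext)
    fix f g :: "nat multiset \<Rightarrow> rat" and X :: "nat multiset"
    show "(\<Sum>A | A \<subseteq># X. f A * g (X - A)) = (\<Sum>A | A \<subseteq># X. g A * f (X - A))"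
      by (rule sum.reindex_bij_witness[of _ "\<lambda>A. X - A" "\<lambda>A. X - A"])
        (auto simp: double_diff_mset mult.commute)
  qed
  show "f * g * h = f * (g * h)"
  proof (transfer, rule ext)
    fix f g h :: "nat multiset \<Rightarrow> rat" and X :: "nat multiset"
    let ?s = "\<lambda>X :: nat multiset. {A. A \<subseteq># X}"
    have "(\<Sum>A\<in>?s X. (\<Sum>B\<in>?s A. f B * g (A - B)) * h (X - A)) =
        (\<Sum>(A, B)\<in>Sigma (?s X) ?s. f B * g (A - B) * h (X - A))"
      by (simp add: sum_distrib_right sum.Sigma finite_submsets)
    also have "\<dots> = (\<Sum>(B, C)\<in>Sigma (?s X) (\<lambda>B. ?s (X - B)). f B * (g C * h (X - B - C)))"
    proof (rule sum.reindex_bij_witness[of _ "\<lambda>(B, C). (B + C, B)" "\<lambda>(A, B). (B, A - B)"],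
        goal_cases)
      case (1 p)
      then show ?case by (auto simp: subset_mset.add_diff_inverse)
    next
      case (2 p)
      then show ?case
        by (auto simp: subseteq_mset_def) (meson order_trans diff_le_mono)+
    next
      case (3 p)
      then show ?case by auto
    next
      case (4 p)
      then show ?case
        by (auto simp: subset_mset.le_diff_conv2 add.commute)
    next
      case (5 p)
      then obtain A B where p: "p = (A, B)" "A \<subseteq># X" "B \<subseteq># A" by auto
      have "X - B - (A - B) = X - A"
        using p by (metis diff_diff_add_mset subset_mset.add_diff_inverse)
      with p show ?case by (simp add: mult.assoc)
    qed
    also have "\<dots> = (\<Sum>B\<in>?s X. f B * (\<Sum>C\<in>?s (X - B). g C * h (X - B - C)))"
      by (simp add: sum_distrib_left sum.Sigma finite_submsets)
    finally show "(\<Sum>A\<in>?s X. (\<Sum>B\<in>?s A. f B * g (A - B)) * h (X - A)) =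
        (\<Sum>B\<in>?s X. f B * (\<Sum>C\<in>?s (X - B). g C * h (X - B - C)))" .
  qed
  show "1 * f = f"
  proof (transfer, rule ext)
    fix f :: "nat multiset \<Rightarrow> rat" and X :: "nat multiset"
    have "(\<Sum>A | A \<subseteq># X. (if A = {#} then 1 else 0) * f (X - A)) =
        (\<Sum>A | A \<subseteq># X. if A = {#} then f X else 0)"
      by (intro sum.cong) auto
    also have "\<dots> = f X"
      by (simp add: sum.delta finite_submsets)
    finally show "(\<Sum>A | A \<subseteq># X. (if A = {#} then 1 else 0) * f (X - A)) = f X" .
  qed
  show "(f + g) * h = f * h + g * h"
    by transfer (auto simp: fun_eq_iff sum.distrib algebra_simps)
  show "(0 :: mser) \<noteq> 1"
    by transfer (auto simp: fun_eq_iff)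
qed

end

lift_definition mscale :: "rat \<Rightarrow> mser \<Rightarrow> mser" is "\<lambda>c f X. c * f X" .


section \<open>Symmetric functions and plethysm\<close>

definition Sym_Fun :: "mser set" where
  "Sym_Fun = {f. (\<forall>\<pi>. bij \<pi> \<longrightarrow> (\<forall>X. mcoeff f (image_mset \<pi> X) = mcoeff f X)) \<and>
                 (\<exists>d. \<forall>X. d < size X \<longrightarrow> mcoeff f X = 0)}"

text \<open>The power sum is the sum of all monomials \<open>x\<^sub>i ^ k\<close> and is used only for \<open>k \<ge> 1\<close>.\<close>

lift_definition power_sum :: "nat \<Rightarrow> mser" is
  "\<lambda>k X. if \<exists>i. X = replicate_mset k i then 1 else 0" .

definition partitions :: "nat \<Rightarrow> nat list set" where
  "partitions d = {\<nu>. sorted_wrt (\<ge>) \<nu> \<and> 0 \<notin> set \<nu> \<and> sum_list \<nu> = d}"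

text \<open>
  Semistandard Young tableaux, as lists of rows: rows weakly increase, columns strictly increase.
  The Schur function is their generating function by content.
\<close>

definition SSYT :: "nat list \<Rightarrow> nat list list set" where
  "SSYT \<nu> = {t. map length t = \<nu> \<and> (\<forall>r\<in>set t. sorted r) \<and>
     (\<forall>i j. Suc i < length t \<longrightarrow> j < length (t ! Suc i) \<longrightarrow> t ! i ! j < t ! Suc i ! j)}"

lift_definition schur :: "nat list \<Rightarrow> mser" is
  "\<lambda>\<nu> X. of_nat (card {t \<in> SSYT \<nu>. mset (concat t) = X})" .

definition rat_alg_hom :: "(mser \<Rightarrow> mser) \<Rightarrow> bool" where
  "rat_alg_hom \<phi> \<longleftrightarrow> \<phi> \<in> Sym_Fun \<rightarrow> Sym_Fun \<and> \<phi> 1 = 1 \<and>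
     (\<forall>f\<in>Sym_Fun. \<forall>g\<in>Sym_Fun. \<phi> (f + g) = \<phi> f + \<phi> g \<and> \<phi> (f * g) = \<phi> f * \<phi> g) \<and>
     (\<forall>c. \<forall>f\<in>Sym_Fun. \<phi> (mscale c f) = mscale c (\<phi> f))"

definition is_plethysm :: "(mser \<Rightarrow> mser \<Rightarrow> mser) \<Rightarrow> bool" where
  "is_plethysm pl \<longleftrightarrow>
     (\<forall>k\<ge>1. \<forall>l\<ge>1. pl (power_sum k) (power_sum l) = power_sum (k * l)) \<and>
     (\<forall>k\<ge>1. rat_alg_hom (\<lambda>g. pl (power_sum k) g)) \<and>
     (\<forall>g\<in>Sym_Fun. rat_alg_hom (\<lambda>f. pl f g))"

text \<open>
  The extensional function space makes the operation, which only matters on symmetric functions,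
  unique as a total function.
\<close>

definition plethysm :: "mser \<Rightarrow> mser \<Rightarrow> mser" where
  "plethysm = (THE pl. pl \<in> Sym_Fun \<rightarrow>\<^sub>E Sym_Fun \<rightarrow>\<^sub>E Sym_Fun \<and> is_plethysm pl)"

text \<open>The coefficients in the Schur expansion of \<open>s\<^sub>n[s\<^sub>m]\<close>, extended by zero.\<close>

definition plethysm_coeff :: "nat \<Rightarrow> nat \<Rightarrow> nat list \<Rightarrow> rat" where
  "plethysm_coeff n m = (THE a. (\<forall>\<nu>. \<nu> \<notin> partitions (n * m) \<longrightarrow> a \<nu> = 0) \<and>
     plethysm (schur [n]) (schur [m]) = (\<Sum>\<nu>\<in>partitions (n * m). mscale (a \<nu>) (schur \<nu>)))"

end

theory Submission
  imports Defs "HOL-Combinatorics.Orbits"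
begin

text \<open>
  Let \<open>L\<close> be the linear functional with \<open>L(s\<^sub>\<nu>) = 1\<close> for every partition \<open>\<nu>\<close>. The local rule of the
  Robinson-Schensted-Knuth correspondence gives \<open>h\<^sub>\<alpha> = \<Sum>\<^sub>\<nu> K\<^bsub>\<nu>\<alpha>\<^esub> s\<^sub>\<nu>\<close>, and its diagonal case shows
  that \<open>L(h\<^sub>\<alpha>)\<close> is the number of symmetric matrices with row sums \<open>\<alpha>\<close>. A Young subgroup \<open>S\<^sub>\<alpha>\<close> satisfies \<open>\<bar>S\<^sub>\<alpha>\<bar> h\<^sub>\<alpha> = \<Sum> p(h)\<close>, summed over \<open>h \<in> S\<^sub>\<alpha>\<close>,
  where \<open>p(h)\<close> is the power sum of the cycle type of \<open>h\<close>, and \<open>\<bar>S\<^sub>\<alpha>\<bar>\<close> times the number of those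
  symmetric matrices counts the permutations whose square lies in \<open>S\<^sub>\<alpha>\<close>. By induction on
  the number of cycles, \<open>L(p(h))\<close> is the number of square roots of \<open>h\<close>.

  Plethysm is substitution in the power sum basis, and Newton's identity shows that the
  coefficients of \<open>s\<^sub>n[s\<^sub>m]\<close> count multisets of multisets. So \<open>s\<^sub>n[s\<^sub>m]\<close> is the average of \<open>p(h)\<close> over
  the wreath product, whose base group we call \<open>B\<close>. Over the coset of \<open>B\<close> given by \<open>\<sigma>\<close>, the values
  \<open>L(p(h))\<close> add up to the number of permutations whose square lies in that coset, which is
  \<open>\<bar>B\<bar> N\<^sup>m(\<sigma>)\<close>. The second equality is an orbit count.
\<close>

text \<open>In terms of characters, p(h) = \<Sum> \<chi>^\<nu>(h) s_\<nu>, so L(p(h)) is the sum of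
  all irreducible characters at h. By Frobenius and Schur this is the number of square roots of h,
  every irreducible representation of a symmetric group having indicator 1. The proof reaches the
  same number without representations.

  The obstacle is that a single p(h) has signed Schur coefficients, so no direct bijection computes
  L(p(h)); sums over a Young subgroup are positive. They suffice because an element of the Young
  subgroup of the cycles of h has more cycles than h unless it has the same orbits, and then it is
  conjugate to h.

  Symmetric matrices arise as follows: if x^2 preserves colours, then x carries the positions that
  it moves from colour a to colour b onto those that it moves from b to a. One counting lemma,
  \<open>card_twisted_pairs\<close>, serves words fixed by permutations, square roots, and the orbit
  count behind multisets of multisets. L is carried as the relation \<open>schur_expansion\<close>,
  because it is a function only once the Schur functions are known to be independent.\<close>

section \<open>Coefficients of series and closure properties of symmetric functions\<close>

lemma mcoeff_simps [simp]:
  "mcoeff 0 X = 0"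
  "mcoeff 1 X = (if X = {#} then 1 else 0)"
  "mcoeff (f + g) X = mcoeff f X + mcoeff g X"
  "mcoeff (f - g) X = mcoeff f X - mcoeff g X"
  "mcoeff (mscale c f) X = c * mcoeff f X"
  by (transfer; simp)+

lemma mcoeff_times: "mcoeff (f * g) X = (\<Sum>A | A \<subseteq># X. mcoeff f A * mcoeff g (X - A))"
  by transfer simp

lemma mcoeff_sum [simp]: "mcoeff (sum f A) X = (\<Sum>a\<in>A. mcoeff (f a) X)"
  by (induction A rule: infinite_finite_induct) auto

lemma mcoeff_power_sum: "mcoeff (power_sum k) X = (if \<exists>i. X = replicate_mset k i then 1 else 0)"
  by transfer simp

lemma mscale_times [simp]:
  "mscale c f * g = mscale c (f * g)" "f * mscale c g = mscale c (f * g)"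
  by (rule mser_eqI; simp add: mcoeff_times sum_distrib_left mult.assoc mult.left_commute[of _ c])+

interpretation mser: vector_space mscale
  by unfold_locales (auto intro!: mser_eqI simp: algebra_simps)

interpretation mser_pair: vector_space_pair mscale mscale
  by unfold_locales

lemma Sym_FunI:
  assumes "\<And>\<pi> X. bij \<pi> \<Longrightarrow> mcoeff f (image_mset \<pi> X) = mcoeff f X"
    and "\<And>X. d < size X \<Longrightarrow> mcoeff f X = 0"
  shows "f \<in> Sym_Fun"
  using assms by (auto simp: Sym_Fun_def)

lemma Sym_Fun_sym: "f \<in> Sym_Fun \<Longrightarrow> bij \<pi> \<Longrightarrow> mcoeff f (image_mset \<pi> X) = mcoeff f X"
  by (auto simp: Sym_Fun_def)

lemma Sym_Fun_deg:
  assumes "f \<in> Sym_Fun"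
  shows "\<exists>d. \<forall>X. d < size X \<longrightarrow> mcoeff f X = 0"
  using assms by (auto simp: Sym_Fun_def)

lemma Sym_Fun_0 [simp]: "0 \<in> Sym_Fun"
  by (rule Sym_FunI[of _ 0]) auto

lemma Sym_Fun_1 [simp]: "1 \<in> Sym_Fun"
  by (rule Sym_FunI[of _ 0]) auto

lemma Sym_Fun_mscale [simp]: "f \<in> Sym_Fun \<Longrightarrow> mscale c f \<in> Sym_Fun"
  by (auto simp: Sym_Fun_def)

lemma Sym_Fun_add [simp]:
  assumes "f \<in> Sym_Fun" "g \<in> Sym_Fun"
  shows "f + g \<in> Sym_Fun"
proof -
  obtain d where "\<And>X. d < size X \<Longrightarrow> mcoeff f X = 0"
    using Sym_Fun_deg[OF assms(1)] by blast
  moreover obtain e where "\<And>X. e < size X \<Longrightarrow> mcoeff g X = 0"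
    using Sym_Fun_deg[OF assms(2)] by blast
  ultimately show ?thesis
    by (intro Sym_FunI[of _ "max d e"]) (auto simp: Sym_Fun_sym assms)
qed

lemma Sym_Fun_diff [simp]:
  assumes "f \<in> Sym_Fun" "g \<in> Sym_Fun"
  shows "f - g \<in> Sym_Fun"
proof -
  have "f - g = f + mscale (-1) g" by (rule mser_eqI) auto
  with assms show ?thesis by (metis Sym_Fun_add Sym_Fun_mscale)
qed

lemma subseteq_image_mset_bij:
  fixes \<pi> :: "'a \<Rightarrow> 'a"
  assumes "bij \<pi>"
  shows "{A. A \<subseteq># image_mset \<pi> X} = image_mset \<pi> ` {B. B \<subseteq># X}"
proof -
  have inv: "image_mset (inv_into UNIV \<pi>) (image_mset \<pi> Y) = Y" "image_mset \<pi> (image_mset (inv_into UNIV \<pi>) Y) = Y" for Y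
    using assms by (simp_all add: multiset.map_comp o_def bij_is_inj bij_is_surj surj_f_inv_f)
  have "A \<in> image_mset \<pi> ` {B. B \<subseteq># X}" if "A \<subseteq># image_mset \<pi> X" for A
    using image_mset_subseteq_mono[OF that, of "inv_into UNIV \<pi>"] inv
    by (metis (mono_tags) image_eqI mem_Collect_eq)
  then show ?thesis by (auto intro: image_mset_subseteq_mono)
qed

lemma inj_image_mset_bij: "bij \<pi> \<Longrightarrow> inj (image_mset \<pi>)"
  by (rule inj_on_inverseI[of _ "image_mset (inv_into UNIV \<pi>)"])
    (simp add: multiset.map_comp o_def bij_is_inj)

lemma Sym_Fun_times [simp]:
  assumes "f \<in> Sym_Fun" "g \<in> Sym_Fun"
  shows "f * g \<in> Sym_Fun"
proof -
  obtain d where d: "\<And>X. d < size X \<Longrightarrow> mcoeff f X = 0"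
    using Sym_Fun_deg[OF assms(1)] by blast
  obtain e where e: "\<And>X. e < size X \<Longrightarrow> mcoeff g X = 0"
    using Sym_Fun_deg[OF assms(2)] by blast
  show ?thesis
  proof (rule Sym_FunI[of _ "d + e"])
    fix \<pi> :: "nat \<Rightarrow> nat" and X assume \<pi>: "bij \<pi>"
    have "mcoeff (f * g) (image_mset \<pi> X) =
        (\<Sum>B | B \<subseteq># X. mcoeff f (image_mset \<pi> B) * mcoeff g (image_mset \<pi> X - image_mset \<pi> B))"
      unfolding mcoeff_times subseteq_image_mset_bij[OF \<pi>]
      by (subst sum.reindex) (auto intro: inj_on_subset[OF inj_image_mset_bij[OF \<pi>]])
    also have "\<dots> = (\<Sum>B | B \<subseteq># X. mcoeff f B * mcoeff g (X - B))"
    proof (rule sum.cong)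
      fix B assume "B \<in> {B. B \<subseteq># X}"
      then have "image_mset \<pi> X - image_mset \<pi> B = image_mset \<pi> (X - B)"
        by (simp add: image_mset_Diff)
      then show "mcoeff f (image_mset \<pi> B) * mcoeff g (image_mset \<pi> X - image_mset \<pi> B) =
          mcoeff f B * mcoeff g (X - B)"
        by (simp add: Sym_Fun_sym assms \<pi>)
    qed simp
    finally show "mcoeff (f * g) (image_mset \<pi> X) = mcoeff (f * g) X" by (simp add: mcoeff_times)
  next
    fix X :: "nat multiset" assume X: "d + e < size X"
    show "mcoeff (f * g) X = 0"
      unfolding mcoeff_times
    proof (rule sum.neutral, rule ballI)
      fix A assume "A \<in> {A. A \<subseteq># X}"
      then have "size X = size A + size (X - A)"
        by (metis mem_Collect_eq size_union subset_mset.add_diff_inverse)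
      then have "d < size A \<or> e < size (X - A)" using X by linarith
      then show "mcoeff f A * mcoeff g (X - A) = 0" using d e by auto
    qed
  qed
qed

lemma Sym_Fun_sum [simp]: "(\<And>a. a \<in> A \<Longrightarrow> f a \<in> Sym_Fun) \<Longrightarrow> sum f A \<in> Sym_Fun"
  by (induction A rule: infinite_finite_induct) auto

lemma Sym_Fun_prod_mset [simp]:
  "(\<And>a. a \<in># A \<Longrightarrow> f a \<in> Sym_Fun) \<Longrightarrow> (\<Prod>a\<in>#A. f a) \<in> Sym_Fun"
  by (induction A) auto

lemma subspace_Sym_Fun: "mser.subspace Sym_Fun"
  by (auto simp: mser.subspace_def)

lemma power_sum_Sym_Fun [simp]: "power_sum k \<in> Sym_Fun"
proof (rule Sym_FunI[of _ k])
  fix \<pi> :: "nat \<Rightarrow> nat" and X assume \<pi>: "bij \<pi>"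
  have "(\<exists>i. image_mset \<pi> X = replicate_mset k i) \<longleftrightarrow> (\<exists>i. X = replicate_mset k i)"
  proof safe
    fix i assume "image_mset \<pi> X = replicate_mset k i"
    then have "image_mset (inv_into UNIV \<pi>) (image_mset \<pi> X) = replicate_mset k (inv_into UNIV \<pi> i)" by simp
    then show "\<exists>i. X = replicate_mset k i"
      using \<pi> by (auto simp: multiset.map_comp o_def bij_is_inj)
  qed auto
  then show "mcoeff (power_sum k) (image_mset \<pi> X) = mcoeff (power_sum k) X"
    by (simp add: mcoeff_power_sum)
qed (auto simp: mcoeff_power_sum)


section \<open>The power sum basis\<close>

text \<open>The exponents of the monomial as a partition. It classifies monomials up to renaming
  variables, so a symmetric function is determined by one coefficient per type.\<close>

definition monomial_type :: "nat multiset \<Rightarrow> nat multiset" where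
  "monomial_type X = image_mset (count X) (mset_set (set_mset X))"

lemma size_monomial_type [simp]: "size (monomial_type X) = card (set_mset X)"
  by (simp add: monomial_type_def)

lemma zero_notin_monomial_type [simp]: "0 \<notin># monomial_type X"
  by (auto simp: monomial_type_def count_eq_zero_iff)

lemma sum_mset_monomial_type [simp]: "sum_mset (monomial_type X) = size X"
  by (simp add: monomial_type_def size_multiset_overloaded_eq sum_unfold_sum_mset)

lemma monomial_type_empty [simp]: "monomial_type {#} = {#}"
  by (simp add: monomial_type_def)

lemma monomial_type_add:
  assumes "i \<notin># X" "k > 0"
  shows "monomial_type (replicate_mset k i + X) = add_mset k (monomial_type X)"
proof -
  have "set_mset (replicate_mset k i + X) = insert i (set_mset X)" using assms by auto
  moreover have "image_mset (count (replicate_mset k i + X)) (mset_set (set_mset X)) =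
      image_mset (count X) (mset_set (set_mset X))"
    by (intro image_mset_cong) (use assms in \<open>auto simp: count_eq_zero_iff\<close>)
  ultimately show ?thesis
    using assms by (simp add: monomial_type_def count_eq_zero_iff)
qed

lemma count_image_mset_inj:
  assumes "inj f"
  shows "count (image_mset f M) (f x) = count M x"
proof -
  have "f -` {f x} = {x}" using assms by (auto simp: inj_def)
  then show ?thesis by (cases "x \<in># M") (auto simp: count_image_mset not_in_iff)
qed

text \<open>On the joint set of variables both exponent functions take the same values with
  multiplicity once padded with zeros, so some permutation of that finite set matches them; outside
  the set it is the identity.\<close>

lemma monomial_type_eqD:
  assumes "monomial_type X = monomial_type Y"
  obtains \<pi> where "bij \<pi>" "image_mset \<pi> X = Y"
proof -
  define A where "A = set_mset X \<union> set_mset Y"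
  have aux: "image_mset (count Z) (mset_set A) = monomial_type Z + replicate_mset (card A - card (set_mset Z)) 0"
    if "set_mset Z \<subseteq> A" for Z
  proof -
    have "finite A" by (simp add: A_def)
    have "mset_set A = mset_set (set_mset Z) + mset_set (A - set_mset Z)"
      using that \<open>finite A\<close> by (subst mset_set_Union[symmetric]) (auto simp: Un_absorb1)
    moreover have "image_mset (count Z) (mset_set (A - set_mset Z)) = image_mset (\<lambda>_. 0) (mset_set (A - set_mset Z))"
      by (intro image_mset_cong) (use \<open>finite A\<close> in \<open>auto simp: not_in_iff\<close>)
    ultimately show ?thesis
      using \<open>finite A\<close> that by (simp add: monomial_type_def image_mset_const_eq card_Diff_subset)
  qed
  have "card (set_mset X) = card (set_mset Y)" using assms size_monomial_type by metis
  then have "image_mset (count X) (mset_set A) = image_mset (count Y) (mset_set A)"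
    using assms aux[of X] aux[of Y] by (simp add: A_def)
  then obtain p where p: "p permutes A" "\<forall>x\<in>A. count X x = count Y (p x)"
    by (rule image_mset_eq_implies_permutes[rotated]) (auto simp: A_def)
  have eq: "count X x = count Y (p x)" for x
  proof (cases "x \<in> A")
    case False
    then have "p x \<notin> A" using p(1) by (simp add: permutes_in_image)
    with False show ?thesis by (auto simp: A_def not_in_iff)
  qed (use p in auto)
  have "bij p" using p(1) by (rule permutes_bij)
  moreover have "image_mset p X = Y"
  proof (rule multiset_eqI)
    fix y
    obtain x where x: "y = p x" using \<open>bij p\<close> by (metis bij_pointE)
    have "count (image_mset p X) (p x) = count X x"
      using \<open>bij p\<close> by (rule count_image_mset_inj[OF bij_is_inj])
    then show "count (image_mset p X) y = count Y y" by (simp add: x eq)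
  qed
  ultimately show ?thesis by (rule that)
qed

lemma Sym_Fun_monomial_type:
  "f \<in> Sym_Fun \<Longrightarrow> monomial_type X = monomial_type Y \<Longrightarrow> mcoeff f X = mcoeff f Y"
  by (metis monomial_type_eqD Sym_Fun_sym)

lemma ex_monomial_type: "0 \<notin># \<nu> \<Longrightarrow> \<exists>X. monomial_type X = \<nu>"
proof (induction \<nu>)
  case (add k \<nu>)
  then obtain X where "monomial_type X = \<nu>" by auto
  moreover obtain i where "i \<notin># X" using ex_new_if_finite[of "set_mset X"] by auto
  ultimately show ?case using add.prems by (intro exI[of _ "replicate_mset k i + X"]) (auto simp: monomial_type_add)
qed (auto intro: exI[of _ "{#}"])

definition power_prod :: "nat multiset \<Rightarrow> mser" where
  "power_prod \<nu> = (\<Prod>k\<in>#\<nu>. power_sum k)"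

lemma power_prod_Sym_Fun [simp]: "power_prod \<nu> \<in> Sym_Fun"
  by (simp add: power_prod_def)

text \<open>For k > 0 distinct variables have distinct k-th powers, so the convolution collapses to
  a sum over the variable whose k-th power is divided out.\<close>

lemma mcoeff_power_sum_times:
  assumes "k > 0"
  shows "mcoeff (power_sum k * f) X = (\<Sum>i | replicate_mset k i \<subseteq># X. mcoeff f (X - replicate_mset k i))"
proof -
  have inj: "inj_on (replicate_mset k) S" for S :: "nat set"
    using assms by (auto simp: inj_on_def dest: replicate_mset_eq_iff[THEN iffD1])
  have "mcoeff (power_sum k * f) X =
      (\<Sum>A\<in>{A. A \<subseteq># X \<and> (\<exists>i. A = replicate_mset k i)}. mcoeff f (X - A))"
    unfolding mcoeff_times mcoeff_power_sum by (rule sum.mono_neutral_cong_right) (auto simp: finite_submsets)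
  also have "{A. A \<subseteq># X \<and> (\<exists>i. A = replicate_mset k i)} = replicate_mset k ` {i. replicate_mset k i \<subseteq># X}"
    by auto
  finally show ?thesis by (simp add: sum.reindex inj)
qed

lemma power_prod_nonneg: "0 \<notin># \<nu> \<Longrightarrow> mcoeff (power_prod \<nu>) X \<ge> 0"
  by (induction \<nu> arbitrary: X)
    (auto simp: power_prod_def mcoeff_power_sum_times intro!: sum_nonneg)

text \<open>Expanding the product chooses one variable per part. Hence at most
  \<open>size \<nu>\<close> variables occur, and if that many occur, the choices are distinct and
  the exponents are the parts of \<nu>. This is the triangularity behind both independence and
  spanning.\<close>

lemma power_prod_support:
  assumes "0 \<notin># \<nu>" "mcoeff (power_prod \<nu>) X \<noteq> 0"
  shows "card (set_mset X) \<le> size \<nu>" "card (set_mset X) = size \<nu> \<Longrightarrow> monomial_type X = \<nu>"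
proof -
  have "card (set_mset X) \<le> size \<nu> \<and> (card (set_mset X) = size \<nu> \<longrightarrow> monomial_type X = \<nu>)"
    using assms
  proof (induction \<nu> arbitrary: X)
    case empty
    then show ?case by (auto simp: power_prod_def split: if_splits)
  next
    case (add k \<nu>)
    then have k: "k > 0" "0 \<notin># \<nu>" by auto
    have "power_prod (add_mset k \<nu>) = power_sum k * power_prod \<nu>" by (simp add: power_prod_def)
    with add.prems k obtain i where i: "replicate_mset k i \<subseteq># X" "mcoeff (power_prod \<nu>) (X - replicate_mset k i) \<noteq> 0"
      by (metis (mono_tags, lifting) mcoeff_power_sum_times mem_Collect_eq sum.neutral)
    define Z where "Z = X - replicate_mset k i"
    have X: "X = replicate_mset k i + Z" using i(1) by (simp add: Z_def)
    have Z: "card (set_mset Z) \<le> size \<nu>" "card (set_mset Z) = size \<nu> \<Longrightarrow> monomial_type Z = \<nu>"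
      using add.IH[of Z] k i by (auto simp: Z_def)
    have set: "set_mset X = insert i (set_mset Z)" using k by (auto simp: X)
    show ?case
    proof (cases "i \<in># Z")
      case True
      then show ?thesis using Z by (auto simp: set insert_absorb)
    next
      case False
      then show ?thesis using Z k monomial_type_add[of i Z k] by (auto simp: set X[symmetric])
    qed
  qed
  then show "card (set_mset X) \<le> size \<nu>" "card (set_mset X) = size \<nu> \<Longrightarrow> monomial_type X = \<nu>"
    by auto
qed

lemma power_prod_size: "0 \<notin># \<nu> \<Longrightarrow> mcoeff (power_prod \<nu>) X \<noteq> 0 \<Longrightarrow> size X = sum_mset \<nu>"
proof (induction \<nu> arbitrary: X)
  case empty
  then show ?case by (auto simp: power_prod_def split: if_splits)
next
  case (add k \<nu>)
  then have k: "k > 0" "0 \<notin># \<nu>" by auto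
  have "power_prod (add_mset k \<nu>) = power_sum k * power_prod \<nu>" by (simp add: power_prod_def)
  with add.prems k obtain i where i: "replicate_mset k i \<subseteq># X" "mcoeff (power_prod \<nu>) (X - replicate_mset k i) \<noteq> 0"
    by (metis (mono_tags, lifting) mcoeff_power_sum_times mem_Collect_eq sum.neutral)
  then have "size (X - replicate_mset k i) = sum_mset \<nu>" using add.IH k by blast
  moreover have "size X = size (replicate_mset k i) + size (X - replicate_mset k i)"
    using i(1) by (metis size_union subset_mset.add_diff_inverse)
  ultimately show ?case by simp
qed

text \<open>All contributions are nonnegative, so it is enough to exhibit the one that assigns the
  parts of \<nu> to the variables having those exponents.\<close>

lemma power_prod_pos: "0 \<notin># \<nu> \<Longrightarrow> monomial_type X = \<nu> \<Longrightarrow> mcoeff (power_prod \<nu>) X > 0"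
proof (induction \<nu> arbitrary: X)
  case empty
  then have "X = {#}" by (simp add: monomial_type_def mset_set_empty_iff)
  then show ?case by (simp add: power_prod_def)
next
  case (add k \<nu>)
  then have k: "k > 0" "0 \<notin># \<nu>" by auto
  have "k \<in># monomial_type X" using add.prems by simp
  then obtain i where i: "i \<in># X" "count X i = k" by (auto simp: monomial_type_def)
  define Z where "Z = X - replicate_mset k i"
  have sub: "replicate_mset k i \<subseteq># X" using i by (simp add: count_le_replicate_mset_subset_eq[symmetric])
  then have X: "X = replicate_mset k i + Z" by (simp add: Z_def)
  have "i \<notin># Z" using i by (simp add: Z_def not_in_iff)
  then have "monomial_type Z = \<nu>"
    using add.prems k monomial_type_add[of i Z k] by (simp add: X[symmetric])
  then have pos: "mcoeff (power_prod \<nu>) Z > 0" using add.IH k by simp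
  have "{i. replicate_mset k i \<subseteq># X} \<subseteq> set_mset X"
    using k by (auto intro: mset_subset_eqD[of "replicate_mset k _"])
  then have "finite {i. replicate_mset k i \<subseteq># X}"
    by (rule finite_subset) simp
  then have "0 < (\<Sum>i | replicate_mset k i \<subseteq># X. mcoeff (power_prod \<nu>) (X - replicate_mset k i))"
    by (rule sum_pos2[of _ i]) (use sub pos k in \<open>auto simp: Z_def power_prod_nonneg\<close>)
  then show ?case using k by (simp add: power_prod_def mcoeff_power_sum_times)
qed

text \<open>Among the indices with nonzero coefficient take \<mu> with the most parts. By
  \<open>power_prod_support\<close> a monomial of type \<mu> occurs in no other power product of the
  relation.\<close>

lemma power_prod_lin_indep:
  assumes "finite S" "\<And>\<nu>. \<nu> \<in> S \<Longrightarrow> 0 \<notin># \<nu>" "(\<Sum>\<nu>\<in>S. mscale (c \<nu>) (power_prod \<nu>)) = 0" "\<nu> \<in> S"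
  shows "c \<nu> = 0"
proof (rule ccontr)
  assume nz: "c \<nu> \<noteq> 0"
  define T where "T = {\<nu>\<in>S. c \<nu> \<noteq> 0}"
  have T: "finite T" "T \<noteq> {}" using assms nz by (auto simp: T_def)
  then have "Max (size ` T) \<in> size ` T" by (intro Max_in) auto
  then obtain \<mu> where \<mu>T: "\<mu> \<in> T" "Max (size ` T) = size \<mu>" by (rule imageE)
  have \<mu>: "\<mu> \<in> T" "\<And>\<kappa>. \<kappa> \<in> T \<Longrightarrow> size \<kappa> \<le> size \<mu>"
    using \<mu>T T(1) by (auto simp flip: \<mu>T(2))
  have \<mu>0: "0 \<notin># \<mu>" "c \<mu> \<noteq> 0" "\<mu> \<in> S" using \<mu>(1) assms(2) by (auto simp: T_def)
  then obtain X where X: "monomial_type X = \<mu>" using ex_monomial_type by blast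
  have "(\<Sum>\<kappa>\<in>S. c \<kappa> * mcoeff (power_prod \<kappa>) X) = (\<Sum>\<kappa>\<in>{\<mu>}. c \<kappa> * mcoeff (power_prod \<kappa>) X)"
  proof (rule sum.mono_neutral_right)
    show "\<forall>\<kappa>\<in>S - {\<mu>}. c \<kappa> * mcoeff (power_prod \<kappa>) X = 0"
    proof (rule ccontr)
      assume "\<not> ?thesis"
      then obtain \<kappa> where \<kappa>: "\<kappa> \<in> S" "\<kappa> \<noteq> \<mu>" "c \<kappa> \<noteq> 0" "mcoeff (power_prod \<kappa>) X \<noteq> 0" by auto
      then have "size \<kappa> \<le> size \<mu>" using \<mu>(2) by (auto simp: T_def)
      moreover have "size \<mu> = card (set_mset X)" using X size_monomial_type by metis
      ultimately show False using power_prod_support[of \<kappa> X] \<kappa> assms(2) X by auto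
    qed
  qed (use assms \<mu>0 in auto)
  moreover have "(\<Sum>\<kappa>\<in>S. c \<kappa> * mcoeff (power_prod \<kappa>) X) = 0"
    using arg_cong[OF assms(3), of "\<lambda>f. mcoeff f X"] by simp
  ultimately show False using power_prod_pos[OF \<mu>0(1) X] \<mu>0 by simp
qed

text \<open>The part 0 is excluded because \<open>power_sum 0\<close> equals 1 in this encoding,
  which would give many indices the same product.\<close>

definition power_index :: "nat multiset set" where
  "power_index = {\<nu>. 0 \<notin># \<nu>}"

lemma inj_on_power_prod: "inj_on power_prod power_index"
proof (rule inj_onI, rule ccontr)
  fix \<nu> \<mu> assume *: "\<nu> \<in> power_index" "\<mu> \<in> power_index" "power_prod \<nu> = power_prod \<mu>" "\<nu> \<noteq> \<mu>"
  have "(\<Sum>\<kappa>\<in>{\<nu>, \<mu>}. mscale (if \<kappa> = \<nu> then 1 else -1) (power_prod \<kappa>)) = 0"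
    using * by (intro mser_eqI) auto
  from power_prod_lin_indep[OF _ _ this, of \<nu>] * show False by (auto simp: power_index_def)
qed

lemma independent_power_prod: "mser.independent (power_prod ` power_index)"
  unfolding mser.independent_explicit_finite_subsets
proof (intro allI impI ballI)
  fix S c v assume S: "S \<subseteq> power_prod ` power_index" "finite S" "(\<Sum>v\<in>S. mscale (c v) v) = 0" "v \<in> S"
  then obtain T where T: "T \<subseteq> power_index" "finite T" "S = power_prod ` T"
    using finite_subset_image[OF S(2,1)] by auto
  have "inj_on power_prod T" using inj_on_power_prod T(1) by (rule inj_on_subset)
  then have *: "(\<Sum>\<nu>\<in>T. mscale (c (power_prod \<nu>)) (power_prod \<nu>)) = 0"
    using S(3) T(3) by (simp add: sum.reindex)
  obtain \<nu> where "v = power_prod \<nu>" "\<nu> \<in> T" using S(4) T(3) by auto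
  then show "c v = 0"
    using power_prod_lin_indep[OF T(2) _ *, of \<nu>] T(1) by (auto simp: power_index_def)
qed

text \<open>Induction on a strict bound j for the number of distinct variables in the monomials of
  f: a combination of power products with exactly the top number of parts cancels the top layer, and
  triangularity keeps the remainder below it.\<close>

lemma span_power_prod: "mser.span (power_prod ` power_index) = Sym_Fun"
proof
  show "mser.span (power_prod ` power_index) \<subseteq> Sym_Fun"
    by (rule mser.span_minimal[OF _ subspace_Sym_Fun]) auto
  have main: "f \<in> mser.span (power_prod ` power_index)"
    if "f \<in> Sym_Fun" "\<And>X. d < size X \<Longrightarrow> mcoeff f X = 0"
      "\<And>X. j \<le> card (set_mset X) \<Longrightarrow> mcoeff f X = 0" for f d j
    using that
  proof (induction j arbitrary: f)
    case 0
    then have "f = 0" by (intro mser_eqI) auto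
    then show ?case by (simp add: mser.span_zero)
  next
    case (Suc j)
    \<comment> \<open>The types of the top layer. The degree bound \<open>d\<close> makes them
      finitely many, and subtracting their products does not raise the degree.\<close>
    define L where "L = {\<nu> \<in> power_index. size \<nu> = j \<and> sum_mset \<nu> \<le> d}"
    have "L \<subseteq> multisets_of_size {..d} j"
      by (auto simp: L_def multisets_of_size_def dest!: multi_member_split)
    then have [simp]: "finite L"
      by (rule finite_subset) (intro finite_multisets_of_size, simp)
    \<comment> \<open>Any representative monomial will do, since coefficients of symmetric functions
      depend only on the type.\<close>
    define x where "x \<nu> = (SOME X. monomial_type X = \<nu>)" for \<nu>
    have x: "monomial_type (x \<nu>) = \<nu>" if "\<nu> \<in> power_index" for \<nu>
      using that someI_ex[OF ex_monomial_type, of \<nu>] by (simp add: x_def power_index_def)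
    define c where "c \<nu> = mcoeff f (x \<nu>) / mcoeff (power_prod \<nu>) (x \<nu>)" for \<nu>
    define g where "g = (\<Sum>\<nu>\<in>L. mscale (c \<nu>) (power_prod \<nu>))"
    have g_span: "g \<in> mser.span (power_prod ` power_index)"
      unfolding g_def by (intro mser.span_sum mser.span_scale mser.span_base) (auto simp: L_def)
    have other: "mcoeff (power_prod \<nu>) X = 0"
      if "\<nu> \<in> L" "j \<le> card (set_mset X)" "\<nu> \<noteq> monomial_type X" for \<nu> X
      using power_prod_support[of \<nu> X] that by (auto simp: L_def power_index_def)
    have g_big: "mcoeff g X = (if monomial_type X \<in> L then mcoeff f X else 0)" if "j \<le> card (set_mset X)" for X
    proof -
      have "mcoeff g X = (\<Sum>\<nu>\<in>L. if \<nu> = monomial_type X then c \<nu> * mcoeff (power_prod \<nu>) X else 0)"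
        unfolding g_def mcoeff_sum mcoeff_simps by (intro sum.cong) (auto simp: other that)
      also have "\<dots> = (if monomial_type X \<in> L then
          c (monomial_type X) * mcoeff (power_prod (monomial_type X)) X else 0)"
        by (simp add: sum.delta')
      also have "\<dots> = (if monomial_type X \<in> L then mcoeff f X else 0)"
      proof (cases "monomial_type X \<in> L")
        case True
        then have *: "monomial_type (x (monomial_type X)) = monomial_type X" using x by (auto simp: L_def)
        have "mcoeff (power_prod (monomial_type X)) X > 0" by (intro power_prod_pos) auto
        moreover have "mcoeff f (x (monomial_type X)) = mcoeff f X"
          using Sym_Fun_monomial_type[OF Suc.prems(1) *] .
        moreover have "mcoeff (power_prod (monomial_type X)) (x (monomial_type X)) =
            mcoeff (power_prod (monomial_type X)) X"
          using Sym_Fun_monomial_type[OF power_prod_Sym_Fun *] .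
        ultimately show ?thesis by (simp add: c_def)
      qed simp
      finally show ?thesis .
    qed
    have "f - g \<in> mser.span (power_prod ` power_index)"
    proof (rule Suc.IH)
      show "f - g \<in> Sym_Fun" by (simp add: g_def Suc.prems)
      show "mcoeff (f - g) X = 0" if "d < size X" for X
      proof -
        have "mcoeff (power_prod \<nu>) X = 0" if "\<nu> \<in> L" for \<nu>
        proof (rule ccontr)
          assume *: "mcoeff (power_prod \<nu>) X \<noteq> 0"
          have "0 \<notin># \<nu>" using that by (auto simp: L_def power_index_def)
          from power_prod_size[OF this *] show False using that \<open>d < size X\<close> by (auto simp: L_def)
        qed
        then show ?thesis using Suc.prems(2)[OF that] by (simp add: g_def)
      qed
      show "mcoeff (f - g) X = 0" if "j \<le> card (set_mset X)" for X
      proof (cases "monomial_type X \<in> L")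
        case False
        then have "d < size X \<or> Suc j \<le> card (set_mset X)"
          using that by (auto simp: L_def power_index_def)
        then show ?thesis using Suc.prems(2,3) False by (auto simp: g_big that)
      qed (auto simp: g_big that)
    qed
    then have "f - g + g \<in> mser.span (power_prod ` power_index)" using g_span by (rule mser.span_add)
    then show ?case by simp
  qed
  show "Sym_Fun \<subseteq> mser.span (power_prod ` power_index)"
  proof
    fix f assume f: "f \<in> Sym_Fun"
    obtain d where d: "\<And>X. d < size X \<Longrightarrow> mcoeff f X = 0" using Sym_Fun_deg[OF f] by blast
    have "card (set_mset X) \<le> size X" for X :: "nat multiset"
      by (induction X) (auto simp: card_insert_if)
    then show "f \<in> mser.span (power_prod ` power_index)"
      by (intro main[OF f, of d "Suc d"]) (meson d Suc_le_lessD order_less_le_trans)+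
  qed
qed


section \<open>Plethysm\<close>

lemma rat_alg_homD:
  assumes "rat_alg_hom \<phi>"
  shows "f \<in> Sym_Fun \<Longrightarrow> \<phi> f \<in> Sym_Fun" "\<phi> 1 = 1"
    "f \<in> Sym_Fun \<Longrightarrow> g \<in> Sym_Fun \<Longrightarrow> \<phi> (f + g) = \<phi> f + \<phi> g"
    "f \<in> Sym_Fun \<Longrightarrow> g \<in> Sym_Fun \<Longrightarrow> \<phi> (f * g) = \<phi> f * \<phi> g"
    "f \<in> Sym_Fun \<Longrightarrow> \<phi> (mscale c f) = mscale c (\<phi> f)"
  using assms by (auto simp: rat_alg_hom_def)

lemma rat_alg_hom_0: "rat_alg_hom \<phi> \<Longrightarrow> \<phi> 0 = 0"
  using rat_alg_homD(5)[of \<phi> 0 0] by simp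

lemma rat_alg_hom_sum:
  assumes "rat_alg_hom \<phi>" "\<And>a. a \<in> A \<Longrightarrow> f a \<in> Sym_Fun"
  shows "\<phi> (\<Sum>a\<in>A. f a) = (\<Sum>a\<in>A. \<phi> (f a))"
  using assms(2) by (induction A rule: infinite_finite_induct)
    (auto simp: rat_alg_hom_0[OF assms(1)] rat_alg_homD(3)[OF assms(1)])

lemma rat_alg_hom_power_prod:
  assumes "rat_alg_hom \<phi>"
  shows "\<phi> (power_prod \<nu>) = (\<Prod>k\<in>#\<nu>. \<phi> (power_sum k))"
  by (induction \<nu>)
    (auto simp: power_prod_def rat_alg_homD(2)[OF assms] rat_alg_homD(4)[OF assms])

lemma rat_alg_hom_unique:
  assumes "rat_alg_hom \<phi>" "rat_alg_hom \<psi>" "\<And>k. k \<ge> 1 \<Longrightarrow> \<phi> (power_sum k) = \<psi> (power_sum k)"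
    and "f \<in> Sym_Fun"
  shows "\<phi> f = \<psi> f"
proof -
  have f: "f \<in> mser.span (power_prod ` power_index)" using assms(4) by (simp add: span_power_prod)
  have "f \<in> Sym_Fun \<and> \<phi> f = \<psi> f"
    using f
  proof (induction rule: mser.span_induct)
    case base
    show ?case
      using assms(1,2) by (auto simp: mser.subspace_def rat_alg_hom_0 rat_alg_homD)
  next
    case (step x)
    then obtain \<nu> where \<nu>: "x = power_prod \<nu>" "0 \<notin># \<nu>" by (auto simp: power_index_def)
    have "image_mset (\<lambda>k. \<phi> (power_sum k)) \<nu> = image_mset (\<lambda>k. \<psi> (power_sum k)) \<nu>"
      by (intro image_mset_cong assms(3)) (use \<nu> in \<open>auto intro: Suc_leI gr0I\<close>)
    then show ?case using assms(1,2) \<nu> by (simp add: rat_alg_hom_power_prod)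
  qed
  then show ?thesis ..
qed

text \<open>The power sums are free generators: prescribe the map on the basis of power products and
  extend linearly. It is multiplicative because the basis is closed under products, checked first
  for one factor in the basis and then for arbitrary factors.\<close>

lemma rat_alg_hom_exists:
  assumes q: "\<And>k. k \<ge> 1 \<Longrightarrow> q k \<in> Sym_Fun"
  shows "\<exists>\<phi>. rat_alg_hom \<phi> \<and> (\<forall>k\<ge>1. \<phi> (power_sum k) = q k)"
proof -
  let ?B = "power_prod ` power_index"
  obtain \<phi> where lin: "Vector_Spaces.linear mscale mscale \<phi>"
    and B: "\<And>b. b \<in> ?B \<Longrightarrow> \<phi> b = (\<Prod>k\<in>#inv_into power_index power_prod b. q k)"
    using mser_pair.linear_independent_extend[OF independent_power_prod,
        of "\<lambda>b. \<Prod>k\<in>#inv_into power_index power_prod b. q k"] by blast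
  interpret \<phi>: Vector_Spaces.linear mscale mscale \<phi> by (rule lin)
  have basis: "\<phi> (power_prod \<nu>) = (\<Prod>k\<in>#\<nu>. q k)" if "\<nu> \<in> power_index" for \<nu>
    using that by (simp add: B inv_into_f_f[OF inj_on_power_prod])
  have spanD: "f \<in> mser.span ?B" if "f \<in> Sym_Fun" for f using that by (simp add: span_power_prod)
  have mult1: "\<phi> (power_prod \<nu> * g) = \<phi> (power_prod \<nu>) * \<phi> g" if "\<nu> \<in> power_index" "g \<in> Sym_Fun" for \<nu> g
    using spanD[OF that(2)]
  proof (induction rule: mser.span_induct)
    case base
    show ?case by (auto simp: mser.subspace_def \<phi>.add \<phi>.scale distrib_left)
  next
    case (step x)
    then obtain \<mu> where \<mu>: "x = power_prod \<mu>" "\<mu> \<in> power_index" by auto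
    have "\<nu> + \<mu> \<in> power_index" "power_prod \<nu> * power_prod \<mu> = power_prod (\<nu> + \<mu>)"
      using that \<mu> by (auto simp: power_index_def power_prod_def)
    then show ?case using that(1) \<mu> by (simp add: basis)
  qed
  have mult: "\<phi> (f * g) = \<phi> f * \<phi> g" if "f \<in> Sym_Fun" "g \<in> Sym_Fun" for f g
    using spanD[OF that(1)]
  proof (induction rule: mser.span_induct)
    case base
    show ?case by (auto simp: mser.subspace_def \<phi>.add \<phi>.scale distrib_right)
  qed (use mult1 that in auto)
  have closed: "\<phi> f \<in> Sym_Fun" if "f \<in> Sym_Fun" for f
    using spanD[OF that]
  proof (induction rule: mser.span_induct)
    case base
    show ?case by (auto simp: mser.subspace_def \<phi>.add \<phi>.scale)
  next
    case (step x)
    then obtain \<mu> where \<mu>: "x = power_prod \<mu>" "\<mu> \<in> power_index" by auto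
    then have "k \<ge> 1" if "k \<in># \<mu>" for k
      using that by (auto simp: power_index_def intro: Suc_leI gr0I)
    then show ?case using \<mu> by (auto simp: basis intro!: Sym_Fun_prod_mset q)
  qed
  have "\<phi> 1 = 1"
    using basis[of "{#}"] by (simp add: power_index_def power_prod_def)
  moreover have "\<phi> (power_sum k) = q k" if "k \<ge> 1" for k
    using basis[of "{#k#}"] that by (simp add: power_index_def power_prod_def)
  ultimately show ?thesis
    using closed mult by (intro exI[of _ \<phi>]) (auto simp: rat_alg_hom_def \<phi>.add \<phi>.scale)
qed

section \<open>The Adams operations, which are plethysm with a power sum on the left\<close>

text \<open>The substitution of x_i^k for every variable x_i. For k > 0 the sum has at most one
  term, because \<open>repeat_mset k\<close> is injective; the condition
  \<open>Y \<subseteq># X\<close> then follows from the other one and makes the index set visibly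
  finite.\<close>

lift_definition adams :: "nat \<Rightarrow> mser \<Rightarrow> mser" is
  "\<lambda>k f X. \<Sum>Y | Y \<subseteq># X \<and> repeat_mset k Y = X. f Y" .

lemma mcoeff_adams_repeat [simp]:
  assumes "k > 0"
  shows "mcoeff (adams k f) (repeat_mset k Y) = mcoeff f Y"
proof -
  have "Y \<subseteq># repeat_mset k Y" using assms by (auto simp: subseteq_mset_def)
  then have "{Z. Z \<subseteq># repeat_mset k Y \<and> repeat_mset k Z = repeat_mset k Y} = {Y}"
    using assms by (auto simp: repeat_mset_cancel1)
  then show ?thesis by (simp add: adams.rep_eq)
qed

lemma mcoeff_adams_other: "X \<notin> range (repeat_mset k) \<Longrightarrow> mcoeff (adams k f) X = 0"
  by (auto simp: adams.rep_eq intro!: sum.neutral)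

lemma adams_eqI:
  assumes "k > 0" "\<And>Y. mcoeff g (repeat_mset k Y) = mcoeff f Y"
    "\<And>X. X \<notin> range (repeat_mset k) \<Longrightarrow> mcoeff g X = 0"
  shows "adams k f = g"
proof (rule mser_eqI)
  fix X show "mcoeff (adams k f) X = mcoeff g X"
    by (cases "X \<in> range (repeat_mset k)") (use assms in \<open>auto simp: mcoeff_adams_other\<close>)
qed

lemma mcoeff_adams_times:
  assumes "k > 0"
  shows "mcoeff (adams k f * g) X = (\<Sum>Y | repeat_mset k Y \<subseteq># X. mcoeff f Y * mcoeff g (X - repeat_mset k Y))"
proof -
  have inj: "inj_on (repeat_mset k) S" for S :: "nat multiset set"
    using assms by (auto simp: inj_on_def repeat_mset_cancel1)
  have "mcoeff (adams k f * g) X =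
      (\<Sum>A\<in>{A. A \<subseteq># X \<and> A \<in> range (repeat_mset k)}. mcoeff (adams k f) A * mcoeff g (X - A))"
    unfolding mcoeff_times by (rule sum.mono_neutral_right) (auto simp: finite_submsets mcoeff_adams_other)
  also have "{A. A \<subseteq># X \<and> A \<in> range (repeat_mset k)} = repeat_mset k ` {Y. repeat_mset k Y \<subseteq># X}"
    by auto
  finally show ?thesis using assms by (simp add: sum.reindex inj)
qed

lemma repeat_mset_image: "repeat_mset k (image_mset \<pi> Y) = image_mset \<pi> (repeat_mset k Y)"
  by (induction k) auto

lemma repeat_mset_subset_iff: "k > 0 \<Longrightarrow> repeat_mset k A \<subseteq># repeat_mset k B \<longleftrightarrow> A \<subseteq># B"
  by (simp add: subseteq_mset_def)

text \<open>\<open>repeat_mset k\<close> embeds the monoid of monomials and respects divisibility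
  and quotients, so a convolution of two series supported on its range is the image of the original
  convolution. A product of two elements of the range stays in the range, which gives the vanishing
  elsewhere.\<close>

lemma rat_alg_hom_adams:
  assumes "k \<ge> 1"
  shows "rat_alg_hom (adams k)"
proof -
  have k: "k > 0" using assms by simp
  have "adams k f \<in> Sym_Fun" if f: "f \<in> Sym_Fun" for f
  proof -
    obtain d where d: "\<And>X. d < size X \<Longrightarrow> mcoeff f X = 0" using Sym_Fun_deg[OF f] by blast
    show ?thesis
    proof (rule Sym_FunI[of _ "k * d"])
      fix \<pi> :: "nat \<Rightarrow> nat" and X assume \<pi>: "bij \<pi>"
      have inv: "image_mset (inv_into UNIV \<pi>) (image_mset \<pi> Y) = Y" for Y
        using \<pi> by (simp add: multiset.map_comp o_def bij_is_inj)
      show "mcoeff (adams k f) (image_mset \<pi> X) = mcoeff (adams k f) X"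
      proof (cases "X \<in> range (repeat_mset k)")
        case True
        then show ?thesis using k f \<pi> by (auto simp: repeat_mset_image[symmetric] Sym_Fun_sym)
      next
        case False
        have "image_mset \<pi> X \<notin> range (repeat_mset k)"
        proof
          assume "image_mset \<pi> X \<in> range (repeat_mset k)"
          then obtain Y where "image_mset \<pi> X = repeat_mset k Y" by auto
          then have "X = repeat_mset k (image_mset (inv_into UNIV \<pi>) Y)" by (metis inv repeat_mset_image)
          with False show False by auto
        qed
        with False show ?thesis by (simp add: mcoeff_adams_other)
      qed
    next
      fix X :: "nat multiset" assume X: "k * d < size X"
      show "mcoeff (adams k f) X = 0"
      proof (cases "X \<in> range (repeat_mset k)")
        case True
        then show ?thesis using X k d by auto
      qed (simp add: mcoeff_adams_other)
    qed
  qed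
  moreover have "adams k 1 = 1"
    using k range_eqI[of "{#}" "repeat_mset k" "{#}"]
    by (intro adams_eqI) (auto simp: repeat_mset_eq_empty_iff)
  moreover have "adams k (f + g) = adams k f + adams k g" "adams k (mscale c f) = mscale c (adams k f)" for f g c
    using k by (auto intro!: adams_eqI simp: mcoeff_adams_other)
  moreover have "adams k (f * g) = adams k f * adams k g" for f g
  proof (rule adams_eqI[OF k])
    fix Y :: "nat multiset"
    have "repeat_mset k Y - repeat_mset k A = repeat_mset k (Y - A)" for A
      by (rule multiset_eqI) (simp add: diff_mult_distrib2)
    then show "mcoeff (adams k f * adams k g) (repeat_mset k Y) = mcoeff (f * g) Y"
      using k by (simp add: mcoeff_adams_times[OF k] repeat_mset_subset_iff) (simp add: mcoeff_times)
  next
    fix X :: "nat multiset" assume X: "X \<notin> range (repeat_mset k)"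
    have "X - repeat_mset k Y \<notin> range (repeat_mset k)" if "repeat_mset k Y \<subseteq># X" for Y
    proof
      assume "X - repeat_mset k Y \<in> range (repeat_mset k)"
      then obtain Z where "X - repeat_mset k Y = repeat_mset k Z" by auto
      then have "X = repeat_mset k (Y + Z)"
        using that by (metis repeat_mset_distrib2 subset_mset.add_diff_inverse)
      with X show False by (metis rangeI)
    qed
    then show "mcoeff (adams k f * adams k g) X = 0"
      using k by (auto simp: mcoeff_adams_times mcoeff_adams_other intro!: sum.neutral)
  qed
  ultimately show ?thesis by (auto simp: rat_alg_hom_def)
qed

lemma repeat_mset_replicate [simp]: "repeat_mset k (replicate_mset l i) = replicate_mset (k * l) i"
  by (rule multiset_eqI) simp

lemma adams_power_sum:
  assumes "k \<ge> 1" "l \<ge> 1"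
  shows "adams k (power_sum l) = power_sum (k * l)"
proof (rule adams_eqI)
  fix Y :: "nat multiset"
  have "(\<exists>i. repeat_mset k Y = replicate_mset (k * l) i) \<longleftrightarrow> (\<exists>i. Y = replicate_mset l i)"
  proof
    assume "\<exists>i. repeat_mset k Y = replicate_mset (k * l) i"
    then obtain i where "repeat_mset k Y = repeat_mset k (replicate_mset l i)" by (auto simp del: repeat_mset_cancel1)
    then have "Y = replicate_mset l i \<or> k = 0" by (simp only: repeat_mset_cancel1)
    then show "\<exists>i. Y = replicate_mset l i" using assms by auto
  qed auto
  then show "mcoeff (power_sum (k * l)) (repeat_mset k Y) = mcoeff (power_sum l) Y"
    by (simp add: mcoeff_power_sum)
next
  fix X :: "nat multiset" assume X: "X \<notin> range (repeat_mset k)"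
  have "X \<noteq> replicate_mset (k * l) i" for i
    using X range_eqI[of X "repeat_mset k" "replicate_mset l i"] by auto
  then show "mcoeff (power_sum (k * l)) X = 0" by (simp add: mcoeff_power_sum)
qed (use assms in auto)

text \<open>Both sides are homomorphisms in g that send each \<open>power_sum l\<close> to
  \<open>power_sum (k * l)\<close>.\<close>

lemma is_plethysm_power_sum:
  assumes "is_plethysm pl" "k \<ge> 1" "g \<in> Sym_Fun"
  shows "pl (power_sum k) g = adams k g"
  by (rule rat_alg_hom_unique[of "\<lambda>g. pl (power_sum k) g"])
    (use assms in \<open>auto simp: is_plethysm_def rat_alg_hom_adams adams_power_sum\<close>)

text \<open>Freeness is used twice: p_k[g] is forced to be \<open>adams k g\<close> by its values on
  power sums, and then f[g] is forced by its values at f = p_k. Reading the same two steps forwards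
  constructs the operation.\<close>

lemma plethysm_ex1: "\<exists>!pl. pl \<in> Sym_Fun \<rightarrow>\<^sub>E Sym_Fun \<rightarrow>\<^sub>E Sym_Fun \<and> is_plethysm pl"
proof -
  have "\<exists>\<phi>. rat_alg_hom \<phi> \<and> (\<forall>k\<ge>1. \<phi> (power_sum k) = adams k g)" if "g \<in> Sym_Fun" for g
    using that by (intro rat_alg_hom_exists) (rule rat_alg_homD(1)[OF rat_alg_hom_adams])
  then obtain \<Phi> where \<Phi>: "\<And>g. g \<in> Sym_Fun \<Longrightarrow> rat_alg_hom (\<Phi> g)"
      "\<And>g k. g \<in> Sym_Fun \<Longrightarrow> k \<ge> 1 \<Longrightarrow> \<Phi> g (power_sum k) = adams k g"
    by metis
  define pl where "pl = (\<lambda>f\<in>Sym_Fun. \<lambda>g\<in>Sym_Fun. \<Phi> g f)"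
  \<comment> \<open>Being a homomorphism only involves values on \<open>Sym_Fun\<close>, so it
    survives the passage to the extensional version.\<close>
  have cong: "rat_alg_hom \<psi>" if "rat_alg_hom \<phi>" "\<And>f. f \<in> Sym_Fun \<Longrightarrow> \<psi> f = \<phi> f" for \<phi> \<psi>
    using that by (auto simp: rat_alg_hom_def)
  show ?thesis
  proof (rule ex1I[of _ pl])
    have "is_plethysm pl"
      unfolding is_plethysm_def
    proof (intro conjI allI impI ballI)
      fix k :: nat assume k: "k \<ge> 1"
      show "rat_alg_hom (\<lambda>g. pl (power_sum k) g)"
        by (rule cong[OF rat_alg_hom_adams[OF k]]) (use \<Phi> k in \<open>auto simp: pl_def\<close>)
    qed (use \<Phi> in \<open>auto simp: pl_def adams_power_sum intro: cong[OF \<Phi>(1)]\<close>)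
    then show "pl \<in> Sym_Fun \<rightarrow>\<^sub>E Sym_Fun \<rightarrow>\<^sub>E Sym_Fun \<and> is_plethysm pl"
      using rat_alg_homD(1)[OF \<Phi>(1)] by (auto simp: pl_def)
  next
    fix pl' assume pl': "pl' \<in> Sym_Fun \<rightarrow>\<^sub>E Sym_Fun \<rightarrow>\<^sub>E Sym_Fun \<and> is_plethysm pl'"
    show "pl' = pl"
    proof (rule PiE_ext)
      show "pl' \<in> Sym_Fun \<rightarrow>\<^sub>E Sym_Fun \<rightarrow>\<^sub>E Sym_Fun" "pl \<in> Sym_Fun \<rightarrow>\<^sub>E Sym_Fun \<rightarrow>\<^sub>E Sym_Fun"
        using pl' rat_alg_homD(1)[OF \<Phi>(1)] by (auto simp: pl_def)
      fix f assume f: "f \<in> Sym_Fun"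
      show "pl' f = pl f"
      proof (rule PiE_ext)
        show "pl' f \<in> Sym_Fun \<rightarrow>\<^sub>E Sym_Fun" "pl f \<in> Sym_Fun \<rightarrow>\<^sub>E Sym_Fun"
          using pl' f rat_alg_homD(1)[OF \<Phi>(1)] by (auto simp: pl_def)
        fix g assume g: "g \<in> Sym_Fun"
        have "pl' f g = \<Phi> g f"
          by (rule rat_alg_hom_unique[of "\<lambda>f. pl' f g"])
            (use pl' f g \<Phi> in \<open>auto simp: is_plethysm_power_sum[of pl'], auto simp: is_plethysm_def\<close>)
        then show "pl' f g = pl f g" using f g by (simp add: pl_def)
      qed
    qed
  qed
qed

lemma is_plethysm_plethysm: "is_plethysm plethysm"
  using theI'[OF plethysm_ex1] by (simp add: plethysm_def)

lemma rat_alg_hom_plethysm: "g \<in> Sym_Fun \<Longrightarrow> rat_alg_hom (\<lambda>f. plethysm f g)"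
  using is_plethysm_plethysm by (simp add: is_plethysm_def)

lemma plethysm_power_sum: "k \<ge> 1 \<Longrightarrow> g \<in> Sym_Fun \<Longrightarrow> plethysm (power_sum k) g = adams k g"
  using is_plethysm_plethysm by (rule is_plethysm_power_sum)


section \<open>The plethysm of complete homogeneous functions\<close>

text \<open>Choices of n monomials of degree m, with repetition, whose product is X. They index the
  coefficient of X when h_n is evaluated at the monomials of h_m.\<close>

definition multisets_sum :: "nat \<Rightarrow> nat \<Rightarrow> 'a multiset \<Rightarrow> 'a multiset multiset set" where
  "multisets_sum m n X = {YY \<in> multisets_of_size {Y. size Y = m} n. sum_mset YY = X}"

lemma finite_multisets_sum [simp]: "finite (multisets_sum m n X)"
proof (rule finite_subset)
  show "multisets_sum m n X \<subseteq> multisets_of_size {A. A \<subseteq># X} n"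
    by (auto simp: multisets_sum_def multisets_of_size_def dest!: multi_member_split)
qed (intro finite_multisets_of_size finite_submsets)

lemma sum_mset_replicate_mset_mset: "(\<Sum>\<^sub># (replicate_mset k Y) :: 'a multiset) = repeat_mset k Y"
  by (induction k) auto

lemma finite_repeat_subset: "k > 0 \<Longrightarrow> finite {Y. P Y \<and> repeat_mset k Y \<subseteq># X}"
proof (rule finite_subset[OF _ finite_submsets[of X]], safe)
  fix Y assume "k > 0" "repeat_mset k Y \<subseteq># X"
  moreover from this have "Y \<subseteq># repeat_mset k Y" by (auto simp: subseteq_mset_def)
  ultimately show "Y \<subseteq># X" by (meson subset_mset.order_trans)
qed

text \<open>
  Both sides count triples of a multiset \<open>YY\<close>, an element \<open>Y\<close> and a number \<open>k\<close> between \<open>1\<close>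
  and the multiplicity of \<open>Y\<close> in \<open>YY\<close>.
\<close>

lemma card_multisets_sum_newton:
  "n * card (multisets_sum m n X) =
    (\<Sum>k=1..n. \<Sum>Y | size Y = m \<and> repeat_mset k Y \<subseteq># X. card (multisets_sum m (n - k) (X - repeat_mset k Y)))"
proof -
  let ?P = "Sigma (multisets_sum m n X) (\<lambda>YY. Sigma (set_mset YY) (\<lambda>Y. {1..count YY Y}))"
  let ?Q = "Sigma {1..n} (\<lambda>k. Sigma {Y. size Y = m \<and> repeat_mset k Y \<subseteq># X}
    (\<lambda>Y. multisets_sum m (n - k) (X - repeat_mset k Y)))"
  have "card ?P = (\<Sum>YY\<in>multisets_sum m n X. \<Sum>Y\<in>set_mset YY. count YY Y)"
    by (simp add: card_SigmaI)
  also have "\<dots> = (\<Sum>YY\<in>multisets_sum m n X. n)"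
    by (intro sum.cong) (auto simp: multisets_sum_def multisets_of_size_def size_multiset_overloaded_eq)
  finally have P: "card ?P = n * card (multisets_sum m n X)" by simp
  have "bij_betw (\<lambda>(YY, Y, k). (k, Y, YY - replicate_mset k Y)) ?P ?Q"
  proof (rule bij_betw_byWitness[where f' = "\<lambda>(k, Y, ZZ). (ZZ + replicate_mset k Y, Y, k)"])
    show "(\<lambda>(YY, Y, k). (k, Y, YY - replicate_mset k Y)) ` ?P \<subseteq> ?Q"
    proof (rule image_subsetI)
      fix p assume "p \<in> ?P"
      then obtain YY Y k where p: "p = (YY, Y, k)"
        and *: "YY \<in> multisets_sum m n X" "Y \<in># YY" "1 \<le> k" "k \<le> count YY Y"
        by (elim SigmaE) auto
      have "replicate_mset k Y \<subseteq># YY" using *(4) by (simp add: count_le_replicate_mset_subset_eq)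
      then obtain ZZ where YY: "YY = replicate_mset k Y + ZZ" by (metis subset_mset.add_diff_inverse)
      have "k \<in> {1..n}" "Y \<in> {Y. size Y = m \<and> repeat_mset k Y \<subseteq># X}"
        "YY - replicate_mset k Y \<in> multisets_sum m (n - k) (X - repeat_mset k Y)"
        using * by (auto simp: YY multisets_sum_def multisets_of_size_def sum_mset_replicate_mset_mset)
      then show "(\<lambda>(YY, Y, k). (k, Y, YY - replicate_mset k Y)) p \<in> ?Q" by (simp add: p)
    qed
    show "(\<lambda>(k, Y, ZZ). (ZZ + replicate_mset k Y, Y, k)) ` ?Q \<subseteq> ?P"
      by (auto simp: multisets_sum_def multisets_of_size_def sum_mset_replicate_mset_mset)
    show "\<forall>a\<in>?P. (\<lambda>(k, Y, ZZ). (ZZ + replicate_mset k Y, Y, k))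
        ((\<lambda>(YY, Y, k). (k, Y, YY - replicate_mset k Y)) a) = a"
      by (auto simp: count_le_replicate_mset_subset_eq)
  qed auto
  then have "card ?P = card ?Q" by (rule bij_betw_same_card)
  also have "\<dots> = (\<Sum>k=1..n. \<Sum>Y | size Y = m \<and> repeat_mset k Y \<subseteq># X. card (multisets_sum m (n - k) (X - repeat_mset k Y)))"
  proof -
    have "finite (Sigma {Y. size Y = m \<and> repeat_mset k Y \<subseteq># X} (\<lambda>Y. multisets_sum m (n - k) (X - repeat_mset k Y)))"
      if "k \<in> {1..n}" for k
      using that by (intro finite_SigmaI finite_repeat_subset) auto
    then show ?thesis
      by (subst card_SigmaI) (auto intro!: sum.cong card_SigmaI finite_repeat_subset)
  qed
  finally show ?thesis using P by simp
qed

lift_definition multiset_series :: "nat \<Rightarrow> nat \<Rightarrow> mser" is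
  "\<lambda>m n X. of_nat (card (multisets_sum m n X))" .

text \<open>A one-row tableau is the sorted list of its content, so s_n is the complete function
  h_n. The case n = 0 is included, with a single empty row.\<close>

lemma mcoeff_schur_row: "mcoeff (schur [n]) X = (if size X = n then 1 else 0)"
proof -
  have "{t \<in> SSYT [n]. mset (concat t) = X} = (\<lambda>r. [r]) ` {r. length r = n \<and> sorted r \<and> mset r = X}"
    (is "?A = ?B")
  proof
    show "?A \<subseteq> ?B"
    proof
      fix t assume t: "t \<in> ?A"
      then have "map length t = [n]" by (simp add: SSYT_def)
      then obtain r where "t = [r]" "length r = n" by (auto simp: map_eq_Cons_conv)
      then show "t \<in> ?B" using t by (simp add: SSYT_def)
    qed
    show "?B \<subseteq> ?A" by (auto simp: SSYT_def)
  qed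
  moreover have "{r. length r = n \<and> sorted r \<and> mset r = X} =
      (if size X = n then {sorted_list_of_multiset X} else {})"
  proof -
    have "length r = n \<and> sorted r \<and> mset r = X \<longleftrightarrow> size X = n \<and> r = sorted_list_of_multiset X" for r
    proof
      assume *: "length r = n \<and> sorted r \<and> mset r = X"
      then show "size X = n \<and> r = sorted_list_of_multiset X"
        using sorted_sort_id[of r] sorted_list_of_multiset_mset[of r] size_mset[of r] by simp
    next
      assume "size X = n \<and> r = sorted_list_of_multiset X"
      then show "length r = n \<and> sorted r \<and> mset r = X"
        using size_mset[of r] by simp
    qed
    then show ?thesis by (cases "size X = n") simp_all
  qed
  ultimately have "{t \<in> SSYT [n]. mset (concat t) = X} =
      (if size X = n then {[sorted_list_of_multiset X]} else {})"
    by simp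
  then show ?thesis by (simp add: schur.rep_eq)
qed

lemma schur_row_Sym_Fun [simp]: "schur [n] \<in> Sym_Fun"
  by (rule Sym_FunI[of _ n]) (auto simp: mcoeff_schur_row)

text \<open>Newton's identity n h_n = \<Sum> p_k h_{n-k}, with the monomials of h_m as
  variables.\<close>

lemma multiset_series_newton:
  "mscale (of_nat n) (multiset_series m n) = (\<Sum>k=1..n. adams k (schur [m]) * multiset_series m (n - k))"
proof (rule mser_eqI)
  fix X :: "nat multiset"
  have "(\<Sum>Y | repeat_mset k Y \<subseteq># X. mcoeff (schur [m]) Y * mcoeff (multiset_series m (n - k)) (X - repeat_mset k Y)) =
      of_nat (\<Sum>Y | size Y = m \<and> repeat_mset k Y \<subseteq># X. card (multisets_sum m (n - k) (X - repeat_mset k Y)))"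
    if "k > 0" for k
    unfolding of_nat_sum using finite_repeat_subset[OF that, of "\<lambda>_. True" X]
    by (intro sum.mono_neutral_cong_right) (auto simp: mcoeff_schur_row multiset_series.rep_eq)
  then have "mcoeff (\<Sum>k=1..n. adams k (schur [m]) * multiset_series m (n - k)) X =
      of_nat (n * card (multisets_sum m n X))"
    unfolding card_multisets_sum_newton mcoeff_sum of_nat_sum
    by (intro sum.cong) (auto simp: mcoeff_adams_times)
  then show "mcoeff (mscale (of_nat n) (multiset_series m n)) X =
      mcoeff (\<Sum>k=1..n. adams k (schur [m]) * multiset_series m (n - k)) X"
    by (simp add: multiset_series.rep_eq)
qed

text \<open>Monomials of degree 1 are single variables. Thus the case m = 1 of the previous lemma is
  Newton's identity for h_n itself.\<close>

lemma multiset_series_1: "multiset_series 1 n = schur [n]"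
proof (rule mser_eqI)
  fix X :: "nat multiset"
  have *: "YY = image_mset (\<lambda>i. {#i#}) (sum_mset YY)" if "\<forall>Y\<in>#YY. size Y = 1" for YY :: "nat multiset multiset"
    using that
  proof (induction YY)
    case (add Y YY)
    then obtain i where "Y = {#i#}" using size_1_singleton_mset[of Y] by auto
    with add show ?case by simp
  qed simp
  have "YY \<in> multisets_sum 1 n X \<longleftrightarrow> size X = n \<and> YY = image_mset (\<lambda>i. {#i#}) X" for YY
  proof
    assume YY: "YY \<in> multisets_sum 1 n X"
    then have "YY = image_mset (\<lambda>i. {#i#}) X"
      using *[of YY] by (auto simp: multisets_sum_def multisets_of_size_def)
    moreover from this have "size YY = size X" by simp
    ultimately show "size X = n \<and> YY = image_mset (\<lambda>i. {#i#}) X"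
      using YY by (simp add: multisets_sum_def multisets_of_size_def)
  next
    assume YY: "size X = n \<and> YY = image_mset (\<lambda>i. {#i#}) X"
    have "sum_mset (image_mset (\<lambda>i. {#i#}) X) = X" by (induction X) auto
    then show "YY \<in> multisets_sum 1 n X"
      using YY by (auto simp: multisets_sum_def multisets_of_size_def)
  qed
  then have "multisets_sum 1 n X = (if size X = n then {image_mset (\<lambda>i. {#i#}) X} else {})"
    by (cases "size X = n") auto
  then show "mcoeff (multiset_series 1 n) X = mcoeff (schur [n]) X"
    by (simp add: multiset_series.rep_eq mcoeff_schur_row)
qed

lemma adams_schur_1: "k \<ge> 1 \<Longrightarrow> adams k (schur [1]) = power_sum k"
proof (rule adams_eqI)
  fix Y :: "nat multiset" assume k: "k \<ge> 1"
  have "(\<exists>i. repeat_mset k Y = replicate_mset k i) \<longleftrightarrow> (\<exists>i. Y = {#i#})"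
  proof
    assume "\<exists>i. repeat_mset k Y = replicate_mset k i"
    then obtain i where "repeat_mset k Y = repeat_mset k {#i#}" by auto
    then have "Y = {#i#} \<or> k = 0" by (simp only: repeat_mset_cancel1)
    then show "\<exists>i. Y = {#i#}" using k by auto
  qed auto
  then show "mcoeff (power_sum k) (repeat_mset k Y) = mcoeff (schur [1]) Y"
    using size_1_singleton_mset[of Y] by (auto simp: mcoeff_power_sum mcoeff_schur_row)
next
  fix X :: "nat multiset" assume X: "X \<notin> range (repeat_mset k)"
  have "X \<noteq> replicate_mset k i" for i
    using X range_eqI[of X "repeat_mset k" "{#i#}"] by auto
  then show "mcoeff (power_sum k) X = 0" by (simp add: mcoeff_power_sum)
qed auto

text \<open>Applying the homomorphism \<open>\<lambda>f. plethysm f (schur [m])\<close> to Newton's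
  identity for h_n yields the recursion that \<open>multiset_series m\<close> satisfies. It
  determines the n-th term because n can be divided out over the rationals.\<close>

lemma plethysm_schur_row:
  "plethysm (schur [n]) (schur [m]) = multiset_series m n"
proof (induction n rule: less_induct)
  case (less n)
  note hom = rat_alg_hom_plethysm[OF schur_row_Sym_Fun[of m]]
  show ?case
  proof (cases "n = 0")
    case True
    have "multisets_sum m 0 X = (if X = {#} then {{#}} else {})" for X :: "nat multiset"
      by (auto simp: multisets_sum_def)
    then have "schur [0] = 1" "multiset_series m 0 = 1"
      by (intro mser_eqI; simp add: mcoeff_schur_row multiset_series.rep_eq)+
    then show ?thesis using True rat_alg_homD(2)[OF hom] by simp
  next
    case False
    have "mscale (of_nat n) (plethysm (schur [n]) (schur [m])) =
        plethysm (mscale (of_nat n) (schur [n])) (schur [m])"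
      using rat_alg_homD(5)[OF hom, of "schur [n]"] by simp
    also have "mscale (of_nat n) (schur [n]) = (\<Sum>k=1..n. power_sum k * schur [n - k])"
      using multiset_series_newton[of n 1] by (simp add: multiset_series_1 adams_schur_1 flip: One_nat_def)
    also have "plethysm \<dots> (schur [m]) = (\<Sum>k=1..n. plethysm (power_sum k * schur [n - k]) (schur [m]))"
      by (rule rat_alg_hom_sum[OF hom]) simp
    also have "\<dots> = (\<Sum>k=1..n. adams k (schur [m]) * multiset_series m (n - k))"
      by (intro sum.cong) (auto simp: rat_alg_homD(4)[OF hom] plethysm_power_sum less.IH)
    also have "\<dots> = mscale (of_nat n) (multiset_series m n)"
      by (rule multiset_series_newton[symmetric])
    finally show ?thesis using False by (simp add: mser.scale_cancel_left)
  qed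
qed


section \<open>Permutations compatible with a pair of colourings\<close>

lemma ex_image_mset_mset_set:
  assumes "finite A" "size M = card A"
  shows "\<exists>w. image_mset w (mset_set A) = M"
  using assms
proof (induction A arbitrary: M rule: finite_induct)
  case (insert a A)
  then obtain x M' where M: "M = add_mset x M'" by (metis card_insert_disjoint size_eq_Suc_imp_eq_union)
  then obtain w where w: "image_mset w (mset_set A) = M'" using insert by auto
  have "image_mset (w(a := x)) (mset_set A) = image_mset w (mset_set A)"
    by (intro image_mset_cong) (use insert.hyps in auto)
  then show ?case using insert.hyps w by (intro exI[of _ "w(a := x)"]) (simp add: M fun_upd_def)
qed simp

text \<open>The permutations y with d \<circ> y = c are counted by a number depending only on how
  often each colour occurs: relabelling positions on both sides carries one set injectively into the
  other. Exchanging the roles gives equality.\<close>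

lemma card_intertwining_le:
  fixes c d c' d' :: "'i \<Rightarrow> 'z"
  assumes "finite I" "image_mset c (mset_set I) = image_mset c' (mset_set I)"
    "image_mset d (mset_set I) = image_mset d' (mset_set I)"
  shows "card {y. y permutes I \<and> (\<forall>p\<in>I. d (y p) = c p)} \<le> card {y. y permutes I \<and> (\<forall>p\<in>I. d' (y p) = c' p)}"
proof -
  obtain \<alpha> where \<alpha>: "\<alpha> permutes I" "\<forall>p\<in>I. c' p = c (\<alpha> p)"
    using image_mset_eq_implies_permutes[OF assms(1) assms(2)[symmetric]] by blast
  obtain \<beta> where \<beta>: "\<beta> permutes I" "\<forall>p\<in>I. d p = d' (\<beta> p)"
    using image_mset_eq_implies_permutes[OF assms(1,3)] by blast
  show ?thesis
  proof (rule card_inj_on_le[of "\<lambda>y. \<beta> \<circ> y \<circ> \<alpha>"])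
    show "inj_on (\<lambda>y. \<beta> \<circ> y \<circ> \<alpha>) {y. y permutes I \<and> (\<forall>p\<in>I. d (y p) = c p)}"
    proof (rule inj_onI)
      fix x y assume "\<beta> \<circ> x \<circ> \<alpha> = \<beta> \<circ> y \<circ> \<alpha>"
      then have "\<beta> (x (\<alpha> p)) = \<beta> (y (\<alpha> p))" for p by (metis comp_apply)
      then have "x (\<alpha> p) = y (\<alpha> p)" for p using permutes_inj[OF \<beta>(1)] by (auto simp: inj_def)
      then show "x = y" using permutes_surj[OF \<alpha>(1)] by (metis ext surjD)
    qed
    show "(\<lambda>y. \<beta> \<circ> y \<circ> \<alpha>) ` {y. y permutes I \<and> (\<forall>p\<in>I. d (y p) = c p)} \<subseteq>
        {y. y permutes I \<and> (\<forall>p\<in>I. d' (y p) = c' p)}"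
    proof (rule image_subsetI)
      fix y assume "y \<in> {y. y permutes I \<and> (\<forall>p\<in>I. d (y p) = c p)}"
      then have y: "y permutes I" "\<And>p. p \<in> I \<Longrightarrow> d (y p) = c p" by auto
      have "d' (\<beta> (y (\<alpha> p))) = c' p" if "p \<in> I" for p
        using that \<alpha> \<beta> y by (metis permutes_in_image)
      then show "\<beta> \<circ> y \<circ> \<alpha> \<in> {y. y permutes I \<and> (\<forall>p\<in>I. d' (y p) = c' p)}"
        using \<alpha> \<beta> y by (auto intro!: permutes_compose)
    qed
  qed (use assms(1) in \<open>simp add: finite_permutations\<close>)
qed

lemma card_intertwining:
  fixes c d c' d' :: "'i \<Rightarrow> 'z"
  assumes "finite I" "image_mset c (mset_set I) = image_mset c' (mset_set I)"
    "image_mset d (mset_set I) = image_mset d' (mset_set I)"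
  shows "card {y. y permutes I \<and> (\<forall>p\<in>I. d (y p) = c p)} = card {y. y permutes I \<and> (\<forall>p\<in>I. d' (y p) = c' p)}"
  using card_intertwining_le[OF assms] card_intertwining_le[OF assms(1) assms(2,3)[symmetric]] by simp

section \<open>Contingency tables of two colourings\<close>

text \<open>Row k of the contingency table that counts positions by their pair of colours (u, w).
  Rows are multisets so that the column colours may range over an infinite type, as they do for
  words.\<close>

definition row_mset :: "'i set \<Rightarrow> ('i \<Rightarrow> 'k) \<Rightarrow> ('i \<Rightarrow> 'l) \<Rightarrow> 'k \<Rightarrow> 'l multiset" where
  "row_mset I u w k = image_mset w (mset_set {p \<in> I. u p = k})"

lemma size_row_mset [simp]: "size (row_mset I u w k) = card {p \<in> I. u p = k}"
  by (simp add: row_mset_def)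

lemma count_pair_image:
  assumes "finite I"
  shows "count (image_mset (\<lambda>p. (u p, w p)) (mset_set I)) (k, l) = count (row_mset I u w k) l"
  using assms by (simp add: row_mset_def count_image_mset_eq_card_vimage conj_assoc)

lemma sum_row_mset:
  assumes "finite I" "finite K" "u ` I \<subseteq> K"
  shows "(\<Sum>k\<in>K. row_mset I u w k) = image_mset w (mset_set I)"
proof (rule multiset_eqI)
  fix l
  have "(\<Sum>k\<in>K. card {p \<in> I. u p = k \<and> w p = l}) = card (\<Union>k\<in>K. {p \<in> I. u p = k \<and> w p = l})"
    by (rule card_UN_disjoint[symmetric]) (use assms in auto)
  also have "(\<Union>k\<in>K. {p \<in> I. u p = k \<and> w p = l}) = {p \<in> I. w p = l}" using assms by auto
  finally show "count (\<Sum>k\<in>K. row_mset I u w k) l = count (image_mset w (mset_set I)) l"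
    using assms by (simp add: count_sum row_mset_def count_image_mset_eq_card_vimage conj_assoc)
qed

text \<open>The Young subgroup of the colour classes of u.\<close>

definition colour_stabilizer :: "'i set \<Rightarrow> ('i \<Rightarrow> 'k) \<Rightarrow> ('i \<Rightarrow> 'i) set" where
  "colour_stabilizer I u = {y. y permutes I \<and> (\<forall>p\<in>I. u (y p) = u p)}"

lemma finite_colour_stabilizer: "finite I \<Longrightarrow> finite (colour_stabilizer I u)"
  by (simp add: colour_stabilizer_def finite_permutations)

lemma card_colour_stabilizer_pos: "finite I \<Longrightarrow> card (colour_stabilizer I u) > 0"
proof -
  assume "finite I"
  moreover have "id \<in> colour_stabilizer I u" by (simp add: colour_stabilizer_def permutes_id)
  ultimately show ?thesis by (auto simp: card_gt_0_iff finite_colour_stabilizer)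
qed

text \<open>
  Used with the twists \<open>(a, l) \<mapsto> (\<sigma> a, l)\<close>, for words \<open>w\<close> fixed by \<open>y\<close> in the coset of \<open>\<sigma>\<close>, and
  \<open>(a, b) \<mapsto> (b, \<sigma> a)\<close>, which forces \<open>w = u \<circ> y\<close> and \<open>y\<^sup>2\<close> in the coset of \<open>\<sigma>\<close>.
\<close>

definition twisted_pairs ::
  "'i set \<Rightarrow> ('i \<Rightarrow> 'k) \<Rightarrow> ('k \<times> 'l \<Rightarrow> 'k \<times> 'l) \<Rightarrow> (('k \<Rightarrow> 'l multiset) \<Rightarrow> bool) \<Rightarrow>
    (('i \<Rightarrow> 'l) \<times> ('i \<Rightarrow> 'i)) set" where
  "twisted_pairs I u \<theta> Q = {(w, y). w \<in> I \<rightarrow>\<^sub>E UNIV \<and> y permutes I \<and>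
     (\<forall>p\<in>I. (u (y p), w (y p)) = \<theta> (u p, w p)) \<and> Q (row_mset I u w)}"

text \<open>Seen as a function on pairs (k, l), such a table is invariant under \<theta>. These are
  the tables that a pair (w, y) can have.\<close>

definition twisted_tables ::
  "'i set \<Rightarrow> ('i \<Rightarrow> 'k) \<Rightarrow> ('k \<times> 'l \<Rightarrow> 'k \<times> 'l) \<Rightarrow> (('k \<Rightarrow> 'l multiset) \<Rightarrow> bool) \<Rightarrow> ('k \<Rightarrow> 'l multiset) set" where
  "twisted_tables I u \<theta> Q = {Y. (\<forall>k. size (Y k) = card {p \<in> I. u p = k}) \<and>
     (\<forall>k l k' l'. \<theta> (k, l) = (k', l') \<longrightarrow> count (Y k') l' = count (Y k) l) \<and> Q Y}"

text \<open>For fixed w the number of admissible y depends only on the multisets of colour pairs at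
  source and target. As Y is \<theta>-invariant, the twist may be dropped at the source, and w may
  be replaced at the target by one fixed word \<open>w0\<close> with table Y. After this exchange y
  ranges over the whole Young subgroup and determines w.\<close>

lemma card_twisted_pairs_single:
  fixes u :: "'i \<Rightarrow> 'k" and \<theta> :: "'k \<times> 'l \<Rightarrow> 'k \<times> 'l"
  assumes I: "finite I" and \<theta>: "bij \<theta>"
    and size: "\<And>k. size (Y k) = card {p \<in> I. u p = k}"
    and inv: "\<And>k l k' l'. \<theta> (k, l) = (k', l') \<Longrightarrow> count (Y k') l' = count (Y k) l"
  shows "card (twisted_pairs I u \<theta> (\<lambda>Y'. Y' = Y)) = card (colour_stabilizer I u)"
    and "finite (twisted_pairs I u \<theta> (\<lambda>Y'. Y' = Y))"
proof -
  define W where "W = {w \<in> I \<rightarrow>\<^sub>E UNIV. row_mset I u w = Y}"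
  have "finite W"
  proof (rule finite_subset)
    show "W \<subseteq> I \<rightarrow>\<^sub>E (\<Union>p\<in>I. set_mset (Y (u p)))"
    proof
      fix w assume w: "w \<in> W"
      have "w p \<in># Y (u p)" if "p \<in> I" for p
        using w that I by (auto simp: W_def row_mset_def)
      then show "w \<in> I \<rightarrow>\<^sub>E (\<Union>p\<in>I. set_mset (Y (u p)))" using w by (auto simp: W_def PiE_iff)
    qed
  qed (use I in \<open>auto intro!: finite_PiE\<close>)
  have "\<exists>v. image_mset v (mset_set {p \<in> I. u p = k}) = Y k" for k
    using I size by (intro ex_image_mset_mset_set) auto
  then obtain v where v: "\<And>k. image_mset (v k) (mset_set {p \<in> I. u p = k}) = Y k" by metis
  define w0 where "w0 = (\<lambda>p\<in>I. v (u p) p)"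
  have row_w0: "row_mset I u w0 = Y"
  proof
    fix k
    show "row_mset I u w0 k = Y k"
      unfolding row_mset_def v[symmetric] by (intro image_mset_cong) (use I in \<open>auto simp: w0_def\<close>)
  qed
  have pair: "image_mset (\<lambda>p. (u p, w p)) (mset_set I) = image_mset (\<lambda>p. (u p, w0 p)) (mset_set I)"
    if "w \<in> W" for w
    by (rule multiset_eqI) (use that row_w0 in \<open>auto simp: count_pair_image[OF I] W_def\<close>)
  have twist: "image_mset (\<lambda>p. \<theta> (u p, w p)) (mset_set I) = image_mset (\<lambda>p. (u p, w p)) (mset_set I)"
    if "w \<in> W" for w
  proof (rule multiset_eqI)
    fix z
    obtain x where z: "z = \<theta> x" using \<theta> by (metis bij_pointE)
    let ?Z = "image_mset (\<lambda>p. (u p, w p)) (mset_set I)"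
    have "count (image_mset \<theta> ?Z) z = count ?Z x"
      unfolding z using \<theta> by (simp add: bij_is_inj count_image_mset_inj del: multiset.map_comp image_mset.compositionality)
    also have "\<dots> = count ?Z z"
    proof -
      obtain k l k' l' where *: "x = (k, l)" "z = (k', l')" by (metis surj_pair)
      have "\<theta> (k, l) = (k', l')" using z by (simp only: *)
      then show ?thesis unfolding * using inv[of k l k' l'] that by (simp add: count_pair_image[OF I] W_def)
    qed
    finally show "count (image_mset (\<lambda>p. \<theta> (u p, w p)) (mset_set I)) z = count ?Z z"
      by (simp add: multiset.map_comp o_def)
  qed
  let ?S = "\<lambda>w. {y. y permutes I \<and> (\<forall>p\<in>I. (u (y p), w (y p)) = \<theta> (u p, w p))}"
  \<comment> \<open>With \<open>w0\<close> at the target the condition reads w = w0 \<circ> y on I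
    together with invariance of u under y. Hence projecting to y is a bijection onto the
    stabilizer.\<close>
  let ?T = "\<lambda>w. {y. y permutes I \<and> (\<forall>p\<in>I. (u (y p), w0 (y p)) = (u p, w p))}"
  have eq: "twisted_pairs I u \<theta> (\<lambda>Y'. Y' = Y) = Sigma W ?S"
    by (auto simp: twisted_pairs_def W_def)
  have fin: "finite (?S w)" "finite (?T w)" for w using I by (simp_all add: finite_permutations)
  show "finite (twisted_pairs I u \<theta> (\<lambda>Y'. Y' = Y))" unfolding eq using \<open>finite W\<close> fin by auto
  have "card (Sigma W ?S) = (\<Sum>w\<in>W. card (?S w))"
    using \<open>finite W\<close> fin by (simp add: card_SigmaI)
  also have "\<dots> = (\<Sum>w\<in>W. card (?T w))"
    by (intro sum.cong card_intertwining I) (auto simp: twist pair)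
  also have "\<dots> = card (Sigma W ?T)"
    using \<open>finite W\<close> fin by (simp add: card_SigmaI)
  also have "\<dots> = card (colour_stabilizer I u)"
  proof (rule bij_betw_same_card[of snd], rule bij_betw_imageI)
    show "inj_on snd (Sigma W ?T)"
    proof (rule inj_onI)
      fix a b assume ab: "a \<in> Sigma W ?T" "b \<in> Sigma W ?T" "snd a = snd b"
      have "fst a p = fst b p" for p
        using ab by (cases "p \<in> I") (auto simp: W_def PiE_iff extensional_def)
      with ab(3) show "a = b" by (auto simp: prod_eq_iff)
    qed
    show "snd ` Sigma W ?T = colour_stabilizer I u"
    proof
      show "snd ` Sigma W ?T \<subseteq> colour_stabilizer I u" by (auto simp: colour_stabilizer_def)
      show "colour_stabilizer I u \<subseteq> snd ` Sigma W ?T"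
      proof
        fix y assume y: "y \<in> colour_stabilizer I u"
        then have y': "y permutes I" "\<And>p. p \<in> I \<Longrightarrow> u (y p) = u p" by (auto simp: colour_stabilizer_def)
        define w where "w = (\<lambda>p\<in>I. w0 (y p))"
        have "row_mset I u w k = Y k" for k
        proof -
          let ?F = "{p \<in> I. u p = k}"
          have "y ` ?F = ?F"
          proof (rule endo_inj_surj)
            show "y ` ?F \<subseteq> ?F" using y' by (auto simp: permutes_in_image)
          qed (use I permutes_inj_on[OF y'(1)] in auto)
          then have "mset_set ?F = image_mset y (mset_set ?F)"
            using permutes_inj_on[OF y'(1)] by (simp add: image_mset_mset_set)
          then have "image_mset w0 (mset_set ?F) = image_mset w0 (image_mset y (mset_set ?F))" by simp
          also have "\<dots> = image_mset w (mset_set ?F)"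
            unfolding multiset.map_comp by (intro image_mset_cong) (use I in \<open>auto simp: w_def\<close>)
          finally show ?thesis using fun_cong[OF row_w0, of k] by (simp add: row_mset_def)
        qed
        then have "w \<in> W" by (auto simp: W_def w_def)
        then have "(w, y) \<in> Sigma W ?T" using y' by (auto simp: w_def)
        then show "y \<in> snd ` Sigma W ?T" by force
      qed
    qed
  qed
  finally show "card (twisted_pairs I u \<theta> (\<lambda>Y'. Y' = Y)) = card (colour_stabilizer I u)"
    by (simp only: eq)
qed

text \<open>Reindexing by y leaves the multiset of colour pairs unchanged, while the condition on y
  says that it applies \<theta> to every pair.\<close>

lemma row_mset_in_twisted_tables:
  assumes I: "finite I" and \<theta>: "bij \<theta>" and "(w, y) \<in> twisted_pairs I u \<theta> Q"
  shows "row_mset I u w \<in> twisted_tables I u \<theta> Q"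
proof -
  have *: "y permutes I" "\<And>p. p \<in> I \<Longrightarrow> (u (y p), w (y p)) = \<theta> (u p, w p)" "Q (row_mset I u w)"
    using assms(3) by (auto simp: twisted_pairs_def)
  let ?Z = "image_mset (\<lambda>p. (u p, w p)) (mset_set I)"
  have "?Z = image_mset (\<lambda>p. (u p, w p)) (image_mset y (mset_set I))"
    using permutes_image_mset[OF *(1)] by simp
  also have "\<dots> = image_mset \<theta> ?Z"
    unfolding multiset.map_comp by (intro image_mset_cong) (use * I in auto)
  finally have Z: "?Z = image_mset \<theta> ?Z" .
  have "count (row_mset I u w k') l' = count (row_mset I u w k) l" if "\<theta> (k, l) = (k', l')" for k l k' l'
  proof -
    have "count ?Z (k', l') = count (image_mset \<theta> ?Z) (\<theta> (k, l))" using Z that by simp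
    also have "\<dots> = count ?Z (k, l)" by (rule count_image_mset_inj[OF bij_is_inj[OF \<theta>]])
    finally show ?thesis by (simp add: count_pair_image[OF I])
  qed
  then show ?thesis using *(3) by (auto simp: twisted_tables_def)
qed

text \<open>Every possible table has a fibre of the same size, the order of the Young subgroup. With
  one colour and trivial twist this is the orbit counting lemma for words.\<close>

lemma card_twisted_pairs:
  assumes I: "finite I" and \<theta>: "bij \<theta>" and fin: "finite (twisted_tables I u \<theta> Q)"
  shows "card (twisted_pairs I u \<theta> Q) = card (colour_stabilizer I u) * card (twisted_tables I u \<theta> Q)"
proof -
  let ?P = "\<lambda>Y. twisted_pairs I u \<theta> (\<lambda>Y'. Y' = Y)"
  have single: "card (?P Y) = card (colour_stabilizer I u)" "finite (?P Y)"
    if "Y \<in> twisted_tables I u \<theta> Q" for Y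
    using that by (auto intro!: card_twisted_pairs_single[OF I \<theta>] simp: twisted_tables_def)
  have "twisted_pairs I u \<theta> Q = (\<Union>Y\<in>twisted_tables I u \<theta> Q. ?P Y)"
  proof (intro equalityI subsetI)
    fix z assume z: "z \<in> twisted_pairs I u \<theta> Q"
    obtain w y where wy: "z = (w, y)" by fastforce
    have "row_mset I u w \<in> twisted_tables I u \<theta> Q"
      using row_mset_in_twisted_tables[OF I \<theta>] z unfolding wy by blast
    moreover have "z \<in> ?P (row_mset I u w)" using z by (auto simp: wy twisted_pairs_def)
    ultimately show "z \<in> (\<Union>Y\<in>twisted_tables I u \<theta> Q. ?P Y)" by blast
  next
    fix z assume "z \<in> (\<Union>Y\<in>twisted_tables I u \<theta> Q. ?P Y)"
    then show "z \<in> twisted_pairs I u \<theta> Q" by (auto simp: twisted_pairs_def twisted_tables_def)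
  qed
  also have "card \<dots> = (\<Sum>Y\<in>twisted_tables I u \<theta> Q. card (?P Y))"
    using fin single(2) by (intro card_UN_disjoint) (auto simp: twisted_pairs_def)
  finally show ?thesis using single(1) by simp
qed


section \<open>Power sums of permutations\<close>

text \<open>A word fixed by h chooses one variable for each cycle, so this is the power sum product
  of the cycle type of h. The description by words keeps cycle types out of the proof.\<close>

lift_definition perm_series :: "nat \<Rightarrow> (nat \<Rightarrow> nat) \<Rightarrow> mser" is
  "\<lambda>N h X. of_nat (card {w \<in> {..<N} \<rightarrow>\<^sub>E UNIV. image_mset w (mset_set {..<N}) = X \<and> (\<forall>p<N. w (h p) = w p)})" .

definition square_roots :: "nat \<Rightarrow> (nat \<Rightarrow> nat) \<Rightarrow> nat" where
  "square_roots N h = card {x. x permutes {..<N} \<and> x \<circ> x = h}"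

text \<open>If nonempty, a coset of the Young subgroup of u: its elements induce \<sigma> on the
  colours. For colour classes that are blocks of equal size these are the elements of the wreath
  product lying over \<sigma>.\<close>

definition colour_coset :: "nat \<Rightarrow> (nat \<Rightarrow> nat) \<Rightarrow> (nat \<Rightarrow> nat) \<Rightarrow> (nat \<Rightarrow> nat) set" where
  "colour_coset N u \<sigma> = {h. h permutes {..<N} \<and> (\<forall>p<N. u (h p) = \<sigma> (u p))}"

lemma colour_coset_id: "colour_coset N u id = colour_stabilizer {..<N} u"
  by (auto simp: colour_coset_def colour_stabilizer_def)

lemma finite_colour_coset [simp]: "finite (colour_coset N u \<sigma>)"
  by (rule finite_subset[of _ "{h. h permutes {..<N}}"]) (auto simp: colour_coset_def finite_permutations)

text \<open>In both kinds of tables, \<open>Y a\<close> is row \<open>a\<close> of a matrix, as a multiset of column indices.\<close>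

definition fixed_tables :: "nat \<Rightarrow> (nat \<Rightarrow> nat) \<Rightarrow> (nat \<Rightarrow> nat) \<Rightarrow> 'l multiset \<Rightarrow> (nat \<Rightarrow> 'l multiset) set" where
  "fixed_tables k \<alpha> \<sigma> X = {Y. (\<forall>a. size (Y a) = \<alpha> a) \<and> (\<forall>a. Y (\<sigma> a) = Y a) \<and> (\<Sum>a<k. Y a) = X}"

definition symmetric_tables :: "(nat \<Rightarrow> nat) \<Rightarrow> (nat \<Rightarrow> nat) \<Rightarrow> (nat \<Rightarrow> nat multiset) set" where
  "symmetric_tables \<alpha> \<sigma> = {Y. (\<forall>a. size (Y a) = \<alpha> a) \<and> (\<forall>a b. count (Y b) (\<sigma> a) = count (Y a) b)}"

lemma finite_words:
  fixes N :: nat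
  shows "finite {w \<in> {..<N} \<rightarrow>\<^sub>E UNIV. image_mset w (mset_set {..<N}) = X \<and> P w}"
proof (rule finite_subset)
  show "{w \<in> {..<N} \<rightarrow>\<^sub>E UNIV. image_mset w (mset_set {..<N}) = X \<and> P w} \<subseteq> {..<N} \<rightarrow>\<^sub>E set_mset X"
    by (auto simp: PiE_def)
qed (auto intro!: finite_PiE)

lemma finite_fixed_tables:
  assumes "\<And>a. a \<ge> k \<Longrightarrow> \<alpha> a = 0"
  shows "finite (fixed_tables k \<alpha> \<sigma> X)"
proof (rule finite_subset)
  have "Y a \<subseteq># (\<Sum>a<k. Y a)" if "a < k" for Y :: "nat \<Rightarrow> 'a multiset" and a
    using that by (subst sum.remove[of _ a]) auto
  moreover have "Y a = {#}" if "\<forall>a. size (Y a) = \<alpha> a" "\<not> a < k" for Y :: "nat \<Rightarrow> 'a multiset" and a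
    using that assms[of a] by (metis linorder_not_less size_eq_0_iff_empty)
  ultimately show "fixed_tables k \<alpha> \<sigma> X \<subseteq>
      {Y. \<forall>a. (a \<in> {..<k} \<longrightarrow> Y a \<in> {A. A \<subseteq># X}) \<and> (a \<notin> {..<k} \<longrightarrow> Y a = {#})}"
    using assms by (auto simp: fixed_tables_def)
qed (intro finite_set_of_finite_funs finite_submsets finite_lessThan)

lemma finite_symmetric_tables:
  assumes "\<And>a. a \<ge> k \<Longrightarrow> \<alpha> a = 0"
  shows "finite (symmetric_tables \<alpha> \<sigma>)"
proof (rule finite_subset)
  show "symmetric_tables \<alpha> \<sigma> \<subseteq>
      {Y. \<forall>a. (a \<in> {..<k} \<longrightarrow> Y a \<in> (\<Union>a<k. multisets_of_size {..<k} (\<alpha> a))) \<and> (a \<notin> {..<k} \<longrightarrow> Y a = {#})}"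
  proof (intro subsetI CollectI allI conjI impI)
    fix Y a assume Y: "Y \<in> symmetric_tables \<alpha> \<sigma>"
    {
      assume a: "a \<in> {..<k}"
      \<comment> \<open>The twisted symmetry turns an entry in column b into an entry of row b,
        which is empty for b \<ge> k.\<close>
      have "b < k" if "b \<in># Y a" for b
      proof (rule ccontr)
        assume "\<not> b < k"
        then have "size (Y b) = 0" using assms[of b] Y by (simp add: symmetric_tables_def)
        then have "count (Y b) (\<sigma> a) = 0" by simp
        then have "count (Y a) b = 0" using Y by (simp add: symmetric_tables_def)
        then show False using that by (simp add: count_eq_zero_iff)
      qed
      then show "Y a \<in> (\<Union>a<k. multisets_of_size {..<k} (\<alpha> a))"
        using Y a by (auto simp: symmetric_tables_def multisets_of_size_def)
    next
      assume "a \<notin> {..<k}"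
      then have "size (Y a) = 0" using assms[of a] Y by (simp add: symmetric_tables_def)
      then show "Y a = {#}" by simp
    }
  qed
qed (intro finite_set_of_finite_funs finite_UN_I finite_multisets_of_size finite_lessThan)

text \<open>A double count of the pairs of a permutation h in the coset and a word fixed by h, the
  words being sorted by their table. For \<sigma> = id it expresses the product of complete
  functions as an average of power sums.\<close>

lemma sum_perm_series_coset:
  assumes \<sigma>: "bij \<sigma>" and u: "\<And>p. p < N \<Longrightarrow> u p < k"
  shows "(\<Sum>h\<in>colour_coset N u \<sigma>. mcoeff (perm_series N h) X) =
    of_nat (card (colour_stabilizer {..<N} u) * card (fixed_tables k (\<lambda>a. card {p\<in>{..<N}. u p = a}) \<sigma> X))"
proof -
  let ?\<theta> = "\<lambda>(a, l::nat). (\<sigma> a, l)"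
  let ?Q = "\<lambda>Y. (\<Sum>a<k. Y a) = X"
  have bij: "bij ?\<theta>"
    using \<sigma> by (auto simp: bij_def inj_def surj_def)
  have tables: "twisted_tables {..<N} u ?\<theta> ?Q = fixed_tables k (\<lambda>a. card {p\<in>{..<N}. u p = a}) \<sigma> X"
    by (auto simp: twisted_tables_def fixed_tables_def multiset_eq_iff)
  have fin: "finite (fixed_tables k (\<lambda>a. card {p\<in>{..<N}. u p = a}) \<sigma> X)"
  proof (rule finite_fixed_tables)
    show "card {p \<in> {..<N}. u p = a} = 0" if "a \<ge> k" for a using that u by fastforce
  qed
  have rows: "(\<Sum>a<k. row_mset {..<N} u w a) = image_mset w (mset_set {..<N})" for w :: "nat \<Rightarrow> nat"
    using u by (intro sum_row_mset) auto
  let ?W = "\<lambda>h. {w \<in> {..<N} \<rightarrow>\<^sub>E UNIV. image_mset w (mset_set {..<N}) = X \<and> (\<forall>p<N. w (h p) = w p)}"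
  have "twisted_pairs {..<N} u ?\<theta> ?Q = (Sigma (colour_coset N u \<sigma>) ?W)\<inverse>"
    by (auto simp: twisted_pairs_def rows colour_coset_def)
  then have "card (twisted_pairs {..<N} u ?\<theta> ?Q) = card (Sigma (colour_coset N u \<sigma>) ?W)"
    by (simp add: card_inverse)
  also have "\<dots> = (\<Sum>h\<in>colour_coset N u \<sigma>. card (?W h))"
    by (intro card_SigmaI) (auto simp: finite_words)
  finally have "(\<Sum>h\<in>colour_coset N u \<sigma>. card (?W h)) =
      card (colour_stabilizer {..<N} u) * card (fixed_tables k (\<lambda>a. card {p\<in>{..<N}. u p = a}) \<sigma> X)"
    using card_twisted_pairs[OF _ bij, of "{..<N}" u ?Q] fin by (simp add: tables)
  then show ?thesis by (simp add: perm_series.rep_eq flip: of_nat_sum)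
qed

text \<open>For x with x^2 in the coset put w = u \<circ> x. Entry (a, b) of the table counts the
  positions moved by x from colour a to colour b; x carries them to positions moved from b to
  \<sigma> a, which is the symmetry of the table. Conversely, the twisted condition forces w = u
  \<circ> x.\<close>

lemma sum_square_roots_coset:
  assumes \<sigma>: "bij \<sigma>" and u: "\<And>p. p < N \<Longrightarrow> u p < k"
  shows "(\<Sum>h\<in>colour_coset N u \<sigma>. square_roots N h) =
    card (colour_stabilizer {..<N} u) * card (symmetric_tables (\<lambda>a. card {p\<in>{..<N}. u p = a}) \<sigma>)"
proof -
  let ?\<theta> = "\<lambda>(a, b). (b, \<sigma> a)"
  let ?Q = "\<lambda>Y. True"
  have bij: "bij ?\<theta>"
    using \<sigma> by (auto simp: bij_def inj_def surj_def)
  have tables: "twisted_tables {..<N} u ?\<theta> ?Q = symmetric_tables (\<lambda>a. card {p\<in>{..<N}. u p = a}) \<sigma>"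
    by (auto simp: twisted_tables_def symmetric_tables_def)
  have fin: "finite (symmetric_tables (\<lambda>a. card {p\<in>{..<N}. u p = a}) \<sigma>)"
  proof (rule finite_symmetric_tables)
    show "card {p \<in> {..<N}. u p = a} = 0" if "a \<ge> k" for a using that u by fastforce
  qed
  let ?R = "\<lambda>h. {x. x permutes {..<N} \<and> x \<circ> x = h}"
  let ?S = "\<Union>h\<in>colour_coset N u \<sigma>. ?R h"
  have S: "?S = {x. x permutes {..<N} \<and> (\<forall>p<N. u (x (x p)) = \<sigma> (u p))}"
    by (auto simp: colour_coset_def permutes_compose)
  have "bij_betw (\<lambda>x. (\<lambda>p\<in>{..<N}. u (x p), x)) ?S (twisted_pairs {..<N} u ?\<theta> ?Q)"
    unfolding S
  proof (rule bij_betw_byWitness[where f' = snd])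
    show "(\<lambda>x. (\<lambda>p\<in>{..<N}. u (x p), x)) ` {x. x permutes {..<N} \<and> (\<forall>p<N. u (x (x p)) = \<sigma> (u p))} \<subseteq>
        twisted_pairs {..<N} u ?\<theta> ?Q"
    proof (rule image_subsetI)
      fix x assume "x \<in> {x. x permutes {..<N} \<and> (\<forall>p<N. u (x (x p)) = \<sigma> (u p))}"
      moreover from this have "x p < N" if "p < N" for p
        using that permutes_in_image[of x "{..<N}" p] by auto
      ultimately show "(\<lambda>p\<in>{..<N}. u (x p), x) \<in> twisted_pairs {..<N} u ?\<theta> ?Q"
        by (auto simp: twisted_pairs_def)
    qed
    have *: "w p = u (x p)" "u (x (x p)) = \<sigma> (u p)"
      if "(w, x) \<in> twisted_pairs {..<N} u ?\<theta> ?Q" "p < N" for w x p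
    proof -
      have "x p < N" using that permutes_in_image[of x "{..<N}" p] by (auto simp: twisted_pairs_def)
      then show "w p = u (x p)" "u (x (x p)) = \<sigma> (u p)"
        using that by (auto simp: twisted_pairs_def)
    qed
    show "\<forall>z\<in>twisted_pairs {..<N} u ?\<theta> ?Q. (\<lambda>p\<in>{..<N}. u (snd z p), snd z) = z"
    proof (clarify, simp, rule ext)
      fix w x p assume z: "(w, x) \<in> twisted_pairs {..<N} u ?\<theta> ?Q"
      show "(\<lambda>p\<in>{..<N}. u (x p)) p = w p"
        using *[OF z, of p] z by (cases "p < N") (auto simp: twisted_pairs_def PiE_iff extensional_def)
    qed
    show "snd ` twisted_pairs {..<N} u ?\<theta> ?Q \<subseteq> {x. x permutes {..<N} \<and> (\<forall>p<N. u (x (x p)) = \<sigma> (u p))}"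
    proof (rule image_subsetI)
      fix z assume z: "z \<in> twisted_pairs {..<N} u ?\<theta> ?Q"
      obtain w x where [simp]: "z = (w, x)" by fastforce
      have "x permutes {..<N}" using z by (simp add: twisted_pairs_def)
      then show "snd z \<in> {x. x permutes {..<N} \<and> (\<forall>p<N. u (x (x p)) = \<sigma> (u p))}"
        using *(2)[of w x] z by simp
    qed
  qed auto
  then have "card ?S = card (twisted_pairs {..<N} u ?\<theta> ?Q)" by (rule bij_betw_same_card)
  moreover have "card ?S = (\<Sum>h\<in>colour_coset N u \<sigma>. card (?R h))"
    by (intro card_UN_disjoint) (auto simp: finite_permutations)
  ultimately show ?thesis
    using card_twisted_pairs[OF _ bij, of "{..<N}" u ?Q] fin by (simp add: tables square_roots_def)
qed


section \<open>Horizontal strips and the local rule of the Robinson-Schensted-Knuth correspondence\<close>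

text \<open>Partitions as decreasing functions with finite support, so that no lengths have to be
  tracked when rows are added or emptied.\<close>

definition shapes :: "(nat \<Rightarrow> nat) set" where
  "shapes = {f. antimono f \<and> (\<exists>L. \<forall>i\<ge>L. f i = 0)}"

definition psize :: "(nat \<Rightarrow> nat) \<Rightarrow> nat" where
  "psize f = (\<Sum>i | f i \<noteq> 0. f i)"

text \<open>Interlacing g 0 \<ge> f 0 \<ge> g 1 \<ge> f 1 \<ge> ..., that is, the skew shape g/f has
  at most one box in each column.\<close>

definition hstrip :: "(nat \<Rightarrow> nat) \<Rightarrow> (nat \<Rightarrow> nat) \<Rightarrow> bool" where
  "hstrip f g \<longleftrightarrow> (\<forall>i. f i \<le> g i \<and> g (Suc i) \<le> f i)"

definition shapes_of_size :: "nat \<Rightarrow> (nat \<Rightarrow> nat) set" where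
  "shapes_of_size n = {f \<in> shapes. psize f = n}"

definition up :: "nat \<Rightarrow> (nat \<Rightarrow> nat) \<Rightarrow> (nat \<Rightarrow> nat) set" where
  "up a f = {g \<in> shapes. hstrip f g \<and> psize g = psize f + a}"

definition down :: "nat \<Rightarrow> (nat \<Rightarrow> nat) \<Rightarrow> (nat \<Rightarrow> nat) set" where
  "down a g = {f \<in> shapes. hstrip f g \<and> psize g = psize f + a}"

lemma psize_eq:
  assumes "\<And>i. i \<ge> L \<Longrightarrow> f i = 0"
  shows "psize f = (\<Sum>i<L. f i)"
  unfolding psize_def
proof (rule sum.mono_neutral_left)
  show "{i. f i \<noteq> 0} \<subseteq> {..<L}"
  proof
    fix i assume i: "i \<in> {i. f i \<noteq> 0}"
    show "i \<in> {..<L}"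
    proof (rule ccontr)
      assume "i \<notin> {..<L}"
      then have "L \<le> i" by simp
      then show False using assms[of i] i by simp
    qed
  qed
qed auto

lemma shapesI:
  assumes "\<And>i. f (Suc i) \<le> f i" "\<And>i. i \<ge> L \<Longrightarrow> f i = 0"
  shows "f \<in> shapes"
  unfolding shapes_def
proof (intro CollectI conjI exI[of _ L] allI impI)
  show "antimono f" using assms(1) by (simp add: antimono_iff_le_Suc)
qed (rule assms(2))

lemma shapes_antimono: "f \<in> shapes \<Longrightarrow> i \<le> j \<Longrightarrow> f j \<le> f i"
  unfolding shapes_def by (blast dest: antimonoD)

lemma shapes_support: "f \<in> shapes \<Longrightarrow> \<exists>L. \<forall>i\<ge>L. f i = 0"
  by (simp add: shapes_def)

lemma shapes_zero_beyond_size: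
  assumes "f \<in> shapes" "psize f \<le> i"
  shows "f i = 0"
proof (rule ccontr)
  assume "f i \<noteq> 0"
  obtain L where L: "\<forall>i\<ge>L. f i = 0" using shapes_support[OF assms(1)] by blast
  have "i < L" using L \<open>f i \<noteq> 0\<close> by (cases "i < L") auto
  have "Suc i = (\<Sum>j<Suc i. 1)" by simp
  also have "\<dots> \<le> (\<Sum>j<Suc i. f j)"
  proof (rule sum_mono)
    fix j assume "j \<in> {..<Suc i}"
    then have "f i \<le> f j" using shapes_antimono[OF assms(1), of j i] by simp
    then show "1 \<le> f j" using \<open>f i \<noteq> 0\<close> by simp
  qed
  also have "\<dots> \<le> (\<Sum>j<L. f j)" by (rule sum_mono2) (use \<open>i < L\<close> in auto)
  also have "\<dots> = psize f" using L by (simp add: psize_eq[of L f])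
  finally show False using assms(2) by simp
qed

lemma shapes_le_size:
  assumes "f \<in> shapes"
  shows "f i \<le> psize f"
proof -
  obtain L where L: "\<forall>i\<ge>L. f i = 0" using shapes_support[OF assms] by blast
  show ?thesis
  proof (cases "i < L")
    case True
    then have "f i \<le> (\<Sum>j<L. f j)" by (intro member_le_sum) auto
    then show ?thesis using psize_eq[of L f] L by simp
  qed (use L in auto)
qed

lemma finite_shapes_of_size [simp]: "finite (shapes_of_size n)"
proof (rule finite_subset)
  show "shapes_of_size n \<subseteq> {f. \<forall>i. (i \<in> {..<n} \<longrightarrow> f i \<in> {..n}) \<and> (i \<notin> {..<n} \<longrightarrow> f i = 0)}"
  proof (intro subsetI CollectI allI conjI impI)
    fix f i assume "f \<in> shapes_of_size n"
    then have f: "f \<in> shapes" "psize f = n" by (auto simp: shapes_of_size_def)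
    show "f i \<in> {..n}" using shapes_le_size[OF f(1), of i] f(2) by simp
    show "f i = 0" if "i \<notin> {..<n}" using shapes_zero_beyond_size[OF f(1), of i] f(2) that by simp
  qed
qed (intro finite_set_of_finite_funs finite_lessThan finite_atMost)

lemma finite_up [simp]: "finite (up a f)"
  by (rule finite_subset[OF _ finite_shapes_of_size[of "psize f + a"]])
    (auto simp: up_def shapes_of_size_def)

lemma finite_down [simp]: "finite (down a f)"
  by (rule finite_subset[OF _ finite_shapes_of_size[of "psize f - a"]])
    (auto simp: down_def shapes_of_size_def)

lemma psize_mono:
  assumes "f \<in> shapes" "g \<in> shapes" "\<And>i. f i \<le> g i"
  shows "psize f \<le> psize g"
proof -
  obtain L M where "\<forall>i\<ge>L. f i = 0" "\<forall>i\<ge>M. g i = 0" using shapes_support assms(1,2) by metis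
  then have "psize f = (\<Sum>i<max L M. f i)" "psize g = (\<Sum>i<max L M. g i)"
    by (auto intro!: psize_eq)
  then show ?thesis using assms(3) by (auto intro: sum_mono)
qed

text \<open>
  One cell of a growth diagram: \<open>f\<close> and \<open>g\<close> are adjacent to both corners \<open>e\<close> (lower) and \<open>h\<close> (upper),
  and \<open>j\<close> is the matrix entry of the cell.
\<close>

definition local_rule :: "(nat \<Rightarrow> nat) \<Rightarrow> (nat \<Rightarrow> nat) \<Rightarrow> (nat \<Rightarrow> nat) \<Rightarrow> nat \<Rightarrow> (nat \<Rightarrow> nat) \<Rightarrow> bool" where
  "local_rule f g e j h \<longleftrightarrow> h 0 = j + max (f 0) (g 0) \<and>
     (\<forall>i. h (Suc i) + e i = max (f (Suc i)) (g (Suc i)) + min (f i) (g i))"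

text \<open>The local rule solved for the upper corner, and next for the lower one. The truncated
  subtractions are exact when the strip conditions hold, as \<open>local_rule_up\<close> and
  \<open>local_rule_down\<close> show.\<close>

definition local_up :: "(nat \<Rightarrow> nat) \<Rightarrow> (nat \<Rightarrow> nat) \<Rightarrow> (nat \<Rightarrow> nat) \<Rightarrow> nat \<Rightarrow> nat \<Rightarrow> nat" where
  "local_up f g e j i = (case i of 0 \<Rightarrow> j + max (f 0) (g 0)
     | Suc i \<Rightarrow> max (f (Suc i)) (g (Suc i)) + min (f i) (g i) - e i)"

definition local_down :: "(nat \<Rightarrow> nat) \<Rightarrow> (nat \<Rightarrow> nat) \<Rightarrow> (nat \<Rightarrow> nat) \<Rightarrow> nat \<Rightarrow> nat" where
  "local_down f g h i = max (f (Suc i)) (g (Suc i)) + min (f i) (g i) - h (Suc i)"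

lemma local_rule_up:
  assumes "hstrip e f" "hstrip e g"
  shows "local_rule f g e j (local_up f g e j)"
proof -
  have "e i \<le> min (f i) (g i)" for i using assms by (simp add: hstrip_def)
  then have "e i \<le> max (f (Suc i)) (g (Suc i)) + min (f i) (g i)" for i by (meson trans_le_add2)
  then show ?thesis by (simp add: local_rule_def local_up_def)
qed

lemma local_rule_down:
  assumes "hstrip f h" "hstrip g h"
  shows "local_rule f g (local_down f g h) (h 0 - max (f 0) (g 0)) h"
proof -
  have "h (Suc i) \<le> min (f i) (g i)" for i using assms by (simp add: hstrip_def)
  then have "h (Suc i) \<le> max (f (Suc i)) (g (Suc i)) + min (f i) (g i)" for i by (meson trans_le_add2)
  moreover have "max (f 0) (g 0) \<le> h 0" using assms by (simp add: hstrip_def)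
  ultimately show ?thesis by (simp add: local_rule_def local_down_def)
qed

lemma local_rule_unique_up:
  assumes "local_rule f g e j h" "local_rule f g e j h'"
  shows "h = h'"
proof
  fix i show "h i = h' i"
    using assms by (cases i) (auto simp: local_rule_def, metis add_right_cancel)
qed

lemma local_rule_unique_down:
  assumes "local_rule f g e j h" "local_rule f g e' j' h"
  shows "e = e'" "j = j'"
proof -
  show "e = e'"
  proof
    fix i show "e i = e' i" using assms by (auto simp: local_rule_def) (metis add_left_cancel)
  qed
  show "j = j'" using assms by (auto simp: local_rule_def)
qed

text \<open>The strip conditions confine \<open>e i\<close> to the interval from max (f (i+1)) (g
  (i+1)) to min (f i) (g i), and they confine \<open>h (i+1)\<close> to the same interval. The rule
  reflects this interval. Only \<open>h 0\<close> is unbounded above, and j records its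
  excess.\<close>

lemma local_rule_hstrip_iff:
  assumes "local_rule f g e j h"
  shows "hstrip e f \<and> hstrip e g \<longleftrightarrow> hstrip f h \<and> hstrip g h"
proof -
  have h0: "h 0 = j + max (f 0) (g 0)"
    and h: "h (Suc i) + e i = max (f (Suc i)) (g (Suc i)) + min (f i) (g i)" for i
    using assms by (auto simp: local_rule_def)
  have "f i \<le> h i \<and> g i \<le> h i \<and> h (Suc i) \<le> f i \<and> h (Suc i) \<le> g i"
    if "\<And>i. e i \<le> f i \<and> e i \<le> g i \<and> f (Suc i) \<le> e i \<and> g (Suc i) \<le> e i" for i
  proof (cases i)
    case 0
    then show ?thesis using h0 h[of 0] that[of 0] by (auto simp: max_def min_def split: if_splits)
  next
    case (Suc k)
    then show ?thesis using h[of k] h[of i] that[of k] that[of i] by (auto simp: max_def min_def split: if_splits)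
  qed
  moreover have "e i \<le> f i \<and> e i \<le> g i \<and> f (Suc i) \<le> e i \<and> g (Suc i) \<le> e i"
    if "\<And>i. f i \<le> h i \<and> g i \<le> h i \<and> h (Suc i) \<le> f i \<and> h (Suc i) \<le> g i" for i
    using h[of i] that[of i] that[of "Suc i"] by (auto simp: max_def min_def split: if_splits)
  ultimately show ?thesis unfolding hstrip_def by meson
qed

text \<open>Sum the rule over all rows. The maxima are shifted by one row against the minima and
  \<open>h 0\<close> supplies the missing one; then max + min = f + g in each row.\<close>

lemma local_rule_psize:
  assumes "local_rule f g e j h" "f \<in> shapes" "g \<in> shapes" "e \<in> shapes"
  shows "psize h + psize e = psize f + psize g + j"
proof -
  have h0: "h 0 = j + max (f 0) (g 0)"
    and h: "h (Suc i) + e i = max (f (Suc i)) (g (Suc i)) + min (f i) (g i)" for i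
    using assms(1) by (auto simp: local_rule_def)
  obtain L1 L2 L3 where L': "\<forall>i\<ge>L1. f i = 0" "\<forall>i\<ge>L2. g i = 0" "\<forall>i\<ge>L3. e i = 0"
    using shapes_support assms(2-) by metis
  define L where "L = Max {L1, L2, L3}"
  have L: "f i = 0" "g i = 0" "e i = 0" if "i \<ge> L" for i using that L' by (auto simp: L_def)
  have hL: "h i = 0" if "i \<ge> Suc L" for i
    using that h[of "i - 1"] L[of i] L[of "i - 1"] by (cases i) auto
  have "psize h + psize e = (\<Sum>i<Suc L. h i) + (\<Sum>i<L. e i)"
    using psize_eq[of "Suc L" h, OF hL] psize_eq[of L e] L by simp
  also have "\<dots> = h 0 + (\<Sum>i<L. h (Suc i) + e i)"
    by (subst sum.lessThan_Suc_shift) (simp add: sum.distrib)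
  also have "\<dots> = j + ((max (f 0) (g 0) + (\<Sum>i<L. max (f (Suc i)) (g (Suc i)))) + (\<Sum>i<L. min (f i) (g i)))"
    by (simp add: h h0 sum.distrib)
  also have "max (f 0) (g 0) + (\<Sum>i<L. max (f (Suc i)) (g (Suc i))) = (\<Sum>i<Suc L. max (f i) (g i))"
    by (subst sum.lessThan_Suc_shift) simp
  also have "\<dots> = (\<Sum>i<L. max (f i) (g i))" using L[of L] by simp
  also have "\<dots> + (\<Sum>i<L. min (f i) (g i)) = (\<Sum>i<L. f i) + (\<Sum>i<L. g i)"
    by (simp add: sum.distrib[symmetric] max_def min_def if_distrib add.commute cong: if_cong)
  also have "\<dots> = psize f + psize g" using psize_eq[of L f] psize_eq[of L g] L by simp
  finally show ?thesis by simp
qed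

lemma hstrip_shapes_lower:
  assumes "hstrip e f" "f \<in> shapes"
  shows "e \<in> shapes"
proof -
  obtain L where "\<forall>i\<ge>L. f i = 0" using shapes_support[OF assms(2)] by blast
  then have "e i = 0" if "i \<ge> L" for i using that assms(1) by (metis hstrip_def le_zero_eq)
  moreover have "e (Suc i) \<le> e i" for i using assms(1) unfolding hstrip_def by (meson order_trans)
  ultimately show ?thesis by (rule shapesI[rotated])
qed

lemma hstrip_shapes_upper:
  assumes "hstrip f h" "f \<in> shapes"
  shows "h \<in> shapes"
proof -
  obtain L where L: "\<forall>i\<ge>L. f i = 0" using shapes_support[OF assms(2)] by blast
  have "h i = 0" if "i \<ge> Suc L" for i
  proof (cases i)
    case (Suc k)
    then have "f k = 0" using that L by simp
    then show ?thesis using assms(1) Suc by (metis hstrip_def le_zero_eq)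
  qed (use that in simp)
  moreover have "h (Suc i) \<le> h i" for i using assms(1) unfolding hstrip_def by (meson order_trans)
  ultimately show ?thesis by (rule shapesI[rotated])
qed

text \<open>The commutation rule D_a U_b = \<Sum>_j U_{b-j} D_{a-j} for adding and removing
  horizontal strips. The local rule is the bijection behind it, with j the entry of the
  cell.\<close>

lemma sum_up_down:
  fixes F :: "(nat \<Rightarrow> nat) \<Rightarrow> nat"
  assumes f: "f \<in> shapes"
  shows "(\<Sum>h\<in>up b f. \<Sum>g\<in>down a h. F g) =
    (\<Sum>j\<le>min a b. \<Sum>e\<in>down (a - j) f. \<Sum>g\<in>up (b - j) e. F g)"
proof -
  let ?P = "Sigma (up b f) (down a)"
  let ?Q = "Sigma {..min a b} (\<lambda>j. Sigma (down (a - j) f) (up (b - j)))"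
  have "(\<Sum>h\<in>up b f. \<Sum>g\<in>down a h. F g) = (\<Sum>(h, g)\<in>?P. F g)"
    by (simp add: sum.Sigma)
  also have "\<dots> = (\<Sum>(j, e, g)\<in>?Q. F g)"
  proof (rule sum.reindex_bij_witness[where i = "\<lambda>(j, e, g). (local_up f g e j, g)"
        and j = "\<lambda>(h, g). (h 0 - max (f 0) (g 0), local_down f g h, g)"])
    fix p assume "p \<in> ?P"
    then obtain h g where p: "p = (h, g)" and h: "h \<in> up b f" and g: "g \<in> down a h" by auto
    define e where "e = local_down f g h"
    define j where "j = h 0 - max (f 0) (g 0)"
    have st: "hstrip f h" "hstrip g h" "h \<in> shapes" "g \<in> shapes" "psize h = psize f + b" "psize h = psize g + a"
      using h g by (auto simp: up_def down_def)
    have rule: "local_rule f g e j h" unfolding e_def j_def by (rule local_rule_down) (use st in auto)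
    then have st': "hstrip e f" "hstrip e g" using local_rule_hstrip_iff st by blast+
    then have e: "e \<in> shapes" using hstrip_shapes_lower f by blast
    have sz: "psize h + psize e = psize f + psize g + j" by (rule local_rule_psize[OF rule f st(4) e])
    \<comment> \<open>The size identity gives a + |e| = |f| + j and b + |e| = |g| + j, so these
      inequalities yield j \<le> a and j \<le> b.\<close>
    have "psize e \<le> psize f" "psize e \<le> psize g"
      using st' by (auto intro!: psize_mono e f st simp: hstrip_def)
    then have "(j, e, g) \<in> ?Q" using sz st st' e by (auto simp: up_def down_def)
    then show "(case p of (h, g) \<Rightarrow> (h 0 - max (f 0) (g 0), local_down f g h, g)) \<in> ?Q"
      by (simp add: p e_def j_def)
    have "local_up f g e j = h"
      using local_rule_unique_up[OF local_rule_up[OF st'] rule] .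
    then show "(case case p of (h, g) \<Rightarrow> (h 0 - max (f 0) (g 0), local_down f g h, g) of
        (j, e, g) \<Rightarrow> (local_up f g e j, g)) = p"
      by (simp add: p e_def j_def)
    show "(case case p of (h, g) \<Rightarrow> (h 0 - max (f 0) (g 0), local_down f g h, g) of (j, e, g) \<Rightarrow> F g) =
        (case p of (h, g) \<Rightarrow> F g)" by (simp add: p)
  next
    fix q assume "q \<in> ?Q"
    then obtain j e g where q: "q = (j, e, g)" and j: "j \<le> a" "j \<le> b"
      and e: "e \<in> down (a - j) f" and g: "g \<in> up (b - j) e" by auto
    define h where "h = local_up f g e j"
    have st: "hstrip e f" "hstrip e g" "e \<in> shapes" "g \<in> shapes" "psize f = psize e + (a - j)" "psize g = psize e + (b - j)"
      using e g by (auto simp: up_def down_def)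
    have rule: "local_rule f g e j h" unfolding h_def by (rule local_rule_up) (use st in auto)
    then have st': "hstrip f h" "hstrip g h" using local_rule_hstrip_iff st by blast+
    then have h: "h \<in> shapes" using hstrip_shapes_upper f by blast
    have sz: "psize h + psize e = psize f + psize g + j" by (rule local_rule_psize[OF rule f st(4,3)])
    then have "(h, g) \<in> ?P" using j st st' h by (auto simp: up_def down_def)
    then show "(case q of (j, e, g) \<Rightarrow> (local_up f g e j, g)) \<in> ?P" by (simp add: q h_def)
    have "local_down f g h = e" "h 0 - max (f 0) (g 0) = j"
      using local_rule_unique_down[OF local_rule_down[OF st'] rule] .
    then show "(case case q of (j, e, g) \<Rightarrow> (local_up f g e j, g) of
        (h, g) \<Rightarrow> (h 0 - max (f 0) (g 0), local_down f g h, g)) = q"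
      by (simp add: q h_def)
  qed
  also have "\<dots> = (\<Sum>j\<le>min a b. \<Sum>e\<in>down (a - j) f. \<Sum>g\<in>up (b - j) e. F g)"
    by (simp add: sum.Sigma)
  finally show ?thesis .
qed

text \<open>A diagonal cell of a symmetric growth diagram: take a = b in the commutation rule and
  let F be the indicator of g = f.\<close>

lemma card_up:
  assumes "f \<in> shapes"
  shows "card (up a f) = (\<Sum>j\<le>a. card (down (a - j) f))"
proof -
  have "f \<in> down a h" if "h \<in> up a f" for h using that assms by (auto simp: up_def down_def)
  then have "card (up a f) = (\<Sum>h\<in>up a f. \<Sum>g\<in>down a h. if g = f then 1 else 0)"
    by simp
  also have "\<dots> = (\<Sum>j\<le>a. \<Sum>e\<in>down (a - j) f. \<Sum>g\<in>up (a - j) e. if g = f then 1 else 0)"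
    using sum_up_down[OF assms, of "\<lambda>g. if g = f then 1 else 0" a a] by (simp only: min.idem)
  also have "\<dots> = (\<Sum>j\<le>a. card (down (a - j) f))"
  proof (rule sum.cong)
    fix j assume "j \<in> {..a}"
    have "(\<Sum>g\<in>up (a - j) e. if g = f then 1 else 0) = (1::nat)" if "e \<in> down (a - j) f" for e
    proof -
      have "f \<in> up (a - j) e" using that assms by (auto simp: up_def down_def)
      then show ?thesis by (simp add: sum.delta)
    qed
    then show "(\<Sum>e\<in>down (a - j) f. \<Sum>g\<in>up (a - j) e. if g = f then 1 else 0) = card (down (a - j) f)"
      by simp
  qed simp
  finally show ?thesis .
qed

lemma sum_down_swap:
  fixes H :: "(nat \<Rightarrow> nat) \<Rightarrow> (nat \<Rightarrow> nat) \<Rightarrow> nat"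
  shows "(\<Sum>h\<in>shapes_of_size (n + a). \<Sum>f\<in>down a h. H f h) = (\<Sum>f\<in>shapes_of_size n. \<Sum>h\<in>up a f. H f h)"
proof -
  have "(\<Sum>h\<in>shapes_of_size (n + a). \<Sum>f\<in>down a h. H f h) =
      (\<Sum>(h, f)\<in>Sigma (shapes_of_size (n + a)) (down a). H f h)"
    by (simp add: sum.Sigma)
  also have "\<dots> = (\<Sum>(f, h)\<in>Sigma (shapes_of_size n) (up a). H f h)"
    by (rule sum.reindex_bij_witness[of _ "\<lambda>(f, h). (h, f)" "\<lambda>(h, f). (f, h)"])
      (auto simp: shapes_of_size_def up_def down_def)
  also have "\<dots> = (\<Sum>f\<in>shapes_of_size n. \<Sum>h\<in>up a f. H f h)"
    by (simp add: sum.Sigma)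
  finally show ?thesis .
qed

lemma down_empty: "n < a \<Longrightarrow> h \<in> shapes_of_size n \<Longrightarrow> down a h = {}"
  by (auto simp: shapes_of_size_def down_def)


section \<open>Counting chains of horizontal strips by integer matrices\<close>

text \<open>The Kostka number K_{f,\<alpha>}: chains of shapes from the empty one to f whose i-th
  step adds a horizontal strip of size \<open>\<alpha> i\<close>.\<close>

fun chain_count :: "nat \<Rightarrow> (nat \<Rightarrow> nat) \<Rightarrow> (nat \<Rightarrow> nat) \<Rightarrow> nat" where
  "chain_count 0 \<alpha> f = (if f = (\<lambda>_. 0) then 1 else 0)"
| "chain_count (Suc k) \<alpha> f = (\<Sum>g\<in>down (\<alpha> k) f. chain_count k \<alpha> g)"

lemma chain_count_cong:
  "(\<And>i. i < k \<Longrightarrow> \<alpha> i = \<beta> i) \<Longrightarrow> chain_count k \<alpha> f = chain_count k \<beta> f"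
  by (induction k arbitrary: f) auto

text \<open>The possible columns of sum b in a matrix whose row sums are \<alpha>.\<close>

definition vectors_below :: "nat \<Rightarrow> nat \<Rightarrow> (nat \<Rightarrow> nat) \<Rightarrow> (nat \<Rightarrow> nat) set" where
  "vectors_below k b \<alpha> = {c. (\<forall>i\<ge>k. c i = 0) \<and> (\<forall>i. c i \<le> \<alpha> i) \<and> (\<Sum>i<k. c i) = b}"

lemma finite_vectors_below [simp]: "finite (vectors_below k b \<alpha>)"
proof (rule finite_subset)
  show "vectors_below k b \<alpha> \<subseteq> {c. \<forall>i. (i \<in> {..<k} \<longrightarrow> c i \<in> {..b}) \<and> (i \<notin> {..<k} \<longrightarrow> c i = 0)}"
  proof (intro subsetI CollectI allI conjI impI)
    fix c i assume c: "c \<in> vectors_below k b \<alpha>"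
    show "c i \<in> {..b}" if "i \<in> {..<k}"
      using member_le_sum[of i "{..<k}" c] that c by (auto simp: vectors_below_def)
    show "c i = 0" if "i \<notin> {..<k}" using that c by (auto simp: vectors_below_def)
  qed
qed (intro finite_set_of_finite_funs finite_lessThan finite_atMost)

lemma sum_vectors_below_Suc:
  fixes G :: "(nat \<Rightarrow> nat) \<Rightarrow> nat"
  shows "(\<Sum>c\<in>vectors_below (Suc k) b \<alpha>. G c) =
    (\<Sum>j\<le>min (\<alpha> k) b. \<Sum>c\<in>vectors_below k (b - j) \<alpha>. G (c(k := j)))"
proof -
  have sum_upd: "(\<Sum>i<k. (c(k := j)) i) = (\<Sum>i<k. c i)" for c :: "nat \<Rightarrow> nat" and j
    by (intro sum.cong) auto
  let ?Q = "Sigma {..min (\<alpha> k) b} (\<lambda>j. vectors_below k (b - j) \<alpha>)"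
  have "(\<Sum>c\<in>vectors_below (Suc k) b \<alpha>. G c) = (\<Sum>(j, c)\<in>?Q. G (c(k := j)))"
  proof (rule sum.reindex_bij_witness[where i = "\<lambda>(j, c). c(k := j)" and j = "\<lambda>c. (c k, c(k := 0))"])
    fix c assume "c \<in> vectors_below (Suc k) b \<alpha>"
    then have c: "\<And>i. i \<ge> Suc k \<Longrightarrow> c i = 0" "\<And>i. c i \<le> \<alpha> i" "(\<Sum>i<k. c i) + c k = b"
      by (auto simp: vectors_below_def)
    show "(c k, c(k := 0)) \<in> ?Q"
      using c by (auto simp: vectors_below_def sum_upd simp del: fun_upd_apply) (auto simp: le_Suc_eq)
  next
    fix q assume "q \<in> ?Q"
    then obtain j c where q: "q = (j, c)" and j: "j \<le> \<alpha> k" "j \<le> b" and c: "c \<in> vectors_below k (b - j) \<alpha>"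
      by auto
    have c': "c k = 0" "\<And>i. i \<ge> k \<Longrightarrow> c i = 0" "\<And>i. c i \<le> \<alpha> i" "(\<Sum>i<k. c i) = b - j"
      using c by (auto simp: vectors_below_def)
    show "(case q of (j, c) \<Rightarrow> c(k := j)) \<in> vectors_below (Suc k) b \<alpha>"
      using c' j by (simp add: q vectors_below_def)
    show "(\<lambda>c. (c k, c(k := 0))) (case q of (j, c) \<Rightarrow> c(k := j)) = q"
      using c' by (auto simp: q fun_eq_iff)
  qed auto
  then show ?thesis by (simp add: sum.Sigma)
qed

lemma zero_shape: "(\<lambda>_. 0) \<in> shapes" "psize (\<lambda>_. 0) = 0"
  by (auto intro: shapesI[of _ 0] simp: psize_def)

text \<open>A strip of size b added at the end of a chain is pushed back to its beginning, one cell
  of the growth diagram per step; c collects the entries of these cells. In symmetric functions this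
  is the adjoint of multiplication by h_b applied to h_\<alpha>, the sum of all
  h_{\<alpha>-c}.\<close>

lemma sum_up_chain_count:
  assumes "f \<in> shapes"
  shows "(\<Sum>h\<in>up b f. chain_count k \<alpha> h) = (\<Sum>c\<in>vectors_below k b \<alpha>. chain_count k (\<lambda>i. \<alpha> i - c i) f)"
  using assms
proof (induction k arbitrary: b f)
  case 0
  have "(\<lambda>_. 0) \<in> up b f \<longleftrightarrow> f = (\<lambda>_. 0) \<and> b = 0"
  proof
    assume *: "(\<lambda>_. 0) \<in> up b f"
    then have "f = (\<lambda>_. 0)" by (auto simp: up_def hstrip_def)
    then show "f = (\<lambda>_. 0) \<and> b = 0" using * by (auto simp: up_def zero_shape)
  qed (auto simp: up_def zero_shape hstrip_def)
  moreover have "vectors_below 0 b \<alpha> = (if b = 0 then {\<lambda>_. 0} else {})"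
    by (auto simp: vectors_below_def)
  ultimately show ?case by (auto simp: sum.delta')
next
  case (Suc k)
  have "(\<Sum>h\<in>up b f. chain_count (Suc k) \<alpha> h) = (\<Sum>h\<in>up b f. \<Sum>g\<in>down (\<alpha> k) h. chain_count k \<alpha> g)"
    by simp
  also have "\<dots> = (\<Sum>j\<le>min (\<alpha> k) b. \<Sum>e\<in>down (\<alpha> k - j) f. \<Sum>g\<in>up (b - j) e. chain_count k \<alpha> g)"
    by (rule sum_up_down[OF Suc.prems])
  also have "\<dots> = (\<Sum>j\<le>min (\<alpha> k) b. \<Sum>e\<in>down (\<alpha> k - j) f. \<Sum>c\<in>vectors_below k (b - j) \<alpha>. chain_count k (\<lambda>i. \<alpha> i - c i) e)"
    by (intro sum.cong refl Suc.IH) (auto simp: down_def)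
  also have "\<dots> = (\<Sum>j\<le>min (\<alpha> k) b. \<Sum>c\<in>vectors_below k (b - j) \<alpha>. \<Sum>e\<in>down (\<alpha> k - j) f. chain_count k (\<lambda>i. \<alpha> i - c i) e)"
    by (intro sum.cong refl sum.swap)
  also have "\<dots> = (\<Sum>j\<le>min (\<alpha> k) b. \<Sum>c\<in>vectors_below k (b - j) \<alpha>.
      chain_count (Suc k) (\<lambda>i. \<alpha> i - (c(k := j)) i) f)"
    by (intro sum.cong refl) (auto intro!: sum.cong chain_count_cong)
  also have "\<dots> = (\<Sum>c\<in>vectors_below (Suc k) b \<alpha>. chain_count (Suc k) (\<lambda>i. \<alpha> i - c i) f)"
    by (rule sum_vectors_below_Suc[symmetric])
  finally show ?case .
qed

definition nat_matrices :: "nat \<Rightarrow> nat \<Rightarrow> (nat \<Rightarrow> nat) \<Rightarrow> (nat \<Rightarrow> nat) \<Rightarrow> (nat \<Rightarrow> nat \<Rightarrow> nat) set" where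
  "nat_matrices k l \<alpha> \<beta> = {C. (\<forall>i j. i \<ge> k \<or> j \<ge> l \<longrightarrow> C i j = 0) \<and>
     (\<forall>i<k. (\<Sum>j<l. C i j) = \<alpha> i) \<and> (\<forall>j<l. (\<Sum>i<k. C i j) = \<beta> j)}"

text \<open>Removes the last column. The bound in the target makes the truncated difference
  \<open>\<alpha> i - c i\<close> exact; \<open>nat_matrices_last_col_le\<close> shows that it holds
  automatically.\<close>

lemma nat_matrices_Suc:
  "bij_betw (\<lambda>(c, C) i j. if j = l then c i else C i j)
    (Sigma (vectors_below k (\<beta> l) \<alpha>) (\<lambda>c. nat_matrices k l (\<lambda>i. \<alpha> i - c i) \<beta>))
    (nat_matrices k (Suc l) \<alpha> \<beta> \<inter> {C. \<forall>i. C i l \<le> \<alpha> i})"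
proof (rule bij_betw_byWitness[where f' = "\<lambda>C. (\<lambda>i. C i l, \<lambda>i j. if j = l then 0 else C i j)"])
  let ?Q = "Sigma (vectors_below k (\<beta> l) \<alpha>) (\<lambda>c. nat_matrices k l (\<lambda>i. \<alpha> i - c i) \<beta>)"
  have *: "(\<Sum>j<l. if j = l then x else C j) = (\<Sum>j<l. C j)" for x and C :: "nat \<Rightarrow> nat"
    by (intro sum.cong) auto
  show "(\<lambda>(c, C) i j. if j = l then c i else C i j) ` ?Q \<subseteq> nat_matrices k (Suc l) \<alpha> \<beta> \<inter> {C. \<forall>i. C i l \<le> \<alpha> i}"
    by (auto simp: nat_matrices_def vectors_below_def * less_Suc_eq)
  show "(\<lambda>C. (\<lambda>i. C i l, \<lambda>i j. if j = l then 0 else C i j)) `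
      (nat_matrices k (Suc l) \<alpha> \<beta> \<inter> {C. \<forall>i. C i l \<le> \<alpha> i}) \<subseteq> ?Q"
  proof (rule image_subsetI)
    fix C assume "C \<in> nat_matrices k (Suc l) \<alpha> \<beta> \<inter> {C. \<forall>i. C i l \<le> \<alpha> i}"
    then have C: "\<And>i j. i \<ge> k \<Longrightarrow> C i j = 0" "\<And>i j. j \<ge> Suc l \<Longrightarrow> C i j = 0"
      "\<And>i. i < k \<Longrightarrow> (\<Sum>j<l. C i j) + C i l = \<alpha> i" "\<And>j. j < Suc l \<Longrightarrow> (\<Sum>i<k. C i j) = \<beta> j" "\<And>i. C i l \<le> \<alpha> i"
      by (auto simp: nat_matrices_def)
    have "(\<Sum>j<l. C i j) = \<alpha> i - C i l" if "i < k" for i using C(3)[OF that] by simp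
    moreover have "C i j = 0" if "j \<ge> l" "j \<noteq> l" for i j using C(2)[of j i] that by simp
    ultimately show "(\<lambda>i. C i l, \<lambda>i j. if j = l then 0 else C i j) \<in> ?Q"
      using C by (simp add: nat_matrices_def vectors_below_def *)
  qed
  show "\<forall>q\<in>?Q. (\<lambda>C. (\<lambda>i. C i l, \<lambda>i j. if j = l then 0 else C i j)) ((\<lambda>(c, C) i j. if j = l then c i else C i j) q) = q"
    by (auto simp: fun_eq_iff nat_matrices_def)
qed (auto simp: fun_eq_iff)

lemma nat_matrices_last_col_le: "nat_matrices k (Suc l) \<alpha> \<beta> \<inter> {C. \<forall>i. C i l \<le> \<alpha> i} = nat_matrices k (Suc l) \<alpha> \<beta>"
proof -
  have "C i l \<le> \<alpha> i" if "C \<in> nat_matrices k (Suc l) \<alpha> \<beta>" for C i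
  proof (cases "i < k")
    case True
    then have "(\<Sum>j<l. C i j) + C i l = \<alpha> i" using that by (simp add: nat_matrices_def)
    then show ?thesis by simp
  next
    case False
    then show ?thesis using that by (simp add: nat_matrices_def)
  qed
  then show ?thesis by auto
qed

lemma nat_matrices_0: "nat_matrices k 0 \<alpha> \<beta> = (if \<forall>i<k. \<alpha> i = 0 then {\<lambda>_ _. 0} else {})"
  by (auto simp: nat_matrices_def fun_eq_iff)

lemma finite_nat_matrices [simp]: "finite (nat_matrices k l \<alpha> \<beta>)"
proof (induction l arbitrary: \<alpha>)
  case (Suc l)
  then show ?case
    using bij_betw_finite[OF nat_matrices_Suc[of l k \<beta> \<alpha>]] by (simp add: nat_matrices_last_col_le)
qed (simp add: nat_matrices_0)

lemma card_nat_matrices_Suc: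
  "card (nat_matrices k (Suc l) \<alpha> \<beta>) =
    (\<Sum>c\<in>vectors_below k (\<beta> l) \<alpha>. card (nat_matrices k l (\<lambda>i. \<alpha> i - c i) \<beta>))"
  using bij_betw_same_card[OF nat_matrices_Suc[of l k \<beta> \<alpha>]]
  by (simp add: nat_matrices_last_col_le card_SigmaI)

definition symmetric_matrices :: "nat \<Rightarrow> (nat \<Rightarrow> nat) \<Rightarrow> (nat \<Rightarrow> nat \<Rightarrow> nat) set" where
  "symmetric_matrices k \<alpha> = {C. (\<forall>i j. i \<ge> k \<longrightarrow> C i j = 0) \<and> (\<forall>i j. C i j = C j i) \<and>
     (\<forall>i<k. (\<Sum>j<k. C i j) = \<alpha> i)}"

text \<open>Removes the last row and column together: x is the diagonal entry, and c is the rest of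
  the column, which by symmetry is also the rest of the row.\<close>

lemma symmetric_matrices_Suc:
  "bij_betw (\<lambda>(x, c, C) i j. if i = k then (if j = k then x else c j) else if j = k then c i else C i j)
    (Sigma {..\<alpha> k} (\<lambda>x. Sigma (vectors_below k (\<alpha> k - x) \<alpha>) (\<lambda>c. symmetric_matrices k (\<lambda>i. \<alpha> i - c i))))
    (symmetric_matrices (Suc k) \<alpha>)" (is "bij_betw ?F ?Q ?S")
proof (rule bij_betw_byWitness[where f' = "\<lambda>C. (C k k, \<lambda>i. if i < k then C i k else 0,
    \<lambda>i j. if i = k \<or> j = k then 0 else C i j)"])
  let ?G = "\<lambda>C. (C k k, \<lambda>i. if i < k then C i k else 0 :: nat, \<lambda>i j. if i = k \<or> j = k then 0 else C i j :: nat)"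
  have *: "(\<Sum>j<k. if j = k then x else C j) = (\<Sum>j<k. C j)" for x and C :: "nat \<Rightarrow> nat"
    by (intro sum.cong) auto
  show "?F ` ?Q \<subseteq> ?S"
  proof (rule image_subsetI)
    fix q assume "q \<in> ?Q"
    then obtain x c C where q: "q = (x, c, C)" and x: "x \<le> \<alpha> k" and c: "c \<in> vectors_below k (\<alpha> k - x) \<alpha>"
      and C: "C \<in> symmetric_matrices k (\<lambda>i. \<alpha> i - c i)" by auto
    have c': "\<And>i. i \<ge> k \<Longrightarrow> c i = 0" "\<And>i. c i \<le> \<alpha> i" "(\<Sum>i<k. c i) = \<alpha> k - x"
      using c by (auto simp: vectors_below_def)
    have C': "\<And>i j. i \<ge> k \<Longrightarrow> C i j = 0" "\<And>i j. C i j = C j i" "\<And>i. i < k \<Longrightarrow> (\<Sum>j<k. C i j) = \<alpha> i - c i"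
      using C by (auto simp: symmetric_matrices_def)
    have rows: "(\<Sum>j<Suc k. ?F q i j) = \<alpha> i" if "i < Suc k" for i
    proof (cases "i = k")
      case True
      then show ?thesis using c' x by (simp add: q *)
    next
      case False
      then have "i < k" using that by simp
      then have "(\<Sum>j<k. C i j) + c i = \<alpha> i" using C'(3)[of i] c'(2)[of i] by simp
      then show ?thesis using False by (simp add: q *)
    qed
    have "?F q i j = 0" if "i \<ge> Suc k" for i j using that c' C' by (simp add: q)
    moreover have "?F q i j = ?F q j i" for i j using C'(2)[of i j] by (simp add: q)
    ultimately show "?F q \<in> ?S" using rows unfolding symmetric_matrices_def by blast
  qed
  show "?G ` ?S \<subseteq> ?Q"
  proof (rule image_subsetI)
    fix C assume "C \<in> ?S"
    then have C: "\<And>i j. i \<ge> Suc k \<Longrightarrow> C i j = 0" "\<And>i j. C i j = C j i"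
      "\<And>i. i < Suc k \<Longrightarrow> (\<Sum>j<k. C i j) + C i k = \<alpha> i"
      by (auto simp: symmetric_matrices_def)
    let ?c = "\<lambda>i. if i < k then C i k else 0"
    let ?C = "\<lambda>i j. if i = k \<or> j = k then 0 else C i j"
    have Ck: "C k k \<in> {..\<alpha> k}" using C(3)[of k] by simp
    have c: "?c \<in> vectors_below k (\<alpha> k - C k k) \<alpha>"
    proof -
      have "(\<Sum>i<k. ?c i) = (\<Sum>j<k. C k j)" using C(2) by (intro sum.cong) auto
      moreover have "?c i \<le> \<alpha> i" for i using C(3)[of i] by (cases "i < k") auto
      ultimately show ?thesis using C(3)[of k] by (simp add: vectors_below_def)
    qed
    have C': "?C \<in> symmetric_matrices k (\<lambda>i. \<alpha> i - ?c i)"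
    proof -
      have "?C i j = 0" if "i \<ge> k" for i j using C(1)[of i j] that by auto
      moreover have "?C i j = ?C j i" for i j using C(2)[of i j] by auto
      moreover have "(\<Sum>j<k. ?C i j) = \<alpha> i - ?c i" if "i < k" for i
      proof -
        have "(\<Sum>j<k. ?C i j) = (\<Sum>j<k. C i j)" using that by (intro sum.cong) auto
        then show ?thesis using C(3)[of i] that by simp
      qed
      ultimately show ?thesis unfolding symmetric_matrices_def by blast
    qed
    show "?G C \<in> ?Q" using Ck c C' by blast
  qed
  show "\<forall>q\<in>?Q. ?G (?F q) = q"
    by (auto simp: fun_eq_iff symmetric_matrices_def vectors_below_def)
  show "\<forall>C\<in>?S. ?F (?G C) = C"
  proof
    fix C assume "C \<in> ?S"
    then have C: "\<And>i j. i \<ge> Suc k \<Longrightarrow> C i j = 0" "\<And>i j. C i j = C j i"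
      by (auto simp: symmetric_matrices_def)
    show "?F (?G C) = C"
    proof (intro ext)
      fix i j
      have "i < k \<or> i = k \<or> i \<ge> Suc k" "j < k \<or> j = k \<or> j \<ge> Suc k" by auto
      then show "?F (?G C) i j = C i j"
        using C(1)[of i j] C(1)[of j i] C(2)[of i j] by auto
    qed
  qed
qed

lemma finite_symmetric_matrices [simp]: "finite (symmetric_matrices k \<alpha>)"
proof (induction k arbitrary: \<alpha>)
  case 0
  have "symmetric_matrices 0 \<alpha> \<subseteq> {\<lambda>_ _. 0}" by (auto simp: symmetric_matrices_def fun_eq_iff)
  then show ?case using finite_subset by blast
next
  case (Suc k)
  then show ?case
    using bij_betw_finite[OF symmetric_matrices_Suc[of k \<alpha>]] by (simp add: finite_SigmaI)
qed

lemma card_symmetric_matrices_Suc: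
  "card (symmetric_matrices (Suc k) \<alpha>) =
    (\<Sum>x\<le>\<alpha> k. \<Sum>c\<in>vectors_below k (\<alpha> k - x) \<alpha>. card (symmetric_matrices k (\<lambda>i. \<alpha> i - c i)))"
  using bij_betw_same_card[OF symmetric_matrices_Suc[of k \<alpha>]] by (simp add: card_SigmaI)

lemma chain_count_zero: "chain_count k \<alpha> (\<lambda>_. 0) = (if \<forall>i<k. \<alpha> i = 0 then 1 else 0)"
proof (induction k)
  case (Suc k)
  have "down a (\<lambda>_. 0) = (if a = 0 then {\<lambda>_. 0} else {})" for a
    by (auto simp: down_def zero_shape hstrip_def)
  then show ?case using Suc by (auto simp: less_Suc_eq)
qed simp

lemma sum_vectors_below_diff:
  assumes "c \<in> vectors_below k b \<alpha>" "(\<Sum>i<k. \<alpha> i) = n + b"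
  shows "(\<Sum>i<k. \<alpha> i - c i) = n"
proof -
  have "c i \<le> \<alpha> i" for i using assms(1) by (simp add: vectors_below_def)
  then have "(\<Sum>i<k. \<alpha> i - c i) + (\<Sum>i<k. c i) = (\<Sum>i<k. \<alpha> i)"
    by (simp flip: sum.distrib)
  then show ?thesis using assms by (simp add: vectors_below_def)
qed

lemma vectors_below_empty:
  assumes "(\<Sum>i<k. \<alpha> i) < b"
  shows "vectors_below k b \<alpha> = {}"
proof -
  have "(\<Sum>i<k. c i) \<le> (\<Sum>i<k. \<alpha> i)" if "\<forall>i. c i \<le> \<alpha> i" for c
    using that by (intro sum_mono) auto
  then show ?thesis using assms leD unfolding vectors_below_def by blast
qed

text \<open>The enumerative form of the Robinson-Schensted-Knuth correspondence. Removing the last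
  strip of the \<beta>-chain is exchanged for adding a strip on top of the \<alpha>-chain, and
  pushing that strip through the \<alpha>-chain produces the last column of the matrix.\<close>

theorem sum_chain_count_times_chain_count:
  assumes "(\<Sum>i<k. \<alpha> i) = n"
  shows "(\<Sum>f\<in>shapes_of_size n. chain_count k \<alpha> f * chain_count l \<beta> f) = card (nat_matrices k l \<alpha> \<beta>)"
  using assms
proof (induction l arbitrary: \<alpha> n)
  case 0
  have "(\<Sum>f\<in>shapes_of_size n. chain_count k \<alpha> f * chain_count 0 \<beta> f) =
      (\<Sum>f\<in>shapes_of_size n. if f = (\<lambda>_. 0) then chain_count k \<alpha> f else 0)"
    by (intro sum.cong) auto
  also have "\<dots> = (if n = 0 then chain_count k \<alpha> (\<lambda>_. 0) else 0)"
  proof -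
    have "(\<lambda>_. 0) \<in> shapes_of_size n \<longleftrightarrow> n = 0" by (auto simp: shapes_of_size_def zero_shape)
    then show ?thesis by (simp add: sum.delta)
  qed
  finally show ?case using 0 by (auto simp: chain_count_zero nat_matrices_0)
next
  case (Suc l)
  show ?case
  proof (cases "\<beta> l \<le> n")
    case True
    then obtain m where n: "n = m + \<beta> l" by (metis le_add_diff_inverse2)
    have "(\<Sum>f\<in>shapes_of_size n. chain_count k \<alpha> f * chain_count (Suc l) \<beta> f) =
        (\<Sum>h\<in>shapes_of_size (m + \<beta> l). \<Sum>f\<in>down (\<beta> l) h. chain_count k \<alpha> h * chain_count l \<beta> f)"
      by (simp add: n sum_distrib_left)
    also have "\<dots> = (\<Sum>f\<in>shapes_of_size m. \<Sum>h\<in>up (\<beta> l) f. chain_count k \<alpha> h * chain_count l \<beta> f)"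
      by (rule sum_down_swap)
    also have "\<dots> = (\<Sum>f\<in>shapes_of_size m. (\<Sum>h\<in>up (\<beta> l) f. chain_count k \<alpha> h) * chain_count l \<beta> f)"
      by (simp add: sum_distrib_right)
    also have "\<dots> = (\<Sum>f\<in>shapes_of_size m.
        (\<Sum>c\<in>vectors_below k (\<beta> l) \<alpha>. chain_count k (\<lambda>i. \<alpha> i - c i) f) * chain_count l \<beta> f)"
      by (intro sum.cong refl arg_cong2[of _ _ _ _ times] sum_up_chain_count) (simp add: shapes_of_size_def)
    also have "\<dots> = (\<Sum>c\<in>vectors_below k (\<beta> l) \<alpha>. \<Sum>f\<in>shapes_of_size m.
        chain_count k (\<lambda>i. \<alpha> i - c i) f * chain_count l \<beta> f)"
      by (simp add: sum_distrib_right, subst sum.swap) simp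
    also have "\<dots> = (\<Sum>c\<in>vectors_below k (\<beta> l) \<alpha>. card (nat_matrices k l (\<lambda>i. \<alpha> i - c i) \<beta>))"
      using Suc.prems n by (intro sum.cong refl Suc.IH sum_vectors_below_diff) auto
    also have "\<dots> = card (nat_matrices k (Suc l) \<alpha> \<beta>)" by (rule card_nat_matrices_Suc[symmetric])
    finally show ?thesis .
  next
    case False
    then have "down (\<beta> l) h = {}" if "h \<in> shapes_of_size n" for h using down_empty[OF _ that] by simp
    then show ?thesis
      using Suc.prems False by (simp add: card_nat_matrices_Suc vectors_below_empty)
  qed
qed

text \<open>The correspondence for symmetric growth diagrams, where one chain determines the
  diagram. \<open>card_up\<close> treats the diagonal cell of the last step, with entry j; the
  remaining strip of size \<open>\<alpha> k - j\<close> is pushed through the shorter chain and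
  gives the off-diagonal part c of the last column.\<close>

theorem sum_chain_count:
  assumes "(\<Sum>i<k. \<alpha> i) = n"
  shows "(\<Sum>f\<in>shapes_of_size n. chain_count k \<alpha> f) = card (symmetric_matrices k \<alpha>)"
  using assms
proof (induction k arbitrary: \<alpha> n)
  case 0
  have "symmetric_matrices 0 \<alpha> = {\<lambda>_ _. 0}" by (auto simp: symmetric_matrices_def fun_eq_iff)
  moreover have "(\<lambda>_. 0) \<in> shapes_of_size 0" by (simp add: shapes_of_size_def zero_shape)
  ultimately show ?case using 0 by (auto simp: sum.delta')
next
  case (Suc k)
  define m where "m = (\<Sum>i<k. \<alpha> i)"
  have n: "n = m + \<alpha> k" using Suc.prems by (simp add: m_def)
  have step: "(\<Sum>f\<in>shapes_of_size m. \<Sum>e\<in>down a f. chain_count k \<alpha> f) =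
      (\<Sum>c\<in>vectors_below k a \<alpha>. card (symmetric_matrices k (\<lambda>i. \<alpha> i - c i)))" for a
  proof (cases "a \<le> m")
    case True
    then obtain d where d: "m = d + a" by (metis le_add_diff_inverse2)
    have "(\<Sum>f\<in>shapes_of_size m. \<Sum>e\<in>down a f. chain_count k \<alpha> f) =
        (\<Sum>e\<in>shapes_of_size d. \<Sum>f\<in>up a e. chain_count k \<alpha> f)"
      unfolding d by (rule sum_down_swap)
    also have "\<dots> = (\<Sum>e\<in>shapes_of_size d. \<Sum>c\<in>vectors_below k a \<alpha>. chain_count k (\<lambda>i. \<alpha> i - c i) e)"
      by (intro sum.cong refl sum_up_chain_count) (simp add: shapes_of_size_def)
    also have "\<dots> = (\<Sum>c\<in>vectors_below k a \<alpha>. \<Sum>e\<in>shapes_of_size d. chain_count k (\<lambda>i. \<alpha> i - c i) e)"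
      by (rule sum.swap)
    also have "\<dots> = (\<Sum>c\<in>vectors_below k a \<alpha>. card (symmetric_matrices k (\<lambda>i. \<alpha> i - c i)))"
      using d by (intro sum.cong refl Suc.IH sum_vectors_below_diff) (auto simp: m_def)
    finally show ?thesis .
  next
    case False
    then have "down a h = {}" if "h \<in> shapes_of_size m" for h using down_empty[OF _ that] by simp
    then show ?thesis using False by (simp add: vectors_below_empty m_def)
  qed
  have "(\<Sum>f\<in>shapes_of_size n. chain_count (Suc k) \<alpha> f) =
      (\<Sum>f\<in>shapes_of_size m. \<Sum>h\<in>up (\<alpha> k) f. chain_count k \<alpha> f)"
    unfolding n chain_count.simps by (rule sum_down_swap)
  also have "\<dots> = (\<Sum>f\<in>shapes_of_size m. \<Sum>j\<le>\<alpha> k. \<Sum>e\<in>down (\<alpha> k - j) f. chain_count k \<alpha> f)"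
    by (intro sum.cong) (auto simp: card_up shapes_of_size_def sum_distrib_right)
  also have "\<dots> = (\<Sum>j\<le>\<alpha> k. \<Sum>f\<in>shapes_of_size m. \<Sum>e\<in>down (\<alpha> k - j) f. chain_count k \<alpha> f)"
    by (rule sum.swap)
  also have "\<dots> = card (symmetric_matrices (Suc k) \<alpha>)"
    by (simp only: step card_symmetric_matrices_Suc)
  finally show ?case .
qed


section \<open>Semistandard tableaux as chains of horizontal strips\<close>

text \<open>Tableaux whose rows are indexed by all natural numbers, so that empty rows are allowed.\<close>

definition row_tableaux :: "nat \<Rightarrow> (nat \<Rightarrow> nat) \<Rightarrow> (nat \<Rightarrow> nat) \<Rightarrow> (nat \<Rightarrow> nat list) set" where
  "row_tableaux k \<alpha> f = {R. (\<forall>i. length (R i) = f i \<and> sorted (R i) \<and> set (R i) \<subseteq> {..<k}) \<and>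
     (\<forall>i j. j < f (Suc i) \<longrightarrow> R i ! j < R (Suc i) ! j) \<and>
     (\<forall>x<k. psize (\<lambda>i. count_list (R i) x) = \<alpha> x)}"

lemma sorted_split_last:
  assumes "sorted xs" "set xs \<subseteq> {..<Suc k}"
  shows "xs = filter (\<lambda>x. x < k) xs @ replicate (length xs - length (filter (\<lambda>x. x < k) xs)) k"
  using assms
proof (induction xs)
  case (Cons x xs)
  show ?case
  proof (cases "x < k")
    case False
    then have "\<forall>y\<in>set xs. y = k" "x = k" using Cons.prems by force+
    then have "filter (\<lambda>x. x < k) xs = []" by auto
    moreover have "xs = replicate (length xs) k"
      using \<open>\<forall>y\<in>set xs. y = k\<close> by (simp add: replicate_length_same)
    ultimately show ?thesis using \<open>x = k\<close> by simp
  qed (use Cons in auto)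
qed simp

lemma count_list_filter: "count_list (filter P xs) x = (if P x then count_list xs x else 0)"
  by (induction xs) auto

lemma count_list_replicate: "count_list (replicate n x) y = (if x = y then n else 0)"
  by (induction n) auto

lemma count_list_append_replicate: "x \<noteq> k \<Longrightarrow> count_list (xs @ replicate n k) x = count_list xs x"
  by (induction xs) (auto simp: count_list_replicate)

lemma row_tableaux_0: "row_tableaux 0 \<alpha> f = (if f = (\<lambda>_. 0) then {\<lambda>_. []} else {})"
proof -
  have a: "R i = [] \<and> f i = 0" if "R \<in> row_tableaux 0 \<alpha> f" for R i
  proof -
    have "length (R i) = f i" "set (R i) \<subseteq> {..<0}" using that unfolding row_tableaux_def by blast+
    then show ?thesis by simp
  qed
  have b: "(\<lambda>_. []) \<in> row_tableaux 0 \<alpha> (\<lambda>_. 0)" by (simp add: row_tableaux_def)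
  show ?thesis
  proof (cases "f = (\<lambda>_. 0)")
    case True
    show ?thesis using a b unfolding True by auto
  next
    case False
    then show ?thesis using a by auto
  qed
qed

text \<open>The entries k stand at the ends of the rows, and strictness of columns allows at most
  one of them in each column. So they fill a horizontal strip, and what remains is a tableau with
  smaller entries.\<close>

lemma row_tableaux_Suc:
  assumes f: "f \<in> shapes"
  shows "bij_betw (\<lambda>(g, R) i. R i @ replicate (f i - g i) k)
    (Sigma (down (\<alpha> k) f) (row_tableaux k \<alpha>)) (row_tableaux (Suc k) \<alpha> f)"
proof (rule bij_betw_byWitness[where f' = "\<lambda>R. (\<lambda>i. length (filter (\<lambda>x. x < k) (R i)), \<lambda>i. filter (\<lambda>x. x < k) (R i))"])
  let ?F = "\<lambda>(g, R) i. R i @ replicate (f i - g i) k"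
  let ?low = "filter (\<lambda>x. x < k)"
  let ?G = "\<lambda>R. (\<lambda>i. length (?low (R i)), \<lambda>i. ?low (R i))"
  obtain L where L: "\<forall>i\<ge>L. f i = 0" using shapes_support[OF f] by blast
  have split: "R i = ?low (R i) @ replicate (f i - length (?low (R i))) k" if "R \<in> row_tableaux (Suc k) \<alpha> f" for R i
  proof -
    have "sorted (R i)" "set (R i) \<subseteq> {..<Suc k}" "length (R i) = f i"
      using that unfolding row_tableaux_def by blast+
    then show ?thesis using sorted_split_last[of "R i" k] by simp
  qed
  show "\<forall>R\<in>row_tableaux (Suc k) \<alpha> f. ?F (?G R) = R"
  proof
    fix R assume "R \<in> row_tableaux (Suc k) \<alpha> f"
    then show "?F (?G R) = R" using split[of R] by (simp add: fun_eq_iff)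
  qed
  show "\<forall>q\<in>Sigma (down (\<alpha> k) f) (row_tableaux k \<alpha>). ?G (?F q) = q"
  proof
    fix q assume "q \<in> Sigma (down (\<alpha> k) f) (row_tableaux k \<alpha>)"
    then obtain g R where q: "q = (g, R)" "g \<in> down (\<alpha> k) f" "R \<in> row_tableaux k \<alpha> g" by auto
    have R: "length (R i) = g i" "set (R i) \<subseteq> {..<k}" for i
      using q(3) unfolding row_tableaux_def by blast+
    have "?low (R i) = R i" for i using R(2)[of i] by (auto simp: filter_id_conv)
    then show "?G (?F q) = q" using R(1) by (simp add: q(1) fun_eq_iff)
  qed
  show "?F ` Sigma (down (\<alpha> k) f) (row_tableaux k \<alpha>) \<subseteq> row_tableaux (Suc k) \<alpha> f"
  proof (rule image_subsetI)
    fix q assume "q \<in> Sigma (down (\<alpha> k) f) (row_tableaux k \<alpha>)"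
    then obtain g R where q: "q = (g, R)" and g: "g \<in> down (\<alpha> k) f" and "R \<in> row_tableaux k \<alpha> g" by auto
    then have R: "\<And>i. length (R i) = g i" "\<And>i. sorted (R i)" "\<And>i. set (R i) \<subseteq> {..<k}"
      "\<And>i j. j < g (Suc i) \<Longrightarrow> R i ! j < R (Suc i) ! j" "\<And>x. x < k \<Longrightarrow> psize (\<lambda>i. count_list (R i) x) = \<alpha> x"
      unfolding row_tableaux_def by blast+
    have g': "\<And>i. g i \<le> f i" "\<And>i. f (Suc i) \<le> g i" "psize f = psize g + \<alpha> k" "g \<in> shapes"
      using g by (auto simp: down_def hstrip_def)
    have gL: "g i = 0" if "i \<ge> L" for i using g'(1)[of i] L that by simp
    have "length (?F q i) = f i" for i using g'(1)[of i] R(1) by (simp add: q)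
    moreover have "sorted (?F q i)" for i
      using R(2,3)[of i] by (auto simp: q sorted_append subset_iff intro: less_imp_le)
    moreover have "set (?F q i) \<subseteq> {..<Suc k}" for i
      using R(3)[of i] by (auto simp: q subset_iff intro: less_SucI)
    moreover have "?F q i ! j < ?F q (Suc i) ! j" if j: "j < f (Suc i)" for i j
    proof -
      have "j < g i" using g'(2)[of i] j by simp
      moreover from this have "R i ! j < k" using R(1,3)[of i] by (metis lessThan_iff nth_mem subsetD)
      ultimately show ?thesis
        using R(4)[of j i] R(1) j by (simp add: q nth_append)
    qed
    moreover have "psize (\<lambda>i. count_list (?F q i) x) = \<alpha> x" if x: "x < Suc k" for x
    proof (cases "x = k")
      case False
      then show ?thesis using R(5)[of x] x by (simp add: q count_list_append_replicate)
    next
      case True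
      have "count_list (R i) k = 0" for i using R(3)[of i] by (auto simp: count_list_0_iff)
      then have cnt: "count_list (?F q i) x = f i - g i" for i
        by (simp add: q True count_list_replicate)
      have "psize (\<lambda>i. f i - g i) + psize g = psize f"
        using L gL g'(1) by (simp add: psize_eq[of L] flip: sum.distrib)
      moreover have "psize (\<lambda>i. count_list (?F q i) x) = psize (\<lambda>i. f i - g i)" by (simp only: cnt)
      ultimately show ?thesis using g'(3) True by simp
    qed
    ultimately show "?F q \<in> row_tableaux (Suc k) \<alpha> f" unfolding row_tableaux_def by blast
  qed
  show "?G ` row_tableaux (Suc k) \<alpha> f \<subseteq> Sigma (down (\<alpha> k) f) (row_tableaux k \<alpha>)"
  proof (rule image_subsetI)
    fix R assume R0: "R \<in> row_tableaux (Suc k) \<alpha> f"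
    then have R: "\<And>i. length (R i) = f i" "\<And>i. sorted (R i)" "\<And>i. set (R i) \<subseteq> {..<Suc k}"
      "\<And>i j. j < f (Suc i) \<Longrightarrow> R i ! j < R (Suc i) ! j" "\<And>x. x < Suc k \<Longrightarrow> psize (\<lambda>i. count_list (R i) x) = \<alpha> x"
      unfolding row_tableaux_def by blast+
    define g where "g i = length (?low (R i))" for i
    have gf: "g i \<le> f i" for i using R(1)[of i] length_filter_le[of "\<lambda>x. x < k" "R i"] by (simp add: g_def)
    have nth: "R i ! j = (if j < g i then ?low (R i) ! j else k)" if "j < f i" for i j
    proof -
      have "R i ! j = (?low (R i) @ replicate (f i - g i) k) ! j"
        using split[OF R0, of i] by (simp add: g_def)
      then show ?thesis using that by (simp add: nth_append g_def)
    qed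
    \<comment> \<open>Otherwise the first entry k of row i would have a box below it, whose entry
      would have to exceed k.\<close>
    have fg: "f (Suc i) \<le> g i" for i
    proof (rule ccontr)
      assume "\<not> f (Suc i) \<le> g i"
      then have j: "g i < f (Suc i)" by simp
      moreover have "f (Suc i) \<le> f i" using shapes_antimono[OF f, of i "Suc i"] by simp
      ultimately have "R i ! g i = k" using nth[of "g i" i] by simp
      moreover have "R (Suc i) ! g i < Suc k"
        using R(1,3)[of "Suc i"] j by (metis lessThan_iff nth_mem subsetD)
      ultimately show False using R(4)[OF j] by simp
    qed
    have strip: "hstrip g f" using gf fg by (simp add: hstrip_def)
    then have g: "g \<in> shapes" using f by (rule hstrip_shapes_lower)
    have gL: "g i = 0" if "i \<ge> L" for i using gf[of i] L that by simp
    have "count_list (R i) k = f i - g i" for i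
    proof -
      have "count_list (R i) k = count_list (?low (R i) @ replicate (f i - g i) k) k"
        using split[OF R0, of i] by (simp add: g_def)
      also have "\<dots> = f i - g i" by (simp add: count_list_filter count_list_replicate)
      finally show ?thesis .
    qed
    then have "psize (\<lambda>i. f i - g i) = \<alpha> k" using R(5)[of k] by simp
    moreover have "psize (\<lambda>i. f i - g i) + psize g = psize f"
      using L gL gf by (simp add: psize_eq[of L] flip: sum.distrib)
    ultimately have "g \<in> down (\<alpha> k) f" using g strip by (simp add: down_def)
    moreover have "(\<lambda>i. ?low (R i)) \<in> row_tableaux k \<alpha> g"
    proof -
      have "?low (R i) ! j < ?low (R (Suc i)) ! j" if "j < g (Suc i)" for i j
      proof -
        have "j < f (Suc i)" using that gf[of "Suc i"] by simp
        moreover have "j < g i" using \<open>j < f (Suc i)\<close> fg[of i] by simp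
        ultimately show ?thesis using R(4)[of j i] nth[of j i] nth[of j "Suc i"] gf[of i] that by simp
      qed
      moreover have "psize (\<lambda>i. count_list (?low (R i)) x) = \<alpha> x" if "x < k" for x
        using R(5)[of x] that by (simp add: count_list_filter)
      moreover have "sorted (?low (R i))" for i using R(2)[of i] by (rule sorted_wrt_filter)
      ultimately show ?thesis unfolding row_tableaux_def by (auto simp: g_def)
    qed
    ultimately show "?G R \<in> Sigma (down (\<alpha> k) f) (row_tableaux k \<alpha>)" by (auto simp: g_def[abs_def])
  qed
qed

lemma card_row_tableaux:
  "f \<in> shapes \<Longrightarrow> finite (row_tableaux k \<alpha> f) \<and> card (row_tableaux k \<alpha> f) = chain_count k \<alpha> f"
proof (induction k arbitrary: f)
  case (Suc k)
  have IH: "finite (row_tableaux k \<alpha> g)" "card (row_tableaux k \<alpha> g) = chain_count k \<alpha> g"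
    if "g \<in> down (\<alpha> k) f" for g
    using Suc.IH[of g] that by (auto simp: down_def)
  have "finite (Sigma (down (\<alpha> k) f) (row_tableaux k \<alpha>))" using IH by auto
  moreover have "card (Sigma (down (\<alpha> k) f) (row_tableaux k \<alpha>)) = chain_count (Suc k) \<alpha> f"
    using IH by (simp add: card_SigmaI)
  ultimately show ?case
    using bij_betw_finite[OF row_tableaux_Suc[OF Suc.prems, of k \<alpha>]]
      bij_betw_same_card[OF row_tableaux_Suc[OF Suc.prems, of k \<alpha>]] by simp
qed (simp add: row_tableaux_0)

definition part_fun :: "nat list \<Rightarrow> nat \<Rightarrow> nat" where
  "part_fun \<nu> i = (if i < length \<nu> then \<nu> ! i else 0)"

definition shape_length :: "(nat \<Rightarrow> nat) \<Rightarrow> nat" where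
  "shape_length f = (LEAST i. f i = 0)"

lemma shape_length:
  assumes "f \<in> shapes"
  shows "f i = 0 \<longleftrightarrow> shape_length f \<le> i"
proof
  show "f i = 0 \<Longrightarrow> shape_length f \<le> i" unfolding shape_length_def by (rule Least_le)
  obtain L where L: "\<forall>i\<ge>L. f i = 0" using shapes_support[OF assms] by blast
  then have "f (shape_length f) = 0"
    unfolding shape_length_def using LeastI[of "\<lambda>i. f i = 0" L] by simp
  moreover assume "shape_length f \<le> i"
  ultimately show "f i = 0" using shapes_antimono[OF assms, of "shape_length f" i] by simp
qed

lemma part_fun_bij: "bij_betw part_fun (partitions d) (shapes_of_size d)"
proof (rule bij_betw_byWitness[where f' = "\<lambda>f. map f [0..<shape_length f]"])
  have shape: "part_fun \<nu> \<in> shapes" if "\<nu> \<in> partitions d" for \<nu>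
  proof (rule shapesI[of _ "length \<nu>"])
    show "part_fun \<nu> (Suc i) \<le> part_fun \<nu> i" for i
      using that sorted_wrt_nth_less[of "(\<ge>)" \<nu> i "Suc i"] by (auto simp: part_fun_def partitions_def)
  qed (simp add: part_fun_def)
  show "\<forall>\<nu>\<in>partitions d. map (part_fun \<nu>) [0..<shape_length (part_fun \<nu>)] = \<nu>"
  proof
    fix \<nu> assume \<nu>: "\<nu> \<in> partitions d"
    have pos: "part_fun \<nu> i \<noteq> 0" if "i < length \<nu>" for i
    proof -
      have "0 \<notin> set \<nu>" using \<nu> by (simp add: partitions_def)
      moreover have "\<nu> ! i \<in> set \<nu>" using that by simp
      ultimately show ?thesis using that by (metis part_fun_def)
    qed
    have "shape_length (part_fun \<nu>) \<le> length \<nu>"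
      using shape_length[OF shape[OF \<nu>], of "length \<nu>"] by (simp add: part_fun_def)
    moreover have "\<not> shape_length (part_fun \<nu>) < length \<nu>"
      using pos shape_length[OF shape[OF \<nu>], of "shape_length (part_fun \<nu>)"] by blast
    ultimately have "shape_length (part_fun \<nu>) = length \<nu>" by simp
    then show "map (part_fun \<nu>) [0..<shape_length (part_fun \<nu>)] = \<nu>"
      by (intro nth_equalityI) (auto simp: part_fun_def)
  qed
  show "part_fun ` partitions d \<subseteq> shapes_of_size d"
  proof (rule image_subsetI)
    fix \<nu> assume \<nu>: "\<nu> \<in> partitions d"
    have "psize (part_fun \<nu>) = (\<Sum>i<length \<nu>. part_fun \<nu> i)"
      by (rule psize_eq) (simp add: part_fun_def)
    also have "\<dots> = sum_list \<nu>"
      by (simp add: sum_list_sum_nth part_fun_def lessThan_atLeast0)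
    finally show "part_fun \<nu> \<in> shapes_of_size d"
      using \<nu> shape by (simp add: shapes_of_size_def partitions_def)
  qed
  show "\<forall>f\<in>shapes_of_size d. part_fun (map f [0..<shape_length f]) = f"
  proof
    fix f assume "f \<in> shapes_of_size d"
    then have "f \<in> shapes" by (simp add: shapes_of_size_def)
    then show "part_fun (map f [0..<shape_length f]) = f"
      using shape_length[of f] by (auto simp: part_fun_def)
  qed
  show "(\<lambda>f. map f [0..<shape_length f]) ` shapes_of_size d \<subseteq> partitions d"
  proof (rule image_subsetI)
    fix f assume "f \<in> shapes_of_size d"
    then have f: "f \<in> shapes" "psize f = d" by (auto simp: shapes_of_size_def)
    have "sorted_wrt (\<ge>) (map f [0..<shape_length f])"
      using shapes_antimono[OF f(1)] by (simp add: sorted_wrt_iff_nth_less)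
    moreover have "0 \<notin> set (map f [0..<shape_length f])"
      using shape_length[OF f(1)] by auto
    moreover have "sum_list (map f [0..<shape_length f]) = psize f"
    proof -
      have "psize f = (\<Sum>i<shape_length f. f i)"
        using shape_length[OF f(1)] by (intro psize_eq) simp
      then show ?thesis by (simp add: sum_list_sum_nth lessThan_atLeast0)
    qed
    ultimately show "map f [0..<shape_length f] \<in> partitions d" using f(2) by (simp add: partitions_def)
  qed
qed

lemma finite_partitions [simp]: "finite (partitions d)"
  using bij_betw_finite[OF part_fun_bij[of d]] by simp

lemma part_fun_shapes: "\<nu> \<in> partitions d \<Longrightarrow> part_fun \<nu> \<in> shapes_of_size d"
  using bij_betw_apply[OF part_fun_bij] .

lemma sum_partitions: "(\<Sum>\<nu>\<in>partitions d. F (part_fun \<nu>)) = (\<Sum>f\<in>shapes_of_size d. F f)"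
  by (rule sum.reindex_bij_betw[OF part_fun_bij])

lemma count_mset_concat: "count (mset (concat t)) x = (\<Sum>i<length t. count_list (t ! i) x)"
  by (induction t) (simp_all add: sum.lessThan_Suc_shift count_mset del: sum.lessThan_Suc)

text \<open>Padding with empty rows turns a tableau into a row tableau. The number k may be any
  bound on the variables of X, so one k can serve all shapes at once.\<close>

lemma mcoeff_schur:
  assumes \<nu>: "\<nu> \<in> partitions d" and X: "set_mset X \<subseteq> {..<k}"
  shows "mcoeff (schur \<nu>) X = of_nat (chain_count k (count X) (part_fun \<nu>))"
proof -
  let ?f = "part_fun \<nu>"
  have "bij_betw (\<lambda>R. map R [0..<length \<nu>]) (row_tableaux k (count X) ?f) {t \<in> SSYT \<nu>. mset (concat t) = X}"
  proof (rule bij_betw_byWitness[where f' = "\<lambda>t i. if i < length t then t ! i else []"])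
    let ?S = "{t \<in> SSYT \<nu>. mset (concat t) = X}"
    show "\<forall>R\<in>row_tableaux k (count X) ?f. (\<lambda>i. if i < length (map R [0..<length \<nu>]) then map R [0..<length \<nu>] ! i else []) = R"
      by (auto simp: row_tableaux_def fun_eq_iff part_fun_def)
    have len: "length t = length \<nu>" "\<And>i. i < length \<nu> \<Longrightarrow> length (t ! i) = \<nu> ! i" if "t \<in> SSYT \<nu>" for t
      using that by (auto simp: SSYT_def)
    show "\<forall>t\<in>?S. map (\<lambda>i. if i < length t then t ! i else []) [0..<length \<nu>] = t"
      using len by (auto intro!: nth_equalityI)
    show "(\<lambda>R. map R [0..<length \<nu>]) ` row_tableaux k (count X) ?f \<subseteq> ?S"
    proof (rule image_subsetI)
      fix R assume "R \<in> row_tableaux k (count X) ?f"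
      then have R: "\<And>i. length (R i) = ?f i" "\<And>i. sorted (R i)" "\<And>i. set (R i) \<subseteq> {..<k}"
        "\<And>i j. j < ?f (Suc i) \<Longrightarrow> R i ! j < R (Suc i) ! j" "\<And>x. x < k \<Longrightarrow> psize (\<lambda>i. count_list (R i) x) = count X x"
        unfolding row_tableaux_def by blast+
      let ?t = "map R [0..<length \<nu>]"
      have "map length ?t = \<nu>" using R(1) by (intro nth_equalityI) (auto simp: part_fun_def)
      moreover have "\<forall>r\<in>set ?t. sorted r" using R(2) by auto
      moreover have "?t ! i ! j < ?t ! Suc i ! j" if "Suc i < length ?t" "j < length (?t ! Suc i)" for i j
        using R(1,4) that by simp
      ultimately have "?t \<in> SSYT \<nu>" by (simp add: SSYT_def)
      moreover have "mset (concat ?t) = X"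
      proof (rule multiset_eqI)
        fix x
        have c: "count (mset (concat ?t)) x = (\<Sum>i<length \<nu>. count_list (R i) x)"
          unfolding count_mset_concat by (intro sum.cong) auto
        show "count (mset (concat ?t)) x = count X x"
        proof (cases "x < k")
          case True
          have "R i = []" if "i \<ge> length \<nu>" for i using R(1)[of i] that by (simp add: part_fun_def)
          then have "psize (\<lambda>i. count_list (R i) x) = (\<Sum>i<length \<nu>. count_list (R i) x)"
            by (intro psize_eq) auto
          then show ?thesis using R(5)[OF True] c by simp
        next
          case False
          then have "count_list (R i) x = 0" for i using R(3)[of i] by (auto simp: count_list_0_iff)
          moreover have "count X x = 0" using X False by (auto simp: count_eq_zero_iff)
          ultimately show ?thesis using c by simp
        qed
      qed
      ultimately show "?t \<in> ?S" by simp
    qed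
    show "(\<lambda>t i. if i < length t then t ! i else []) ` ?S \<subseteq> row_tableaux k (count X) ?f"
    proof (rule image_subsetI)
      fix t assume t: "t \<in> ?S"
      let ?R = "\<lambda>i. if i < length t then t ! i else []"
      have lt: "length t = length \<nu>" "\<And>i. i < length \<nu> \<Longrightarrow> length (t ! i) = \<nu> ! i" using len t by blast+
      have st: "\<forall>r\<in>set t. sorted r" "\<And>i j. Suc i < length t \<Longrightarrow> j < length (t ! Suc i) \<Longrightarrow> t ! i ! j < t ! Suc i ! j"
        "mset (concat t) = X"
        using t by (auto simp: SSYT_def)
      have "length (?R i) = ?f i" for i using lt by (simp add: part_fun_def)
      moreover have "sorted (?R i)" for i using st(1) by simp
      moreover have "set (?R i) \<subseteq> {..<k}" for i
      proof (cases "i < length t")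
        case True
        then have "set (t ! i) \<subseteq> set_mset (mset (concat t))" by (auto intro: nth_mem)
        then show ?thesis using X st(3) True by auto
      qed simp
      moreover have "?R i ! j < ?R (Suc i) ! j" if "j < ?f (Suc i)" for i j
        using that st(2)[of i j] lt by (auto simp: part_fun_def split: if_splits)
      moreover have "psize (\<lambda>i. count_list (?R i) x) = count X x" for x
      proof -
        have "psize (\<lambda>i. count_list (?R i) x) = (\<Sum>i<length t. count_list (?R i) x)" by (intro psize_eq) auto
        also have "\<dots> = count (mset (concat t)) x" unfolding count_mset_concat by (intro sum.cong) auto
        finally show ?thesis by (simp only: st(3))
      qed
      ultimately show "?R \<in> row_tableaux k (count X) ?f" unfolding row_tableaux_def by blast
    qed
  qed
  then have "card {t \<in> SSYT \<nu>. mset (concat t) = X} = card (row_tableaux k (count X) ?f)"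
    by (simp add: bij_betw_same_card)
  also have "\<dots> = chain_count k (count X) ?f"
    using card_row_tableaux part_fun_shapes[OF \<nu>] by (simp add: shapes_of_size_def)
  finally show ?thesis by (simp add: schur.rep_eq)
qed


section \<open>Schur expansions\<close>

text \<open>States that L(f) = c. Linearity holds for the relation without knowing that the
  coefficients are unique.\<close>

definition schur_expansion :: "nat \<Rightarrow> mser \<Rightarrow> rat \<Rightarrow> bool" where
  "schur_expansion N f c \<longleftrightarrow>
     (\<exists>a. f = (\<Sum>\<nu>\<in>partitions N. mscale (a \<nu>) (schur \<nu>)) \<and> (\<Sum>\<nu>\<in>partitions N. a \<nu>) = c)"

lemma schur_expansion_zero: "schur_expansion N 0 0"
  unfolding schur_expansion_def by (rule exI[of _ "\<lambda>_. 0"]) simp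

lemma schur_expansion_add:
  assumes "schur_expansion N f c" "schur_expansion N g d"
  shows "schur_expansion N (f + g) (c + d)"
proof -
  obtain a b where "f = (\<Sum>\<nu>\<in>partitions N. mscale (a \<nu>) (schur \<nu>))" "(\<Sum>\<nu>\<in>partitions N. a \<nu>) = c"
    "g = (\<Sum>\<nu>\<in>partitions N. mscale (b \<nu>) (schur \<nu>))" "(\<Sum>\<nu>\<in>partitions N. b \<nu>) = d"
    using assms unfolding schur_expansion_def by blast
  then show ?thesis
    unfolding schur_expansion_def
    by (intro exI[of _ "\<lambda>\<nu>. a \<nu> + b \<nu>"]) (simp add: sum.distrib mser.scale_left_distrib)
qed

lemma schur_expansion_scale:
  assumes "schur_expansion N f c"
  shows "schur_expansion N (mscale r f) (r * c)"
proof -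
  obtain a where "f = (\<Sum>\<nu>\<in>partitions N. mscale (a \<nu>) (schur \<nu>))" "(\<Sum>\<nu>\<in>partitions N. a \<nu>) = c"
    using assms unfolding schur_expansion_def by blast
  then show ?thesis
    unfolding schur_expansion_def
    by (intro exI[of _ "\<lambda>\<nu>. r * a \<nu>"]) (auto simp: sum_distrib_left mser.scale_sum_right)
qed

lemma schur_expansion_sum:
  "(\<And>i. i \<in> I \<Longrightarrow> schur_expansion N (f i) (c i)) \<Longrightarrow> schur_expansion N (sum f I) (sum c I)"
  by (induction I rule: infinite_finite_induct)
    (auto intro: schur_expansion_zero schur_expansion_add)

lemma schur_expansion_diff:
  assumes "schur_expansion N f c" "schur_expansion N g d"
  shows "schur_expansion N (f - g) (c - d)"
proof -
  have "f - g = f + mscale (-1) g" by (rule mser_eqI) simp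
  moreover have "c - d = c + (-1) * d" by simp
  ultimately show ?thesis using assms by (metis schur_expansion_add schur_expansion_scale)
qed

lemma size_eq_sum_count: "set_mset M \<subseteq> {..<l :: nat} \<Longrightarrow> size M = (\<Sum>j<l. count M j)"
  unfolding size_multiset_overloaded_eq
  by (rule sum.mono_neutral_left) (auto simp: count_eq_zero_iff)

lemma count_Abs_multiset_bounded:
  fixes C :: "nat \<Rightarrow> nat"
  assumes "\<And>j. j \<ge> l \<Longrightarrow> C j = 0"
  shows "count (Abs_multiset C) = C" "set_mset (Abs_multiset C) \<subseteq> {..<l}"
proof -
  have "{j. 0 < C j} \<subseteq> {..<l}"
  proof
    fix j assume "j \<in> {j. 0 < C j}"
    then show "j \<in> {..<l}" using assms[of j] by (cases "j < l") auto
  qed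
  then show c: "count (Abs_multiset C) = C" by (intro count_Abs_multiset finite_subset[OF _ finite_lessThan])
  then have "set_mset (Abs_multiset C) = {j. 0 < C j}" by (simp add: set_mset_def)
  then show "set_mset (Abs_multiset C) \<subseteq> {..<l}" using \<open>{j. 0 < C j} \<subseteq> {..<l}\<close> by simp
qed

lemma card_fixed_tables_id:
  assumes \<alpha>: "\<And>a. a \<ge> k \<Longrightarrow> \<alpha> a = 0" and X: "set_mset X \<subseteq> {..<l}"
  shows "card (fixed_tables k \<alpha> id X) = card (nat_matrices k l \<alpha> (count X))"
proof (rule bij_betw_same_card[of "\<lambda>Y i. count (Y i)"],
    rule bij_betw_byWitness[where f' = "\<lambda>C i. Abs_multiset (C i)"])
  show "\<forall>Y\<in>fixed_tables k \<alpha> id X. (\<lambda>i. Abs_multiset (count (Y i))) = Y"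
    by (simp add: count_inverse)
  have C: "count (Abs_multiset (C i)) = C i" "set_mset (Abs_multiset (C i)) \<subseteq> {..<l}"
    if "C \<in> nat_matrices k l \<alpha> (count X)" for C i
    using that by (auto intro!: count_Abs_multiset_bounded simp: nat_matrices_def
        intro: subsetD[OF count_Abs_multiset_bounded(2)[of l "C i"]])
  show "\<forall>C\<in>nat_matrices k l \<alpha> (count X). (\<lambda>i. count (Abs_multiset (C i))) = C"
    using C by simp
  show "(\<lambda>Y i. count (Y i)) ` fixed_tables k \<alpha> id X \<subseteq> nat_matrices k l \<alpha> (count X)"
  proof (rule image_subsetI)
    fix Y assume "Y \<in> fixed_tables k \<alpha> id X"
    then have Y: "\<And>a. size (Y a) = \<alpha> a" "(\<Sum>a<k. Y a) = X" by (auto simp: fixed_tables_def)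
    have empty: "Y i = {#}" if "i \<ge> k" for i using Y(1)[of i] \<alpha>[OF that] by simp
    have "set_mset (Y i) \<subseteq> set_mset X" for i
      using Y(2) empty[of i] by (cases "i < k") (auto simp: set_mset_sum)
    then have sub: "set_mset (Y i) \<subseteq> {..<l}" for i using X by blast
    have "count (Y i) j = 0" if "i \<ge> k \<or> j \<ge> l" for i j
      using that empty[of i] sub[of i] by (auto simp: count_eq_zero_iff)
    moreover have "(\<Sum>j<l. count (Y i) j) = \<alpha> i" for i
      using size_eq_sum_count[OF sub[of i]] Y(1)[of i] by simp
    moreover have "(\<Sum>i<k. count (Y i) j) = count X j" for j
      using Y(2) by (auto simp: count_sum)
    ultimately show "(\<lambda>i. count (Y i)) \<in> nat_matrices k l \<alpha> (count X)" by (simp add: nat_matrices_def)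
  qed
  show "(\<lambda>C i. Abs_multiset (C i)) ` nat_matrices k l \<alpha> (count X) \<subseteq> fixed_tables k \<alpha> id X"
  proof (rule image_subsetI)
    fix C assume C': "C \<in> nat_matrices k l \<alpha> (count X)"
    have "size (Abs_multiset (C i)) = \<alpha> i" for i
    proof -
      have "size (Abs_multiset (C i)) = (\<Sum>j<l. C i j)"
        using size_eq_sum_count[OF C(2)[OF C', of i]] C(1)[OF C', of i] by simp
      also have "\<dots> = \<alpha> i"
        using C' \<alpha>[of i] by (cases "i < k") (auto simp: nat_matrices_def)
      finally show ?thesis .
    qed
    moreover have "(\<Sum>i<k. Abs_multiset (C i)) = X"
    proof (rule multiset_eqI)
      fix j
      have "count (\<Sum>i<k. Abs_multiset (C i)) j = (\<Sum>i<k. C i j)" by (simp add: count_sum C(1)[OF C'])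
      also have "\<dots> = count X j"
      proof (cases "j < l")
        case False
        then have "count X j = 0" using X by (auto simp: count_eq_zero_iff)
        then show ?thesis using C' False by (simp add: nat_matrices_def)
      qed (use C' in \<open>simp add: nat_matrices_def\<close>)
      finally show "count (\<Sum>i<k. Abs_multiset (C i)) j = count X j" .
    qed
    ultimately show "(\<lambda>i. Abs_multiset (C i)) \<in> fixed_tables k \<alpha> id X" by (simp add: fixed_tables_def)
  qed
qed

lemma card_symmetric_tables_id:
  assumes \<alpha>: "\<And>a. a \<ge> k \<Longrightarrow> \<alpha> a = 0"
  shows "card (symmetric_tables \<alpha> id) = card (symmetric_matrices k \<alpha>)"
proof (rule bij_betw_same_card[of "\<lambda>Y i. count (Y i)"],
    rule bij_betw_byWitness[where f' = "\<lambda>C i. Abs_multiset (C i)"])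
  show "\<forall>Y\<in>symmetric_tables \<alpha> id. (\<lambda>i. Abs_multiset (count (Y i))) = Y"
    by (simp add: count_inverse)
  have C0: "C i j = 0" if "C \<in> symmetric_matrices k \<alpha>" "j \<ge> k" for C i j
  proof -
    have "C i j = C j i" "C j i = 0" using that unfolding symmetric_matrices_def by blast+
    then show ?thesis by simp
  qed
  have C: "count (Abs_multiset (C i)) = C i" "set_mset (Abs_multiset (C i)) \<subseteq> {..<k}"
    if "C \<in> symmetric_matrices k \<alpha>" for C i
    using count_Abs_multiset_bounded[of k "C i"] C0[OF that] by auto
  show "\<forall>C\<in>symmetric_matrices k \<alpha>. (\<lambda>i. count (Abs_multiset (C i))) = C"
    using C by simp
  show "(\<lambda>Y i. count (Y i)) ` symmetric_tables \<alpha> id \<subseteq> symmetric_matrices k \<alpha>"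
  proof (rule image_subsetI)
    fix Y assume "Y \<in> symmetric_tables \<alpha> id"
    then have Y: "\<And>a. size (Y a) = \<alpha> a" "\<And>a b. count (Y b) a = count (Y a) b"
      by (auto simp: symmetric_tables_def)
    have empty: "Y i = {#}" if "i \<ge> k" for i using Y(1)[of i] \<alpha>[OF that] by simp
    then have "count (Y j) i = 0" if "j \<ge> k" for i j using that by simp
    then have zero: "count (Y i) j = 0" if "j \<ge> k" for i j using Y(2)[of i j] that by simp
    have sub: "set_mset (Y i) \<subseteq> {..<k}" for i
    proof
      fix j assume "j \<in># Y i"
      then have "count (Y i) j \<noteq> 0" by (simp add: count_eq_zero_iff)
      then show "j \<in> {..<k}" using zero[of j i] by (cases "j < k") auto
    qed
    have "(\<Sum>j<k. count (Y i) j) = \<alpha> i" for i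
      using size_eq_sum_count[OF sub[of i]] Y(1)[of i] by simp
    then show "(\<lambda>i. count (Y i)) \<in> symmetric_matrices k \<alpha>"
      using empty Y(2) unfolding symmetric_matrices_def by simp
  qed
  show "(\<lambda>C i. Abs_multiset (C i)) ` symmetric_matrices k \<alpha> \<subseteq> symmetric_tables \<alpha> id"
  proof (rule image_subsetI)
    fix C assume C': "C \<in> symmetric_matrices k \<alpha>"
    have "size (Abs_multiset (C i)) = \<alpha> i" for i
    proof -
      have "size (Abs_multiset (C i)) = (\<Sum>j<k. C i j)"
        using size_eq_sum_count[OF C(2)[OF C', of i]] C(1)[OF C', of i] by simp
      also have "\<dots> = \<alpha> i"
      proof (cases "i < k")
        case False
        then have "C i j = 0" for j using C' unfolding symmetric_matrices_def by auto
        then show ?thesis using \<alpha>[of i] False by simp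
      next
        case True
        then show ?thesis using C' unfolding symmetric_matrices_def by blast
      qed
      finally show ?thesis .
    qed
    moreover have "C b a = C a b" for a b using C' unfolding symmetric_matrices_def by blast
    ultimately show "(\<lambda>i. Abs_multiset (C i)) \<in> symmetric_tables \<alpha> id"
      by (simp add: symmetric_tables_def C(1)[OF C'])
  qed
qed

text \<open>The product h_\<alpha> of complete functions: row a of a table is the monomial taken
  from the factor of degree \<open>\<alpha> a\<close>.\<close>

lift_definition complete_series :: "nat \<Rightarrow> (nat \<Rightarrow> nat) \<Rightarrow> mser" is
  "\<lambda>k \<alpha> X. of_nat (card (fixed_tables k \<alpha> id X))" .

text \<open>Compared at the monomial X, the identity h_\<alpha> = \<Sum> K_{\<nu>,\<alpha>} s_\<nu>
  is the matrix count for row sums \<alpha> and column sums \<open>count X\<close>. The value of L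
  is the symmetric count.\<close>

lemma schur_expansion_complete_series:
  assumes \<alpha>: "\<And>a. a \<ge> k \<Longrightarrow> \<alpha> a = 0" and N: "(\<Sum>a<k. \<alpha> a) = N"
  shows "schur_expansion N (complete_series k \<alpha>) (of_nat (card (symmetric_tables \<alpha> id)))"
  unfolding schur_expansion_def
proof (intro exI[of _ "\<lambda>\<nu>. of_nat (chain_count k \<alpha> (part_fun \<nu>))"] conjI)
  show "complete_series k \<alpha> = (\<Sum>\<nu>\<in>partitions N. mscale (of_nat (chain_count k \<alpha> (part_fun \<nu>))) (schur \<nu>))"
  proof (rule mser_eqI)
    fix X :: "nat multiset"
    obtain l where l: "set_mset X \<subseteq> {..<l}"
      using finite_nat_set_iff_bounded[of "set_mset X"] by auto
    have "mcoeff (\<Sum>\<nu>\<in>partitions N. mscale (of_nat (chain_count k \<alpha> (part_fun \<nu>))) (schur \<nu>)) X =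
        of_nat (\<Sum>\<nu>\<in>partitions N. chain_count k \<alpha> (part_fun \<nu>) * chain_count l (count X) (part_fun \<nu>))"
      unfolding mcoeff_sum of_nat_sum by (intro sum.cong) (auto simp: mcoeff_schur[OF _ l])
    also have "\<dots> = of_nat (card (nat_matrices k l \<alpha> (count X)))"
      using sum_chain_count_times_chain_count[OF N, of l "count X"]
        sum_partitions[of "\<lambda>f. chain_count k \<alpha> f * chain_count l (count X) f" N] by simp
    also have "\<dots> = mcoeff (complete_series k \<alpha>) X"
      using card_fixed_tables_id[of k \<alpha>, OF \<alpha> l] by (simp add: complete_series.rep_eq)
    finally show "mcoeff (complete_series k \<alpha>) X =
        mcoeff (\<Sum>\<nu>\<in>partitions N. mscale (of_nat (chain_count k \<alpha> (part_fun \<nu>))) (schur \<nu>)) X" ..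
  qed
  have "(\<Sum>\<nu>\<in>partitions N. chain_count k \<alpha> (part_fun \<nu>)) = card (symmetric_tables \<alpha> id)"
    using sum_chain_count[OF N] sum_partitions[of "chain_count k \<alpha>" N]
      card_symmetric_tables_id[of k \<alpha>, OF \<alpha>] by simp
  then show "(\<Sum>\<nu>\<in>partitions N. rat_of_nat (chain_count k \<alpha> (part_fun \<nu>))) = of_nat (card (symmetric_tables \<alpha> id))"
    by (metis of_nat_sum)
qed


section \<open>Linear independence of the Schur functions\<close>

lemma chain_count_support:
  assumes "chain_count k \<alpha> f \<noteq> 0"
  shows "\<forall>i\<ge>k. f i = 0" "psize f = (\<Sum>i<k. \<alpha> i)"
proof -
  have "(\<forall>i\<ge>k. f i = 0) \<and> psize f = (\<Sum>i<k. \<alpha> i)"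
    using assms
  proof (induction k arbitrary: f)
    case 0
    then show ?case by (simp add: zero_shape split: if_splits)
  next
    case (Suc k)
    then obtain g where g: "g \<in> down (\<alpha> k) f" "chain_count k \<alpha> g \<noteq> 0"
      by (auto simp: sum.neutral)
    have "f (Suc i) = 0" if "i \<ge> k" for i
      using Suc.IH[OF g(2)] g(1) that by (auto simp: down_def hstrip_def) (metis le_zero_eq)
    then have "f i = 0" if "i \<ge> Suc k" for i using that by (cases i) auto
    then show ?case using Suc.IH[OF g(2)] g(1) by (simp add: down_def)
  qed
  then show "\<forall>i\<ge>k. f i = 0" "psize f = (\<Sum>i<k. \<alpha> i)" by auto
qed

text \<open>After j steps a chain has size \<alpha> 0 + ... + \<alpha> (j-1), and its shape lies in
  the first j rows of f, since each strip opens at most one new row.\<close>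

lemma chain_count_dominance:
  assumes "chain_count k \<alpha> f \<noteq> 0" "j \<le> k"
  shows "(\<Sum>i<j. \<alpha> i) \<le> (\<Sum>i<j. f i)"
  using assms
proof (induction k arbitrary: f)
  case (Suc k)
  then obtain g where g: "g \<in> down (\<alpha> k) f" "chain_count k \<alpha> g \<noteq> 0"
    by (auto simp: sum.neutral)
  show ?case
  proof (cases "j \<le> k")
    case True
    then have "(\<Sum>i<j. \<alpha> i) \<le> (\<Sum>i<j. g i)" using Suc.IH g by blast
    also have "\<dots> \<le> (\<Sum>i<j. f i)" using g(1) by (intro sum_mono) (simp add: down_def hstrip_def)
    finally show ?thesis .
  next
    case False
    then have j: "j = Suc k" using Suc.prems by simp
    show ?thesis
      using chain_count_support[OF Suc.prems(1)] psize_eq[of "Suc k" f] by (simp add: j)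
  qed
qed simp

text \<open>The chain that adds one complete row of f at a time.\<close>

lemma chain_count_self:
  assumes f: "f \<in> shapes"
  shows "chain_count k f (\<lambda>i. if i < k then f i else 0) \<noteq> 0"
proof (induction k)
  case (Suc k)
  let ?g = "\<lambda>k i. if i < k then f i else 0"
  have shape: "?g k \<in> shapes" for k
    using shapes_antimono[OF f] by (intro shapesI[of _ k]) auto
  have psize: "psize (?g k) = (\<Sum>i<k. f i)" for k
    by (subst psize_eq[of k]) auto
  have "hstrip (?g k) (?g (Suc k))"
    using shapes_antimono[OF f] by (auto simp: hstrip_def)
  then have "?g k \<in> down (f k) (?g (Suc k))"
    using shape psize by (simp add: down_def)
  then show ?case using Suc.IH by (simp, blast)
qed simp

text \<open>Kostka numbers are triangular for dominance: the monomial with exponents \<mu> occurs in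
  s_\<kappa> only if \<kappa> dominates \<mu>. It is tested for a \<mu> that is maximal among the
  partitions with nonzero coefficient.\<close>

lemma schur_lin_indep:
  assumes "(\<Sum>\<nu>\<in>partitions N. mscale (a \<nu>) (schur \<nu>)) = 0" "\<nu> \<in> partitions N"
  shows "a \<nu> = 0"
proof (rule ccontr)
  assume nz: "a \<nu> \<noteq> 0"
  \<comment> \<open>Dominance is only a partial order. The sum of all partial sums is strictly
    monotone along it, so a maximum of this number is maximal for dominance.\<close>
  define pot where "pot f = (\<Sum>j\<le>N. \<Sum>i<j. f i)" for f :: "nat \<Rightarrow> nat"
  define T where "T = {\<nu> \<in> partitions N. a \<nu> \<noteq> 0}"
  have T: "finite T" "T \<noteq> {}" using assms(2) nz by (auto simp: T_def)
  then have "Max ((\<lambda>\<nu>. pot (part_fun \<nu>)) ` T) \<in> (\<lambda>\<nu>. pot (part_fun \<nu>)) ` T" by (intro Max_in) auto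
  then obtain \<mu> where \<mu>T: "\<mu> \<in> T" "Max ((\<lambda>\<nu>. pot (part_fun \<nu>)) ` T) = pot (part_fun \<mu>)" by (rule imageE)
  have max: "pot (part_fun \<kappa>) \<le> pot (part_fun \<mu>)" if "\<kappa> \<in> T" for \<kappa>
    using that T(1) by (auto simp flip: \<mu>T(2))
  have \<mu>: "\<mu> \<in> partitions N" "a \<mu> \<noteq> 0" using \<mu>T by (auto simp: T_def)
  have zero: "part_fun \<kappa> i = 0" if "\<kappa> \<in> partitions N" "i \<ge> N" for \<kappa> i
    using part_fun_shapes[OF that(1)] shapes_zero_beyond_size[of "part_fun \<kappa>" i] that(2)
    by (simp add: shapes_of_size_def)
  define X where "X = Abs_multiset (part_fun \<mu>)"
  have X: "count X = part_fun \<mu>" "set_mset X \<subseteq> {..<N}"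
    unfolding X_def using count_Abs_multiset_bounded[of N "part_fun \<mu>"] zero[OF \<mu>(1)] by auto
  have only: "chain_count N (part_fun \<mu>) (part_fun \<kappa>) = 0" if \<kappa>: "\<kappa> \<in> T" "\<kappa> \<noteq> \<mu>" for \<kappa>
  proof (rule ccontr)
    assume c: "chain_count N (part_fun \<mu>) (part_fun \<kappa>) \<noteq> 0"
    have \<kappa>N: "\<kappa> \<in> partitions N" using \<kappa> by (simp add: T_def)
    have le: "(\<Sum>i<j. part_fun \<mu> i) \<le> (\<Sum>i<j. part_fun \<kappa> i)" if "j \<le> N" for j
      using chain_count_dominance[OF c that] .
    have eq: "(\<Sum>i<j. part_fun \<mu> i) = (\<Sum>i<j. part_fun \<kappa> i)" if "j \<le> N" for j
    proof (rule ccontr)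
      assume "(\<Sum>i<j. part_fun \<mu> i) \<noteq> (\<Sum>i<j. part_fun \<kappa> i)"
      then have "(\<Sum>i<j. part_fun \<mu> i) < (\<Sum>i<j. part_fun \<kappa> i)" using le[OF that] by simp
      then have "pot (part_fun \<mu>) < pot (part_fun \<kappa>)"
        unfolding pot_def using le that by (intro sum_strict_mono_ex1) auto
      then show False using max[OF \<kappa>(1)] by simp
    qed
    have "part_fun \<mu> i = part_fun \<kappa> i" for i
    proof (cases "i < N")
      case True
      then show ?thesis using eq[of i] eq[of "Suc i"] by simp
    next
      case False
      then show ?thesis using zero[OF \<mu>(1)] zero[OF \<kappa>N] by simp
    qed
    then have "part_fun \<mu> = part_fun \<kappa>" by (rule ext)
    then show False
      using bij_betw_imp_inj_on[OF part_fun_bij[of N]] \<mu>(1) \<kappa>N \<kappa>(2) by (auto dest: inj_onD)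
  qed
  have "0 = (\<Sum>\<kappa>\<in>partitions N. a \<kappa> * of_nat (chain_count N (part_fun \<mu>) (part_fun \<kappa>)))"
    using arg_cong[OF assms(1), of "\<lambda>f. mcoeff f X"] X(1)
    by (simp add: mcoeff_schur[OF _ X(2)] cong: sum.cong)
  also have "\<dots> = (\<Sum>\<kappa>\<in>{\<mu>}. a \<kappa> * of_nat (chain_count N (part_fun \<mu>) (part_fun \<kappa>)))"
  proof (rule sum.mono_neutral_right)
    show "\<forall>\<kappa>\<in>partitions N - {\<mu>}. a \<kappa> * of_nat (chain_count N (part_fun \<mu>) (part_fun \<kappa>)) = 0"
    proof
      fix \<kappa> assume "\<kappa> \<in> partitions N - {\<mu>}"
      then show "a \<kappa> * of_nat (chain_count N (part_fun \<mu>) (part_fun \<kappa>)) = 0"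
        using only[of \<kappa>] by (cases "a \<kappa> = 0") (auto simp: T_def)
    qed
  qed (use \<mu>(1) in auto)
  finally have "chain_count N (part_fun \<mu>) (part_fun \<mu>) = 0" using \<mu>(2) by simp
  moreover have "(\<lambda>i. if i < N then part_fun \<mu> i else 0) = part_fun \<mu>"
    using zero[OF \<mu>(1)] by (auto simp: fun_eq_iff)
  ultimately show False
    using chain_count_self[of "part_fun \<mu>" N] part_fun_shapes[OF \<mu>(1)] by (simp add: shapes_of_size_def)
qed

text \<open>The first part justifies the definite description in \<open>plethysm_coeff\<close>; the
  second evaluates the sum of the coefficients so described.\<close>

lemma schur_expansion_unique:
  assumes "schur_expansion N f c"
  shows "\<exists>!a. (\<forall>\<nu>. \<nu> \<notin> partitions N \<longrightarrow> a \<nu> = 0) \<and> f = (\<Sum>\<nu>\<in>partitions N. mscale (a \<nu>) (schur \<nu>))"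
    and "(\<forall>\<nu>. \<nu> \<notin> partitions N \<longrightarrow> a \<nu> = 0) \<and> f = (\<Sum>\<nu>\<in>partitions N. mscale (a \<nu>) (schur \<nu>)) \<Longrightarrow>
      (\<Sum>\<nu>\<in>partitions N. a \<nu>) = c"
proof -
  obtain b where b: "f = (\<Sum>\<nu>\<in>partitions N. mscale (b \<nu>) (schur \<nu>))" "(\<Sum>\<nu>\<in>partitions N. b \<nu>) = c"
    using assms unfolding schur_expansion_def by blast
  have uniq: "a \<nu> = b \<nu>" if "f = (\<Sum>\<nu>\<in>partitions N. mscale (a \<nu>) (schur \<nu>))" "\<nu> \<in> partitions N" for a \<nu>
  proof -
    have "(\<Sum>\<nu>\<in>partitions N. mscale (a \<nu> - b \<nu>) (schur \<nu>)) = f - f"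
      using that(1) b(1) by (simp add: mser.scale_left_diff_distrib sum_subtractf)
    then have "a \<nu> - b \<nu> = 0" using that(2) schur_lin_indep[of "\<lambda>\<nu>. a \<nu> - b \<nu>" N] by simp
    then show ?thesis by simp
  qed
  show "\<exists>!a. (\<forall>\<nu>. \<nu> \<notin> partitions N \<longrightarrow> a \<nu> = 0) \<and> f = (\<Sum>\<nu>\<in>partitions N. mscale (a \<nu>) (schur \<nu>))"
  proof (rule ex1I[of _ "\<lambda>\<nu>. if \<nu> \<in> partitions N then b \<nu> else 0"])
    show "(\<forall>\<nu>. \<nu> \<notin> partitions N \<longrightarrow> (if \<nu> \<in> partitions N then b \<nu> else 0) = 0) \<and>
        f = (\<Sum>\<nu>\<in>partitions N. mscale (if \<nu> \<in> partitions N then b \<nu> else 0) (schur \<nu>))"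
      using b(1) by simp
  next
    fix a assume a: "(\<forall>\<nu>. \<nu> \<notin> partitions N \<longrightarrow> a \<nu> = 0) \<and> f = (\<Sum>\<nu>\<in>partitions N. mscale (a \<nu>) (schur \<nu>))"
    show "a = (\<lambda>\<nu>. if \<nu> \<in> partitions N then b \<nu> else 0)"
      using a uniq[of a] by (intro ext) auto
  qed
  assume "(\<forall>\<nu>. \<nu> \<notin> partitions N \<longrightarrow> a \<nu> = 0) \<and> f = (\<Sum>\<nu>\<in>partitions N. mscale (a \<nu>) (schur \<nu>))"
  then have "(\<Sum>\<nu>\<in>partitions N. a \<nu>) = (\<Sum>\<nu>\<in>partitions N. b \<nu>)"
    using uniq[of a] by (intro sum.cong) auto
  then show "(\<Sum>\<nu>\<in>partitions N. a \<nu>) = c" using b(2) by simp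
qed


section \<open>Permutations with the same orbits\<close>

lemma permutes_permutation: "h permutes {..<N} \<Longrightarrow> permutation h" for N :: nat
  by (auto simp: permutation_permutes intro: exI[of _ "{..<N}"])

text \<open>On the orbit of b the permutation is a single cycle. The right side depends on the orbit
  alone, which lets equalities between iterates pass to another permutation with the same
  orbits.\<close>

lemma funpow_eq_iff_mod:
  assumes "permutation h"
  shows "(h ^^ m) b = (h ^^ n) b \<longleftrightarrow> m mod card (orbit h b) = n mod card (orbit h b)"
proof -
  have b: "b \<in> orbit h b" using assms by (rule permutation_self_in_orbit)
  define s where "s = funpow_dist1 h b b"
  have inj: "inj_on (\<lambda>n. (h ^^ n) b) {0..<s}" unfolding s_def using b by (rule inj_on_funpow_dist1)
  have "orbit h b = (\<lambda>n. (h ^^ n) b) ` {0..<s}" unfolding s_def using b by (rule orbit_conv_funpow_dist1)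
  then have card: "card (orbit h b) = s" using inj by (simp add: card_image)
  have period: "(h ^^ s) b = b" unfolding s_def using b by (rule funpow_dist1_prop)
  have s: "s > 0" by (simp add: s_def)
  have "(h ^^ m) b = (h ^^ n) b \<longleftrightarrow> (h ^^ (m mod s)) b = (h ^^ (n mod s)) b"
    using period by (simp add: funpow_mod_eq)
  also have "\<dots> \<longleftrightarrow> m mod s = n mod s"
    using inj s by (auto simp: inj_on_def)
  finally show ?thesis by (simp add: card)
qed

text \<open>A canonical point of each orbit, so that the orbit partition becomes a colouring with
  colours below N.\<close>

definition orbit_label :: "(nat \<Rightarrow> nat) \<Rightarrow> nat \<Rightarrow> nat" where
  "orbit_label h p = Min (orbit h p)"

context
  fixes N :: nat and h :: "nat \<Rightarrow> nat"
  assumes h: "h permutes {..<N}"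
begin

lemma self_in_orbit: "p \<in> orbit h p"
  using permutes_permutation[OF h] by (rule permutation_self_in_orbit)

lemma orbit_eq: "q \<in> orbit h p \<Longrightarrow> orbit h q = orbit h p"
  by (rule orbit_cyclic_eq3[OF cyclic_on_orbit[OF h finite_lessThan]])

lemma orbit_label_in_orbit: "orbit_label h p \<in> orbit h p"
  unfolding orbit_label_def using finite_orbit[OF self_in_orbit] orbit_nonempty by (rule Min_in)

lemma orbit_label_eq_iff: "orbit_label h p = orbit_label h q \<longleftrightarrow> orbit h p = orbit h q"
proof
  assume "orbit_label h p = orbit_label h q"
  then show "orbit h p = orbit h q"
    using orbit_eq[OF orbit_label_in_orbit[of p]] orbit_eq[OF orbit_label_in_orbit[of q]] by simp
qed (simp add: orbit_label_def)

lemma orbit_label_step: "orbit_label h (h p) = orbit_label h p"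
  unfolding orbit_label_def using orbit_eq[OF orbit.base] by simp

lemma orbit_label_less: "p < N \<Longrightarrow> orbit_label h p < N"
  using permutes_orbit_subset[OF h, of p] orbit_label_in_orbit[of p] by auto

end

text \<open>Write p as the s-th iterate of h at the label of its orbit, and send it to the s-th
  iterate of h' at the same label. Iterates of h and h' collide in the same cases because the cycles
  have equal lengths, so the map is injective and intertwines h with h'.\<close>

lemma exists_conjugation:
  fixes N :: nat
  assumes h: "h permutes {..<N}" and h': "h' permutes {..<N}" and orb: "\<And>p. p < N \<Longrightarrow> orbit h p = orbit h' p"
  shows "\<exists>c. c permutes {..<N} \<and> c \<circ> h = h' \<circ> c"
proof -
  note perm = permutes_permutation[OF h] permutes_permutation[OF h']
  define steps where "steps p = funpow_dist h (orbit_label h p) p" for p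
  define c where "c p = (if p < N then (h' ^^ steps p) (orbit_label h p) else p)" for p
  have steps: "(h ^^ steps p) (orbit_label h p) = p" for p
  proof -
    have "p \<in> orbit h (orbit_label h p)"
      using orbit_eq[OF h orbit_label_in_orbit[OF h], of p] self_in_orbit[OF h, of p] by simp
    then show ?thesis unfolding steps_def by (rule funpow_dist_prop)
  qed
  have transfer: "(h ^^ m) b = (h ^^ n) b \<longleftrightarrow> (h' ^^ m) b = (h' ^^ n) b" if "b < N" for m n b
    unfolding funpow_eq_iff_mod[OF perm(1)] funpow_eq_iff_mod[OF perm(2)] orb[OF that] ..
  have hN: "h p < N \<longleftrightarrow> p < N" "h' p < N \<longleftrightarrow> p < N" for p
    using permutes_in_image[OF h, of p] permutes_in_image[OF h', of p] by simp_all
  have comm: "c (h p) = h' (c p)" for p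
  proof (cases "p < N")
    case True
    let ?b = "orbit_label h p"
    have b: "?b < N" using orbit_label_less[OF h True] .
    have "(h ^^ steps (h p)) ?b = (h ^^ Suc (steps p)) ?b"
      using steps[of "h p"] steps[of p] by (simp add: orbit_label_step[OF h])
    then have "(h' ^^ steps (h p)) ?b = (h' ^^ Suc (steps p)) ?b"
      using transfer[OF b, of "steps (h p)" "Suc (steps p)"] by simp
    then show ?thesis using True by (simp add: c_def hN orbit_label_step[OF h])
  next
    case False
    then have "h p = p" "h' p = p" using permutes_not_in[OF h, of p] permutes_not_in[OF h', of p] by simp_all
    then show ?thesis using False by (simp add: c_def)
  qed
  have c_orbit: "c p \<in> orbit h p" if "p < N" for p
  proof -
    have "orbit_label h p < N" using orbit_label_less[OF h that] .
    then have "c p \<in> orbit h (orbit_label h p)"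
      using funpow_in_orbit[OF self_in_orbit[OF h'], of "steps p" "orbit_label h p"] orb that
      by (simp add: c_def)
    then show ?thesis using orbit_eq[OF h orbit_label_in_orbit[OF h], of p] by simp
  qed
  have "inj_on c {..<N}"
  proof (rule inj_onI)
    fix p q assume pq: "p \<in> {..<N}" "q \<in> {..<N}" "c p = c q"
    then have "orbit h p = orbit h q"
      using orbit_eq[OF h c_orbit[of p]] orbit_eq[OF h c_orbit[of q]] by simp
    then have lab: "orbit_label h p = orbit_label h q" by (simp add: orbit_label_def)
    have "orbit_label h p < N" using orbit_label_less[OF h] pq(1) by simp
    moreover have "(h' ^^ steps p) (orbit_label h p) = (h' ^^ steps q) (orbit_label h p)"
      using pq lab by (simp add: c_def)
    ultimately have eq: "(h ^^ steps p) (orbit_label h p) = (h ^^ steps q) (orbit_label h p)"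
      using transfer[of "orbit_label h p" "steps p" "steps q"] by simp
    have "p = (h ^^ steps p) (orbit_label h p)" by (rule steps[symmetric])
    also note eq
    also have "(h ^^ steps q) (orbit_label h p) = q" using steps[of q] by (simp only: lab)
    finally show "p = q" .
  qed
  moreover have "c ` {..<N} \<subseteq> {..<N}"
  proof (rule image_subsetI)
    fix p assume p: "p \<in> {..<N}"
    then show "c p \<in> {..<N}" using c_orbit[of p] permutes_orbit_subset[OF h p] by blast
  qed
  ultimately have "bij_betw c {..<N} {..<N}"
    by (simp add: bij_betw_def endo_inj_surj)
  then have "c permutes {..<N}" by (rule bij_imp_permutes) (simp add: c_def)
  moreover have "c \<circ> h = h' \<circ> c" by (rule ext) (simp add: comm)
  ultimately show ?thesis by (intro exI[of _ c] conjI)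
qed

lemma square_roots_le_conjugate:
  assumes h: "h permutes {..<N}" and h': "h' permutes {..<N}"
    and c: "c permutes {..<N}" "c \<circ> h = h' \<circ> c"
  shows "square_roots N h \<le> square_roots N h'"
  unfolding square_roots_def
proof (rule card_inj_on_le[of "\<lambda>x. c \<circ> x \<circ> inv_into UNIV c"])
  let ?d = "inv_into UNIV c"
  have d: "?d (c p) = p" "c (?d p) = p" for p
    using permutes_inverses[OF c(1)] by auto
  have d_perm: "?d permutes {..<N}" using c(1) by (rule permutes_inv)
  have ch: "c (h p) = h' (c p)" for p using fun_cong[OF c(2), of p] by simp
  show "inj_on (\<lambda>x. c \<circ> x \<circ> ?d) {x. x permutes {..<N} \<and> x \<circ> x = h}"
    by (rule inj_on_inverseI[of _ "\<lambda>y. ?d \<circ> y \<circ> c"]) (simp add: fun_eq_iff d)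
  show "(\<lambda>x. c \<circ> x \<circ> ?d) ` {x. x permutes {..<N} \<and> x \<circ> x = h} \<subseteq> {x. x permutes {..<N} \<and> x \<circ> x = h'}"
  proof (rule image_subsetI)
    fix x assume x: "x \<in> {x. x permutes {..<N} \<and> x \<circ> x = h}"
    then have "x (x p) = h p" for p by auto
    then have "(c \<circ> x \<circ> ?d) \<circ> (c \<circ> x \<circ> ?d) = h'" by (simp add: fun_eq_iff d ch)
    moreover have "c \<circ> x \<circ> ?d permutes {..<N}"
      using x by (intro permutes_compose c(1) d_perm) simp
    ultimately show "c \<circ> x \<circ> ?d \<in> {x. x permutes {..<N} \<and> x \<circ> x = h'}" by simp
  qed
qed (simp add: finite_permutations)

lemma square_roots_same_orbits:
  assumes "h permutes {..<N}" "h' permutes {..<N}" "\<And>p. p < N \<Longrightarrow> orbit h p = orbit h' p"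
  shows "square_roots N h = square_roots N h'"
proof (rule antisym)
  show "square_roots N h \<le> square_roots N h'"
    using exists_conjugation[of h N h'] assms square_roots_le_conjugate by blast
  have "\<exists>c. c permutes {..<N} \<and> c \<circ> h' = h \<circ> c"
    using assms(3) by (intro exists_conjugation assms(1,2)) simp
  then show "square_roots N h' \<le> square_roots N h"
    using assms square_roots_le_conjugate by blast
qed

text \<open>Reduces the words counted by \<open>perm_series\<close> to the orbit partition, so
  permutations with the same orbits have the same series.\<close>

lemma word_invariant_iff:
  fixes N :: nat
  assumes "h permutes {..<N}"
  shows "(\<forall>p<N. w (h p) = w p) \<longleftrightarrow> (\<forall>p<N. \<forall>q\<in>orbit h p. w q = w p)"
proof
  assume w: "\<forall>p<N. w (h p) = w p"
  have "q < N \<and> w q = w p" if "q \<in> orbit h p" "p < N" for p q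
    using that(1)
  proof induction
    case base
    then show ?case using w that(2) permutes_in_image[OF assms, of p] by simp
  next
    case (step y)
    then show ?case using w permutes_in_image[OF assms, of y] by simp
  qed
  then show "\<forall>p<N. \<forall>q\<in>orbit h p. w q = w p" by blast
next
  assume "\<forall>p<N. \<forall>q\<in>orbit h p. w q = w p"
  then show "\<forall>p<N. w (h p) = w p" using orbit.base by metis
qed

lemma perm_series_same_orbits:
  assumes "h permutes {..<N}" "h' permutes {..<N}" "\<And>p. p < N \<Longrightarrow> orbit h p = orbit h' p"
  shows "perm_series N h = perm_series N h'"
  by (rule mser_eqI) (simp add: perm_series.rep_eq word_invariant_iff assms)

lemma colour_stabilizer_refines:
  assumes h: "h permutes {..<N}" and h': "h' \<in> colour_stabilizer {..<N} (orbit_label h)" and p: "p < N"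
  shows "orbit h' p \<subseteq> orbit h p"
proof
  have perm: "h' permutes {..<N}" and lab: "\<And>p. p < N \<Longrightarrow> orbit_label h (h' p) = orbit_label h p"
    using h' by (auto simp: colour_stabilizer_def)
  have orb: "orbit h (h' q) = orbit h q" if "q < N" for q
    using lab[OF that] orbit_label_eq_iff[OF h, of "h' q" q] by simp
  fix q assume "q \<in> orbit h' p"
  then have "q < N \<and> orbit h q = orbit h p"
  proof induction
    case base
    then show ?case using p orb permutes_in_image[OF perm, of p] by auto
  next
    case (step y)
    then show ?case using orb permutes_in_image[OF perm, of y] by auto
  qed
  then show "q \<in> orbit h p" using self_in_orbit[OF h, of q] by simp
qed

definition orbit_number :: "nat \<Rightarrow> (nat \<Rightarrow> nat) \<Rightarrow> nat" where
  "orbit_number N h = card (orbit_label h ` {..<N})"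

lemma orbit_number_le: "orbit_number N h \<le> N"
  unfolding orbit_number_def using card_image_le[of "{..<N}" "orbit_label h"] by simp

text \<open>The orbits of h' refine those of h, so the labels of h are a function of the labels of
  h'. If that function is injective on labels, the partitions agree; otherwise h' has strictly more
  orbits.\<close>

lemma orbit_number_refines:
  assumes h: "h permutes {..<N}" and h': "h' \<in> colour_stabilizer {..<N} (orbit_label h)"
  shows "orbit_number N h < orbit_number N h' \<or> (\<forall>p<N. orbit h' p = orbit h p)"
proof -
  have perm: "h' permutes {..<N}" using h' by (simp add: colour_stabilizer_def)
  have fac: "orbit_label h (orbit_label h' p) = orbit_label h p" if "p < N" for p
  proof -
    have "orbit_label h' p \<in> orbit h p"
      using colour_stabilizer_refines[OF h h' that] orbit_label_in_orbit[OF perm] by blast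
    then show ?thesis using orbit_eq[OF h] by (simp add: orbit_label_def)
  qed
  have img: "orbit_label h ` {..<N} = orbit_label h ` orbit_label h' ` {..<N}"
    unfolding image_image by (rule image_cong) (use fac in auto)
  have fin: "finite (orbit_label h' ` {..<N})" by simp
  show ?thesis
  proof (cases "inj_on (orbit_label h) (orbit_label h' ` {..<N})")
    case False
    then have "card (orbit_label h ` orbit_label h' ` {..<N}) < card (orbit_label h' ` {..<N})"
      using card_image_le[OF fin, of "orbit_label h"] inj_on_iff_eq_card[OF fin, of "orbit_label h"] by linarith
    then show ?thesis by (simp add: orbit_number_def img)
  next
    case True
    have "orbit h' p = orbit h p" if p: "p < N" for p
    proof
      show "orbit h' p \<subseteq> orbit h p" using colour_stabilizer_refines[OF h h' p] .
      show "orbit h p \<subseteq> orbit h' p"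
      proof
        fix q assume q: "q \<in> orbit h p"
        then have qN: "q < N" using permutes_orbit_subset[OF h, of p] p by auto
        have "orbit_label h q = orbit_label h p" using orbit_eq[OF h q] by (simp add: orbit_label_def)
        then have "orbit_label h (orbit_label h' q) = orbit_label h (orbit_label h' p)"
          using fac p qN by simp
        then have "orbit_label h' q = orbit_label h' p"
          using True p qN by (auto dest: inj_onD)
        then have "orbit h' q = orbit h' p" using orbit_label_eq_iff[OF perm, of q p] by simp
        then show "q \<in> orbit h' p" using self_in_orbit[OF perm, of q] by simp
      qed
    qed
    then show ?thesis by blast
  qed
qed

text \<open>
  Summing over the stabilizer of the orbit partition of \<open>h\<close> gives a product of complete functions;
  the permutations in the sum either have the same orbits as \<open>h\<close> or strictly more.
\<close>

theorem schur_expansion_perm_series: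
  assumes "h permutes {..<N}"
  shows "schur_expansion N (perm_series N h) (of_nat (square_roots N h))"
  using assms
proof (induction "N - orbit_number N h" arbitrary: h rule: less_induct)
  case less
  note h = less.prems
  let ?u = "orbit_label h"
  define B where "B = colour_stabilizer {..<N} ?u"
  define \<alpha> where "\<alpha> a = card {p \<in> {..<N}. ?u p = a}" for a
  \<comment> \<open>The part of the stabilizer on which both quantities agree with their values at
    h. It contains h, so its cardinality can be divided out after the rest has been removed by
    induction.\<close>
  define S where "S = {h' \<in> B. \<forall>p<N. orbit h' p = orbit h p}"
  have fin: "finite B" unfolding B_def by (rule finite_colour_stabilizer) simp
  have u: "?u p < N" if "p < N" for p using orbit_label_less[OF h that] .
  have "h \<in> S" using h orbit_label_step[OF h] by (simp add: S_def B_def colour_stabilizer_def)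
  then have S: "S \<subseteq> B" "card S > 0" using fin by (auto simp: S_def card_gt_0_iff)
  have zero: "\<alpha> a = 0" if "a \<ge> N" for a
    using u that by (fastforce simp: \<alpha>_def)
  have total: "(\<Sum>a<N. \<alpha> a) = N"
  proof -
    have "(\<Sum>a<N. card {p \<in> {..<N}. ?u p = a}) = card (\<Union>a<N. {p \<in> {..<N}. ?u p = a})"
      by (rule card_UN_disjoint[symmetric]) auto
    also have "(\<Union>a<N. {p \<in> {..<N}. ?u p = a}) = {..<N}" using u by auto
    finally show ?thesis by (simp add: \<alpha>_def)
  qed
  have sumP: "(\<Sum>h'\<in>B. perm_series N h') = mscale (of_nat (card B)) (complete_series N \<alpha>)"
  proof (rule mser_eqI)
    fix X
    show "mcoeff (\<Sum>h'\<in>B. perm_series N h') X = mcoeff (mscale (of_nat (card B)) (complete_series N \<alpha>)) X"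
      using sum_perm_series_coset[of id N ?u N X] u
      by (simp add: colour_coset_id B_def complete_series.rep_eq \<alpha>_def[abs_def])
  qed
  have sumR: "(\<Sum>h'\<in>B. square_roots N h') = card B * card (symmetric_tables \<alpha> id)"
    using sum_square_roots_coset[of id N ?u N] u
    by (simp add: colour_coset_id B_def \<alpha>_def[abs_def])
  have all: "schur_expansion N (\<Sum>h'\<in>B. perm_series N h') (\<Sum>h'\<in>B. of_nat (square_roots N h'))"
  proof -
    have "schur_expansion N (mscale (of_nat (card B)) (complete_series N \<alpha>))
        (of_nat (card B) * of_nat (card (symmetric_tables \<alpha> id)))"
      by (intro schur_expansion_scale schur_expansion_complete_series zero total)
    then show ?thesis by (simp only: sumP sumR flip: of_nat_mult of_nat_sum)
  qed
  have rest: "schur_expansion N (\<Sum>h'\<in>B - S. perm_series N h') (\<Sum>h'\<in>B - S. of_nat (square_roots N h'))"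
  proof (rule schur_expansion_sum)
    fix h' assume h': "h' \<in> B - S"
    then have "orbit_number N h < orbit_number N h'"
      using orbit_number_refines[OF h, of h'] by (auto simp: S_def B_def)
    then have "N - orbit_number N h' < N - orbit_number N h"
      using orbit_number_le[of N h'] by linarith
    moreover have "h' permutes {..<N}" using h' by (simp add: B_def colour_stabilizer_def)
    ultimately show "schur_expansion N (perm_series N h') (of_nat (square_roots N h'))"
      by (rule less.hyps)
  qed
  have same: "perm_series N h' = perm_series N h" "square_roots N h' = square_roots N h" if "h' \<in> S" for h'
    using that h by (auto simp: S_def B_def colour_stabilizer_def
        intro!: perm_series_same_orbits square_roots_same_orbits)
  have "(\<Sum>h'\<in>B. perm_series N h') - (\<Sum>h'\<in>B - S. perm_series N h') = (\<Sum>h'\<in>S. perm_series N h')"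
    using sum.subset_diff[OF S(1) fin, of "perm_series N"] by simp
  also have "\<dots> = mscale (of_nat (card S)) (perm_series N h)"
    by (rule mser_eqI, unfold mcoeff_sum) (simp add: same)
  finally have P: "(\<Sum>h'\<in>B. perm_series N h') - (\<Sum>h'\<in>B - S. perm_series N h') =
    mscale (of_nat (card S)) (perm_series N h)" .
  have "(\<Sum>h'\<in>B. rat_of_nat (square_roots N h')) - (\<Sum>h'\<in>B - S. of_nat (square_roots N h')) =
      (\<Sum>h'\<in>S. of_nat (square_roots N h'))"
    using sum.subset_diff[OF S(1) fin, of "\<lambda>h'. rat_of_nat (square_roots N h')"] by simp
  also have "\<dots> = of_nat (card S) * of_nat (square_roots N h)" by (simp add: same)
  finally have R: "(\<Sum>h'\<in>B. rat_of_nat (square_roots N h')) - (\<Sum>h'\<in>B - S. of_nat (square_roots N h')) =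
    of_nat (card S) * of_nat (square_roots N h)" .
  have "schur_expansion N (mscale (of_nat (card S)) (perm_series N h)) (of_nat (card S) * of_nat (square_roots N h))"
    using schur_expansion_diff[OF all rest] by (simp only: P R)
  then have "schur_expansion N (mscale (1 / of_nat (card S)) (mscale (of_nat (card S)) (perm_series N h)))
      (1 / of_nat (card S) * (of_nat (card S) * of_nat (square_roots N h)))"
    by (rule schur_expansion_scale)
  then show ?case using S(2) by simp
qed


section \<open>Counting permutation equivalence classes\<close>

definition permute_mat :: "nat \<Rightarrow> (nat \<Rightarrow> nat) \<Rightarrow> (nat \<Rightarrow> nat) \<Rightarrow> nat mat \<Rightarrow> nat mat" where
  "permute_mat n \<alpha> \<beta> A = mat n n (\<lambda>(i, j). A $$ (\<alpha> i, \<beta> j))"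

lemma perm_equiv_iff: "perm_equiv n A B \<longleftrightarrow> (\<exists>\<alpha>\<in>sym_group n. \<exists>\<beta>\<in>sym_group n. B = permute_mat n \<alpha> \<beta> A)"
  by (simp add: perm_equiv_def permute_mat_def)

lemma sym_group_less: "\<sigma> \<in> sym_group n \<Longrightarrow> i < n \<Longrightarrow> \<sigma> i < n"
  using permutes_in_image[of \<sigma> "{..<n}" i] by (simp add: sym_group_def)

lemma sym_group_comp: "\<sigma> \<in> sym_group n \<Longrightarrow> \<tau> \<in> sym_group n \<Longrightarrow> \<sigma> \<circ> \<tau> \<in> sym_group n"
  by (simp add: sym_group_def permutes_compose)

lemma sym_group_inv: "\<sigma> \<in> sym_group n \<Longrightarrow> inv_into UNIV \<sigma> \<in> sym_group n"
  by (simp add: sym_group_def permutes_inv)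

lemma sym_group_id: "id \<in> sym_group n"
  by (simp add: sym_group_def permutes_id)

lemma sym_group_inv_simps:
  assumes "\<sigma> \<in> sym_group n"
  shows "\<sigma> (inv_into UNIV \<sigma> x) = x" "inv_into UNIV \<sigma> (\<sigma> x) = x"
  using permutes_inverses[of \<sigma> "{..<n}"] assms by (auto simp: sym_group_def)

lemma finite_sym_group [simp]: "finite (sym_group n)"
  by (simp add: sym_group_def finite_permutations)

lemma card_sym_group: "card (sym_group n) = fact n"
  by (simp add: sym_group_def card_permutations)

lemma M_mats_carrier: "A \<in> M_mats n m \<Longrightarrow> A \<in> carrier_mat n n"
  by (simp add: M_mats_def)

lemma permute_mat_carrier [simp]: "permute_mat n \<alpha> \<beta> A \<in> carrier_mat n n"
  by (simp add: permute_mat_def)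

lemma permute_mat_index [simp]: "i < n \<Longrightarrow> j < n \<Longrightarrow> permute_mat n \<alpha> \<beta> A $$ (i, j) = A $$ (\<alpha> i, \<beta> j)"
  by (simp add: permute_mat_def)

lemma mat_eq_iff:
  assumes "A \<in> carrier_mat n n" "B \<in> carrier_mat n n"
  shows "A = B \<longleftrightarrow> (\<forall>i<n. \<forall>j<n. A $$ (i, j) = B $$ (i, j))"
  using assms by (auto intro!: eq_matI)

lemma permute_mat_M_mats:
  assumes A: "A \<in> M_mats n m" and \<alpha>: "\<alpha> \<in> sym_group n" and \<beta>: "\<beta> \<in> sym_group n"
  shows "permute_mat n \<alpha> \<beta> A \<in> M_mats n m"
proof -
  have p: "\<alpha> permutes {..<n}" "\<beta> permutes {..<n}" using \<alpha> \<beta> by (auto simp: sym_group_def)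
  have "(\<Sum>j<n. A $$ (\<alpha> i, \<beta> j)) = m" if "i < n" for i
  proof -
    have "(\<Sum>j<n. A $$ (\<alpha> i, \<beta> j)) = (\<Sum>j<n. A $$ (\<alpha> i, j))"
      using sum.permute[OF p(2), of "\<lambda>j. A $$ (\<alpha> i, j)"] by (simp add: o_def)
    then show ?thesis using A sym_group_less[OF \<alpha> that] by (simp add: M_mats_def)
  qed
  moreover have "(\<Sum>i<n. A $$ (\<alpha> i, \<beta> j)) = m" if "j < n" for j
  proof -
    have "(\<Sum>i<n. A $$ (\<alpha> i, \<beta> j)) = (\<Sum>i<n. A $$ (i, \<beta> j))"
      using sum.permute[OF p(1), of "\<lambda>i. A $$ (i, \<beta> j)"] by (simp add: o_def)
    then show ?thesis using A sym_group_less[OF \<beta> that] by (simp add: M_mats_def)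
  qed
  ultimately show ?thesis by (simp add: M_mats_def)
qed

lemma permute_mat_compose:
  assumes "\<alpha> \<in> sym_group n" "\<beta> \<in> sym_group n"
  shows "permute_mat n \<alpha> \<beta> (permute_mat n \<gamma> \<delta> A) = permute_mat n (\<gamma> \<circ> \<alpha>) (\<delta> \<circ> \<beta>) A"
  by (subst mat_eq_iff[of _ n]) (simp_all add: sym_group_less assms)

lemma permute_mat_id: "A \<in> carrier_mat n n \<Longrightarrow> permute_mat n id id A = A"
  by (subst mat_eq_iff[of _ n]) simp_all

lemma finite_M_mats [simp]: "finite (M_mats n m)"
proof (rule finite_subset)
  show "M_mats n m \<subseteq> (\<lambda>f. mat n n (\<lambda>(i, j). f (i, j))) ` ({..<n} \<times> {..<n} \<rightarrow>\<^sub>E {..m})"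
  proof
    fix A assume A: "A \<in> M_mats n m"
    have le: "A $$ (i, j) \<le> m" if "i < n" "j < n" for i j
    proof -
      have "A $$ (i, j) \<le> (\<Sum>j<n. A $$ (i, j))" using that by (intro member_le_sum) auto
      then show ?thesis using A that by (simp add: M_mats_def)
    qed
    define f where "f = (\<lambda>p\<in>{..<n} \<times> {..<n}. A $$ p)"
    have "f \<in> {..<n} \<times> {..<n} \<rightarrow>\<^sub>E {..m}" using le by (auto simp: f_def)
    moreover have "A = mat n n (\<lambda>(i, j). f (i, j))"
      using M_mats_carrier[OF A] by (subst mat_eq_iff[of _ n]) (auto simp: f_def)
    ultimately show "A \<in> (\<lambda>f. mat n n (\<lambda>(i, j). f (i, j))) ` ({..<n} \<times> {..<n} \<rightarrow>\<^sub>E {..m})" by blast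
  qed
qed (intro finite_imageI finite_PiE finite_cartesian_product; simp)

lemma perm_equiv_refl: "A \<in> carrier_mat n n \<Longrightarrow> perm_equiv n A A"
  unfolding perm_equiv_iff using sym_group_id permute_mat_id by metis

lemma perm_equiv_sym:
  assumes "A \<in> carrier_mat n n" "perm_equiv n A B"
  shows "perm_equiv n B A"
proof -
  obtain \<alpha> \<beta> where *: "\<alpha> \<in> sym_group n" "\<beta> \<in> sym_group n" "B = permute_mat n \<alpha> \<beta> A"
    using assms(2) unfolding perm_equiv_iff by blast
  have id: "\<alpha> \<circ> inv_into UNIV \<alpha> = id" "\<beta> \<circ> inv_into UNIV \<beta> = id"
    using sym_group_inv_simps(1)[OF *(1)] sym_group_inv_simps(1)[OF *(2)] by (simp_all add: fun_eq_iff)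
  have "permute_mat n (inv_into UNIV \<alpha>) (inv_into UNIV \<beta>) B =
      permute_mat n (\<alpha> \<circ> inv_into UNIV \<alpha>) (\<beta> \<circ> inv_into UNIV \<beta>) A"
    unfolding *(3) by (intro permute_mat_compose sym_group_inv *)
  also have "\<dots> = A" using permute_mat_id[OF assms(1)] by (simp add: id)
  finally have "permute_mat n (inv_into UNIV \<alpha>) (inv_into UNIV \<beta>) B = A" .
  then show ?thesis unfolding perm_equiv_iff using sym_group_inv *(1,2) by metis
qed

lemma perm_equiv_trans:
  assumes "perm_equiv n A B" "perm_equiv n B C"
  shows "perm_equiv n A C"
proof -
  obtain \<alpha> \<beta> \<gamma> \<delta> where *: "\<alpha> \<in> sym_group n" "\<beta> \<in> sym_group n" "B = permute_mat n \<alpha> \<beta> A"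
    "\<gamma> \<in> sym_group n" "\<delta> \<in> sym_group n" "C = permute_mat n \<gamma> \<delta> B"
    using assms unfolding perm_equiv_iff by blast
  then have "C = permute_mat n (\<alpha> \<circ> \<gamma>) (\<beta> \<circ> \<delta>) A" by (simp add: permute_mat_compose)
  then show ?thesis unfolding perm_equiv_iff using sym_group_comp * by blast
qed

lemma equiv_perm_equiv_rel: "equiv (M_mats n m) (perm_equiv_rel n m)"
proof (rule equivI)
  show "perm_equiv_rel n m \<subseteq> M_mats n m \<times> M_mats n m" by (auto simp: perm_equiv_rel_def)
  show "refl_on (M_mats n m) (perm_equiv_rel n m)"
    by (auto simp: refl_on_def perm_equiv_rel_def intro: perm_equiv_refl M_mats_carrier)
  show "sym (perm_equiv_rel n m)"
    by (auto simp: sym_def perm_equiv_rel_def intro: perm_equiv_sym M_mats_carrier)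
  show "trans (perm_equiv_rel n m)"
    unfolding trans_def perm_equiv_rel_def using perm_equiv_trans by blast
qed

text \<open>Row \<sigma> i of the product is row i of the transpose, and the indices \<sigma> i run
  through all rows.\<close>

lemma perm_mat_times_transpose_iff:
  assumes \<sigma>: "\<sigma> \<in> sym_group n" and A: "A \<in> carrier_mat n n"
  shows "perm_mat n \<sigma> * transpose_mat A = A \<longleftrightarrow> (\<forall>i<n. \<forall>j<n. A $$ (\<sigma> i, j) = A $$ (j, i))"
proof -
  have idx: "(perm_mat n \<sigma> * transpose_mat A) $$ (\<sigma> i, j) = A $$ (j, i)" if "i < n" "j < n" for i j
  proof -
    have inj: "\<sigma> i = \<sigma> k \<longleftrightarrow> i = k" for k using sym_group_inv_simps(2)[OF \<sigma>] by metis
    have "(perm_mat n \<sigma> * transpose_mat A) $$ (\<sigma> i, j) = (\<Sum>k<n. (if \<sigma> i = \<sigma> k then 1 else 0) * A $$ (j, k))"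
      using that A sym_group_less[OF \<sigma>]
      by (simp add: perm_mat_def scalar_prod_def lessThan_atLeast0)
    also have "\<dots> = (\<Sum>k<n. if k = i then A $$ (j, k) else 0)"
      by (intro sum.cong) (auto simp: inj)
    finally show ?thesis using that by simp
  qed
  have "perm_mat n \<sigma> * transpose_mat A = A \<longleftrightarrow>
      (\<forall>i<n. \<forall>j<n. (perm_mat n \<sigma> * transpose_mat A) $$ (i, j) = A $$ (i, j))"
    using A by (intro mat_eq_iff) (auto simp: perm_mat_def)
  also have "\<dots> \<longleftrightarrow> (\<forall>i<n. \<forall>j<n. (perm_mat n \<sigma> * transpose_mat A) $$ (\<sigma> i, j) = A $$ (\<sigma> i, j))"
    (is "?L \<longleftrightarrow> ?R")
  proof
    show "?L \<Longrightarrow> ?R" using sym_group_less[OF \<sigma>] by blast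
    show "?R \<Longrightarrow> ?L"
    proof (intro allI impI)
      fix i j assume R: ?R and ij: "i < n" "j < n"
      have "inv_into UNIV \<sigma> i < n" using sym_group_less[OF sym_group_inv[OF \<sigma>] ij(1)] .
      then show "(perm_mat n \<sigma> * transpose_mat A) $$ (i, j) = A $$ (i, j)"
        using R ij(2) sym_group_inv_simps(1)[OF \<sigma>, of i] by metis
    qed
  qed
  also have "\<dots> \<longleftrightarrow> (\<forall>i<n. \<forall>j<n. A $$ (\<sigma> i, j) = A $$ (j, i))"
    using idx by metis
  finally show ?thesis .
qed

text \<open>The solutions of \<sigma>A^T = A in entrywise form. The set S restricts A, so that the
  solutions can be sorted by equivalence class.\<close>

definition transpose_pairs :: "nat \<Rightarrow> nat mat set \<Rightarrow> ((nat \<Rightarrow> nat) \<times> nat mat) set" where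
  "transpose_pairs n S = {(\<sigma>, A). \<sigma> \<in> sym_group n \<and> A \<in> S \<and> (\<forall>i<n. \<forall>j<n. A $$ (\<sigma> i, j) = A $$ (j, i))}"

lemma transpose_pairs_T_mats:
  assumes "(\<sigma>, A) \<in> transpose_pairs n (M_mats n m)"
  shows "A \<in> T_mats n m"
proof -
  have A: "A \<in> M_mats n m" and \<sigma>: "\<sigma> \<in> sym_group n" and *: "\<And>i j. i < n \<Longrightarrow> j < n \<Longrightarrow> A $$ (\<sigma> i, j) = A $$ (j, i)"
    using assms by (auto simp: transpose_pairs_def)
  have "transpose_mat A = permute_mat n \<sigma> id A"
    using M_mats_carrier[OF A] * by (subst mat_eq_iff[of _ n]) auto
  then have "perm_equiv n A (transpose_mat A)" unfolding perm_equiv_iff using \<sigma> sym_group_id by blast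
  then show ?thesis using A by (simp add: T_mats_def)
qed

text \<open>
  With \<open>A = \<alpha>\<sqdot>A\<^sub>0\<sqdot>\<beta>\<close> and \<open>A\<^sub>0\<^sup>T = \<gamma>\<sqdot>A\<^sub>0\<sqdot>\<delta>\<close>, the condition \<open>\<sigma>A\<^sup>T = A\<close> says that the pair
  \<open>(\<gamma>\<beta>\<sigma>\<^sup>-\<^sup>1\<alpha>\<^sup>-\<^sup>1, \<delta>\<alpha>\<beta>\<^sup>-\<^sup>1)\<close> stabilizes \<open>A\<^sub>0\<close>, so the triples \<open>(\<alpha>, \<beta>, \<sigma>)\<close> are parametrized
  by \<open>\<alpha>\<close> and an element of the stabilizer.
\<close>

lemma card_transpose_pairs_class:
  assumes A0: "A0 \<in> T_mats n m"
  shows "card (transpose_pairs n (perm_equiv_rel n m `` {A0})) = fact n"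
proof -
  let ?G = "sym_group n"
  let ?C = "perm_equiv_rel n m `` {A0}"
  let ?i = "inv_into UNIV :: (nat \<Rightarrow> nat) \<Rightarrow> nat \<Rightarrow> nat"
  have M: "A0 \<in> M_mats n m" using A0 by (simp add: T_mats_def)
  note car = M_mats_carrier[OF M]
  obtain \<gamma> \<delta> where \<gamma>: "\<gamma> \<in> ?G" and \<delta>: "\<delta> \<in> ?G" and tr: "transpose_mat A0 = permute_mat n \<gamma> \<delta> A0"
    using A0 unfolding T_mats_def perm_equiv_iff by blast
  have tr': "A0 $$ (j, i) = A0 $$ (\<gamma> i, \<delta> j)" if "i < n" "j < n" for i j
  proof -
    have "A0 $$ (j, i) = transpose_mat A0 $$ (i, j)" using car that by simp
    then show ?thesis using that by (simp add: tr)
  qed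
  \<comment> \<open>The stabilizer of \<open>A0\<close> under independent row and column
    permutations.\<close>
  define Stab where "Stab = {(s, t). s \<in> ?G \<and> t \<in> ?G \<and> (\<forall>x<n. \<forall>y<n. A0 $$ (s x, t y) = A0 $$ (x, y))}"
  have "Stab \<subseteq> ?G \<times> ?G" by (auto simp: Stab_def)
  then have finS: "finite Stab" by (rule finite_subset) simp
  have "(id, id) \<in> Stab" by (simp add: Stab_def sym_group_id)
  then have posS: "card Stab > 0" using finS by (auto simp: card_gt_0_iff)
  \<comment> \<open>The condition of \<open>transpose_pairs\<close> for the matrix
    \<open>permute_mat n \<alpha> \<beta> A0\<close>, before matrices arising from several pairs
    (\<alpha>, \<beta>) are identified.\<close>
  define Tr where "Tr = {(\<alpha>, \<beta>, \<sigma>). \<alpha> \<in> ?G \<and> \<beta> \<in> ?G \<and> \<sigma> \<in> ?G \<and>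
    (\<forall>i<n. \<forall>j<n. A0 $$ (\<alpha> (\<sigma> i), \<beta> j) = A0 $$ (\<alpha> j, \<beta> i))}"
  have "Tr \<subseteq> ?G \<times> ?G \<times> ?G" by (auto simp: Tr_def)
  then have finT: "finite Tr" by (rule finite_subset) simp
  note less = sym_group_less and inv = sym_group_inv_simps
  have "bij_betw (\<lambda>(\<alpha>, \<beta>, \<sigma>). (\<alpha>, \<gamma> \<circ> \<beta> \<circ> ?i \<sigma> \<circ> ?i \<alpha>, \<delta> \<circ> \<alpha> \<circ> ?i \<beta>)) Tr (?G \<times> Stab)"
  proof (rule bij_betw_byWitness[where f' = "\<lambda>(\<alpha>, s, t). (\<alpha>, ?i t \<circ> \<delta> \<circ> \<alpha>,
      ?i \<alpha> \<circ> ?i s \<circ> \<gamma> \<circ> (?i t \<circ> \<delta> \<circ> \<alpha>))"])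
    show "(\<lambda>(\<alpha>, \<beta>, \<sigma>). (\<alpha>, \<gamma> \<circ> \<beta> \<circ> ?i \<sigma> \<circ> ?i \<alpha>, \<delta> \<circ> \<alpha> \<circ> ?i \<beta>)) ` Tr \<subseteq> ?G \<times> Stab"
    proof (rule image_subsetI)
      fix z assume "z \<in> Tr"
      then obtain \<alpha> \<beta> \<sigma> where z: "z = (\<alpha>, \<beta>, \<sigma>)" and G: "\<alpha> \<in> ?G" "\<beta> \<in> ?G" "\<sigma> \<in> ?G"
        and eq: "\<And>i j. i < n \<Longrightarrow> j < n \<Longrightarrow> A0 $$ (\<alpha> (\<sigma> i), \<beta> j) = A0 $$ (\<alpha> j, \<beta> i)"
        by (auto simp: Tr_def)
      have "A0 $$ (\<gamma> (\<beta> (?i \<sigma> (?i \<alpha> x))), \<delta> (\<alpha> (?i \<beta> y))) = A0 $$ (x, y)" if "x < n" "y < n" for x y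
      proof -
        have lt: "?i \<sigma> (?i \<alpha> x) < n" "?i \<beta> y < n" using that G by (simp_all add: less sym_group_inv)
        have "A0 $$ (x, y) = A0 $$ (\<alpha> (\<sigma> (?i \<sigma> (?i \<alpha> x))), \<beta> (?i \<beta> y))"
          by (simp add: inv[OF G(1)] inv[OF G(2)] inv[OF G(3)])
        also have "\<dots> = A0 $$ (\<alpha> (?i \<beta> y), \<beta> (?i \<sigma> (?i \<alpha> x)))" by (rule eq[OF lt])
        also have "\<dots> = A0 $$ (\<gamma> (\<beta> (?i \<sigma> (?i \<alpha> x))), \<delta> (\<alpha> (?i \<beta> y)))"
          by (rule tr') (use lt G in \<open>simp_all add: less\<close>)
        finally show ?thesis ..
      qed
      then show "(case z of (\<alpha>, \<beta>, \<sigma>) \<Rightarrow> (\<alpha>, \<gamma> \<circ> \<beta> \<circ> ?i \<sigma> \<circ> ?i \<alpha>, \<delta> \<circ> \<alpha> \<circ> ?i \<beta>)) \<in> ?G \<times> Stab"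
        using G \<gamma> \<delta> by (simp add: z Stab_def sym_group_comp sym_group_inv)
    qed
    show "(\<lambda>(\<alpha>, s, t). (\<alpha>, ?i t \<circ> \<delta> \<circ> \<alpha>, ?i \<alpha> \<circ> ?i s \<circ> \<gamma> \<circ> (?i t \<circ> \<delta> \<circ> \<alpha>))) ` (?G \<times> Stab) \<subseteq> Tr"
    proof (rule image_subsetI)
      fix z assume "z \<in> ?G \<times> Stab"
      then obtain \<alpha> s t where z: "z = (\<alpha>, s, t)" and G: "\<alpha> \<in> ?G" "s \<in> ?G" "t \<in> ?G"
        and eq: "\<And>x y. x < n \<Longrightarrow> y < n \<Longrightarrow> A0 $$ (s x, t y) = A0 $$ (x, y)"
        by (auto simp: Stab_def)
      define \<beta> where "\<beta> = ?i t \<circ> \<delta> \<circ> \<alpha>"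
      define \<sigma> where "\<sigma> = ?i \<alpha> \<circ> ?i s \<circ> \<gamma> \<circ> \<beta>"
      have \<beta>: "\<beta> \<in> ?G" and \<sigma>: "\<sigma> \<in> ?G"
        using G \<gamma> \<delta> by (simp_all add: \<beta>_def \<sigma>_def sym_group_comp sym_group_inv)
      have "A0 $$ (\<alpha> (\<sigma> i), \<beta> j) = A0 $$ (\<alpha> j, \<beta> i)" if "i < n" "j < n" for i j
      proof -
        have "A0 $$ (\<alpha> (\<sigma> i), \<beta> j) = A0 $$ (s (\<alpha> (\<sigma> i)), t (\<beta> j))"
          by (rule eq[symmetric]) (use that G \<beta> \<sigma> in \<open>simp_all add: less\<close>)
        also have "s (\<alpha> (\<sigma> i)) = \<gamma> (\<beta> i)" by (simp add: \<sigma>_def inv[OF G(1)] inv[OF G(2)])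
        also have "t (\<beta> j) = \<delta> (\<alpha> j)" by (simp add: \<beta>_def inv[OF G(3)])
        also have "A0 $$ (\<gamma> (\<beta> i), \<delta> (\<alpha> j)) = A0 $$ (\<alpha> j, \<beta> i)"
          by (rule tr'[symmetric]) (use that G \<beta> in \<open>simp_all add: less\<close>)
        finally show ?thesis .
      qed
      then show "(case z of (\<alpha>, s, t) \<Rightarrow> (\<alpha>, ?i t \<circ> \<delta> \<circ> \<alpha>, ?i \<alpha> \<circ> ?i s \<circ> \<gamma> \<circ> (?i t \<circ> \<delta> \<circ> \<alpha>))) \<in> Tr"
        using G \<beta> \<sigma> by (simp add: z Tr_def flip: \<beta>_def) (simp add: \<sigma>_def o_def)
    qed
    show "\<forall>z\<in>Tr. (\<lambda>(\<alpha>, s, t). (\<alpha>, ?i t \<circ> \<delta> \<circ> \<alpha>, ?i \<alpha> \<circ> ?i s \<circ> \<gamma> \<circ> (?i t \<circ> \<delta> \<circ> \<alpha>)))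
        ((\<lambda>(\<alpha>, \<beta>, \<sigma>). (\<alpha>, \<gamma> \<circ> \<beta> \<circ> ?i \<sigma> \<circ> ?i \<alpha>, \<delta> \<circ> \<alpha> \<circ> ?i \<beta>)) z) = z"
    proof
      fix z assume "z \<in> Tr"
      then obtain \<alpha> \<beta> \<sigma> where z: "z = (\<alpha>, \<beta>, \<sigma>)" and G: "\<alpha> \<in> ?G" "\<beta> \<in> ?G" "\<sigma> \<in> ?G"
        by (auto simp: Tr_def)
      define s where "s = \<gamma> \<circ> \<beta> \<circ> ?i \<sigma> \<circ> ?i \<alpha>"
      define t where "t = \<delta> \<circ> \<alpha> \<circ> ?i \<beta>"
      have st: "s \<in> ?G" "t \<in> ?G"
        using G \<gamma> \<delta> by (simp_all add: s_def t_def sym_group_comp sym_group_inv)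
      have "?i t (\<delta> (\<alpha> x)) = \<beta> x" for x
      proof -
        have "t (\<beta> x) = \<delta> (\<alpha> x)" by (simp add: t_def inv[OF G(2)])
        then show ?thesis using inv(2)[OF st(2), of "\<beta> x"] by simp
      qed
      moreover have "?i \<alpha> (?i s (\<gamma> (\<beta> x))) = \<sigma> x" for x
      proof -
        have "s (\<alpha> (\<sigma> x)) = \<gamma> (\<beta> x)" by (simp add: s_def inv[OF G(1)] inv[OF G(3)])
        then have "?i s (\<gamma> (\<beta> x)) = \<alpha> (\<sigma> x)" using inv(2)[OF st(1), of "\<alpha> (\<sigma> x)"] by simp
        then show ?thesis by (simp add: inv[OF G(1)])
      qed
      ultimately show "(\<lambda>(\<alpha>, s, t). (\<alpha>, ?i t \<circ> \<delta> \<circ> \<alpha>, ?i \<alpha> \<circ> ?i s \<circ> \<gamma> \<circ> (?i t \<circ> \<delta> \<circ> \<alpha>)))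
          ((\<lambda>(\<alpha>, \<beta>, \<sigma>). (\<alpha>, \<gamma> \<circ> \<beta> \<circ> ?i \<sigma> \<circ> ?i \<alpha>, \<delta> \<circ> \<alpha> \<circ> ?i \<beta>)) z) = z"
        by (simp add: z fun_eq_iff flip: s_def t_def)
    qed
    show "\<forall>z\<in>?G \<times> Stab. (\<lambda>(\<alpha>, \<beta>, \<sigma>). (\<alpha>, \<gamma> \<circ> \<beta> \<circ> ?i \<sigma> \<circ> ?i \<alpha>, \<delta> \<circ> \<alpha> \<circ> ?i \<beta>))
        ((\<lambda>(\<alpha>, s, t). (\<alpha>, ?i t \<circ> \<delta> \<circ> \<alpha>, ?i \<alpha> \<circ> ?i s \<circ> \<gamma> \<circ> (?i t \<circ> \<delta> \<circ> \<alpha>))) z) = z"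
    proof
      fix z assume "z \<in> ?G \<times> Stab"
      then obtain \<alpha> s t where z: "z = (\<alpha>, s, t)" and G: "\<alpha> \<in> ?G" "s \<in> ?G" "t \<in> ?G"
        by (auto simp: Stab_def)
      define \<beta> where "\<beta> = ?i t \<circ> \<delta> \<circ> \<alpha>"
      define \<sigma> where "\<sigma> = ?i \<alpha> \<circ> ?i s \<circ> \<gamma> \<circ> \<beta>"
      have \<beta>: "\<beta> \<in> ?G" and \<sigma>: "\<sigma> \<in> ?G"
        using G \<gamma> \<delta> by (simp_all add: \<beta>_def \<sigma>_def sym_group_comp sym_group_inv)
      have "\<delta> (\<alpha> (?i \<beta> x)) = t x" for x
      proof -
        have "t (\<beta> (?i \<beta> x)) = \<delta> (\<alpha> (?i \<beta> x))" by (simp add: \<beta>_def inv[OF G(3)])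
        then show ?thesis by (simp add: inv[OF \<beta>])
      qed
      moreover have "\<gamma> (\<beta> (?i \<sigma> (?i \<alpha> x))) = s x" for x
      proof -
        have "s (\<alpha> (\<sigma> (?i \<sigma> (?i \<alpha> x)))) = \<gamma> (\<beta> (?i \<sigma> (?i \<alpha> x)))"
          by (simp add: \<sigma>_def inv[OF G(1)] inv[OF G(2)])
        then show ?thesis by (simp add: inv[OF \<sigma>] inv[OF G(1)])
      qed
      ultimately show "(\<lambda>(\<alpha>, \<beta>, \<sigma>). (\<alpha>, \<gamma> \<circ> \<beta> \<circ> ?i \<sigma> \<circ> ?i \<alpha>, \<delta> \<circ> \<alpha> \<circ> ?i \<beta>))
          ((\<lambda>(\<alpha>, s, t). (\<alpha>, ?i t \<circ> \<delta> \<circ> \<alpha>, ?i \<alpha> \<circ> ?i s \<circ> \<gamma> \<circ> (?i t \<circ> \<delta> \<circ> \<alpha>))) z) = z"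
        by (simp add: z fun_eq_iff flip: \<beta>_def \<sigma>_def)
    qed
  qed
  then have "card Tr = card (?G \<times> Stab)" by (rule bij_betw_same_card)
  then have Tr1: "card Tr = fact n * card Stab" by (simp add: card_cartesian_product card_sym_group)
  \<comment> \<open>A second count of the triples. Two pairs (\<alpha>, \<beta>) give the same
    matrix exactly when they differ by an element of \<open>Stab\<close>, so every fibre has
    \<open>card Stab\<close> elements, and this factor cancels against the first count.\<close>
  let ?p = "\<lambda>(\<alpha>, \<beta>, \<sigma>). (\<sigma> :: nat \<Rightarrow> nat, permute_mat n \<alpha> \<beta> A0)"
  have img: "?p ` Tr = transpose_pairs n ?C"
  proof (intro equalityI subsetI)
    fix z assume "z \<in> ?p ` Tr"
    then obtain \<alpha> \<beta> \<sigma> where z: "z = (\<sigma>, permute_mat n \<alpha> \<beta> A0)" and *: "(\<alpha>, \<beta>, \<sigma>) \<in> Tr" by auto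
    have G: "\<alpha> \<in> ?G" "\<beta> \<in> ?G" "\<sigma> \<in> ?G" using * by (auto simp: Tr_def)
    have "permute_mat n \<alpha> \<beta> A0 \<in> ?C"
      using G M permute_mat_M_mats[OF M] by (auto simp: perm_equiv_rel_def perm_equiv_iff)
    then show "z \<in> transpose_pairs n ?C" using * G by (auto simp: z transpose_pairs_def Tr_def less)
  next
    fix z assume z: "z \<in> transpose_pairs n ?C"
    then obtain \<sigma> A where [simp]: "z = (\<sigma>, A)" and \<sigma>: "\<sigma> \<in> ?G" and "A \<in> ?C"
      and *: "\<And>i j. i < n \<Longrightarrow> j < n \<Longrightarrow> A $$ (\<sigma> i, j) = A $$ (j, i)"
      by (auto simp: transpose_pairs_def)
    then obtain \<alpha> \<beta> where G: "\<alpha> \<in> ?G" "\<beta> \<in> ?G" and A: "A = permute_mat n \<alpha> \<beta> A0"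
      by (auto simp: perm_equiv_rel_def perm_equiv_iff)
    have "(\<alpha>, \<beta>, \<sigma>) \<in> Tr" using G \<sigma> * by (simp add: Tr_def A less)
    then show "z \<in> ?p ` Tr" by (intro image_eqI[of _ _ "(\<alpha>, \<beta>, \<sigma>)"]) (simp_all add: A)
  qed
  have fibre: "card {y \<in> Tr. ?p y = z} = card Stab" if "z \<in> transpose_pairs n ?C" for z
  proof -
    have "z \<in> ?p ` Tr" using that by (simp only: img)
    then obtain y0 where y0: "z = ?p y0" "y0 \<in> Tr" by (rule imageE)
    obtain \<alpha>0 \<beta>0 \<sigma> where "y0 = (\<alpha>0, \<beta>0, \<sigma>)" by (metis surj_pair)
    with y0 have z: "z = (\<sigma>, permute_mat n \<alpha>0 \<beta>0 A0)" and *: "(\<alpha>0, \<beta>0, \<sigma>) \<in> Tr" by auto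
    have G: "\<alpha>0 \<in> ?G" "\<beta>0 \<in> ?G" "\<sigma> \<in> ?G" using * by (auto simp: Tr_def)
    have Tr_cong: "(\<alpha>, \<beta>, \<sigma>) \<in> Tr" if "\<alpha> \<in> ?G" "\<beta> \<in> ?G"
      "\<And>i j. i < n \<Longrightarrow> j < n \<Longrightarrow> A0 $$ (\<alpha> i, \<beta> j) = A0 $$ (\<alpha>0 i, \<beta>0 j)" for \<alpha> \<beta>
      using that * less[OF G(3)] by (simp add: Tr_def)
    have "bij_betw (\<lambda>(s, t). (s \<circ> \<alpha>0, t \<circ> \<beta>0, \<sigma>)) Stab {y \<in> Tr. ?p y = z}"
    proof (rule bij_betw_byWitness[where f' = "\<lambda>(\<alpha>, \<beta>, \<sigma>). (\<alpha> \<circ> ?i \<alpha>0, \<beta> \<circ> ?i \<beta>0)"])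
      show "\<forall>a\<in>Stab. (\<lambda>(\<alpha>, \<beta>, \<sigma>). (\<alpha> \<circ> ?i \<alpha>0, \<beta> \<circ> ?i \<beta>0)) ((\<lambda>(s, t). (s \<circ> \<alpha>0, t \<circ> \<beta>0, \<sigma>)) a) = a"
      proof
        fix a show "(\<lambda>(\<alpha>, \<beta>, \<sigma>). (\<alpha> \<circ> ?i \<alpha>0, \<beta> \<circ> ?i \<beta>0)) ((\<lambda>(s, t). (s \<circ> \<alpha>0, t \<circ> \<beta>0, \<sigma>)) a) = a"
          by (cases a) (simp add: fun_eq_iff inv[OF G(1)] inv[OF G(2)])
      qed
      show "\<forall>y\<in>{y \<in> Tr. ?p y = z}. (\<lambda>(s, t). (s \<circ> \<alpha>0, t \<circ> \<beta>0, \<sigma>)) ((\<lambda>(\<alpha>, \<beta>, \<sigma>). (\<alpha> \<circ> ?i \<alpha>0, \<beta> \<circ> ?i \<beta>0)) y) = y"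
      proof
        fix y assume y: "y \<in> {y \<in> Tr. ?p y = z}"
        obtain \<alpha> \<beta> \<sigma>' where y': "y = (\<alpha>, \<beta>, \<sigma>')" by (metis surj_pair)
        have "\<sigma>' = \<sigma>" using y by (simp add: y' z)
        then show "(\<lambda>(s, t). (s \<circ> \<alpha>0, t \<circ> \<beta>0, \<sigma>)) ((\<lambda>(\<alpha>, \<beta>, \<sigma>). (\<alpha> \<circ> ?i \<alpha>0, \<beta> \<circ> ?i \<beta>0)) y) = y"
          by (simp add: y' fun_eq_iff inv[OF G(1)] inv[OF G(2)])
      qed
      show "(\<lambda>(s, t). (s \<circ> \<alpha>0, t \<circ> \<beta>0, \<sigma>)) ` Stab \<subseteq> {y \<in> Tr. ?p y = z}"
      proof (rule image_subsetI)
        fix a assume "a \<in> Stab"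
        then obtain s t where a: "a = (s, t)" "s \<in> ?G" "t \<in> ?G"
          and st: "\<And>x y. x < n \<Longrightarrow> y < n \<Longrightarrow> A0 $$ (s x, t y) = A0 $$ (x, y)"
          by (auto simp: Stab_def)
        have eq: "A0 $$ ((s \<circ> \<alpha>0) i, (t \<circ> \<beta>0) j) = A0 $$ (\<alpha>0 i, \<beta>0 j)" if "i < n" "j < n" for i j
          using st[of "\<alpha>0 i" "\<beta>0 j"] less[OF G(1) that(1)] less[OF G(2) that(2)] by simp
        have "(s \<circ> \<alpha>0, t \<circ> \<beta>0, \<sigma>) \<in> Tr"
          by (rule Tr_cong) (use a G eq in \<open>simp_all add: sym_group_comp\<close>)
        moreover have "permute_mat n (s \<circ> \<alpha>0) (t \<circ> \<beta>0) A0 = permute_mat n \<alpha>0 \<beta>0 A0"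
          using eq by (subst mat_eq_iff[of _ n]) simp_all
        ultimately show "(case a of (s, t) \<Rightarrow> (s \<circ> \<alpha>0, t \<circ> \<beta>0, \<sigma>)) \<in> {y \<in> Tr. ?p y = z}" by (simp add: a z)
      qed
      show "(\<lambda>(\<alpha>, \<beta>, \<sigma>). (\<alpha> \<circ> ?i \<alpha>0, \<beta> \<circ> ?i \<beta>0)) ` {y \<in> Tr. ?p y = z} \<subseteq> Stab"
      proof (rule image_subsetI)
        fix y assume y: "y \<in> {y \<in> Tr. ?p y = z}"
        obtain \<alpha> \<beta> \<sigma>' where y': "y = (\<alpha>, \<beta>, \<sigma>')" by (metis surj_pair)
        have G': "\<alpha> \<in> ?G" "\<beta> \<in> ?G" using y by (auto simp: y' Tr_def)
        have eq: "permute_mat n \<alpha> \<beta> A0 = permute_mat n \<alpha>0 \<beta>0 A0" using y by (simp add: y' z)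
        have "A0 $$ (\<alpha> (?i \<alpha>0 i), \<beta> (?i \<beta>0 j)) = A0 $$ (i, j)" if "i < n" "j < n" for i j
        proof -
          have lt: "?i \<alpha>0 i < n" "?i \<beta>0 j < n" using that G by (simp_all add: less sym_group_inv)
          have "permute_mat n \<alpha> \<beta> A0 $$ (?i \<alpha>0 i, ?i \<beta>0 j) = permute_mat n \<alpha>0 \<beta>0 A0 $$ (?i \<alpha>0 i, ?i \<beta>0 j)"
            by (simp only: eq)
          then show ?thesis using lt by (simp add: inv[OF G(1)] inv[OF G(2)])
        qed
        then show "(case y of (\<alpha>, \<beta>, \<sigma>) \<Rightarrow> (\<alpha> \<circ> ?i \<alpha>0, \<beta> \<circ> ?i \<beta>0)) \<in> Stab"
          using G G' by (simp add: y' Stab_def sym_group_comp sym_group_inv)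
      qed
    qed
    then show ?thesis by (simp add: bij_betw_same_card)
  qed
  have finP: "finite (transpose_pairs n ?C)" unfolding img[symmetric] using finT by simp
  have "card Tr = (\<Sum>z\<in>transpose_pairs n ?C. card {y \<in> Tr. ?p y = z})"
  proof -
    have "Tr = (\<Union>z\<in>transpose_pairs n ?C. {y \<in> Tr. ?p y = z})" by (auto simp flip: img)
    also have "card \<dots> = (\<Sum>z\<in>transpose_pairs n ?C. card {y \<in> Tr. ?p y = z})"
      using finP finT by (intro card_UN_disjoint) auto
    finally show ?thesis .
  qed
  also have "\<dots> = card (transpose_pairs n ?C) * card Stab" using fibre by simp
  finally show ?thesis using Tr1 posS by simp
qed

text \<open>A double count of the pairs (\<sigma>, A) with \<sigma>A^T = A. Such an equation makes A
  equivalent to its transpose, so only classes in \<open>T_mats n m\<close> contribute, and each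
  contributes n! pairs.\<close>

theorem sum_N_fun:
  "(\<Sum>\<sigma>\<in>sym_group n. N_fun n m \<sigma>) = of_nat (fact n * card (T_mats n m // perm_equiv_rel n m))"
proof -
  let ?R = "perm_equiv_rel n m"
  let ?Q = "T_mats n m // ?R"
  have sub: "T_mats n m \<subseteq> M_mats n m" by (auto simp: T_mats_def)
  then have finQ: "finite ?Q" using finite_subset[OF sub finite_M_mats] by (simp add: quotient_def)
  have classes: "C \<subseteq> M_mats n m" if "C \<in> ?Q" for C
    using that by (auto simp: quotient_def perm_equiv_rel_def)
  have fin: "finite (transpose_pairs n C)" if "C \<subseteq> M_mats n m" for C
    by (rule finite_subset[of _ "sym_group n \<times> M_mats n m"]) (use that in \<open>auto simp: transpose_pairs_def\<close>)
  have "(\<Sum>\<sigma>\<in>sym_group n. card {A \<in> M_mats n m. perm_mat n \<sigma> * transpose_mat A = A}) =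
      card (Sigma (sym_group n) (\<lambda>\<sigma>. {A \<in> M_mats n m. perm_mat n \<sigma> * transpose_mat A = A}))"
    by (simp add: card_SigmaI)
  also have "Sigma (sym_group n) (\<lambda>\<sigma>. {A \<in> M_mats n m. perm_mat n \<sigma> * transpose_mat A = A}) =
      transpose_pairs n (M_mats n m)"
    by (auto simp: transpose_pairs_def perm_mat_times_transpose_iff M_mats_carrier)
  also have "\<dots> = (\<Union>C\<in>?Q. transpose_pairs n C)"
  proof (intro equalityI subsetI)
    fix z assume z: "z \<in> transpose_pairs n (M_mats n m)"
    obtain \<sigma> A where zA: "z = (\<sigma>, A)" by fastforce
    have A: "A \<in> T_mats n m" using transpose_pairs_T_mats z zA by blast
    then have "?R `` {A} \<in> ?Q" by (rule quotientI)
    moreover have "A \<in> ?R `` {A}"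
      using equiv_class_self[OF equiv_perm_equiv_rel] A sub by blast
    ultimately show "z \<in> (\<Union>C\<in>?Q. transpose_pairs n C)" using z by (auto simp: zA transpose_pairs_def)
  next
    fix z assume "z \<in> (\<Union>C\<in>?Q. transpose_pairs n C)"
    then show "z \<in> transpose_pairs n (M_mats n m)" using classes by (auto simp: transpose_pairs_def)
  qed
  also have "card \<dots> = (\<Sum>C\<in>?Q. card (transpose_pairs n C))"
  proof (intro card_UN_disjoint finQ ballI impI)
    fix C D assume CD: "C \<in> ?Q" "D \<in> ?Q" "C \<noteq> D"
    have "C \<in> M_mats n m // ?R" "D \<in> M_mats n m // ?R" using CD sub by (auto simp: quotient_def)
    then have "C \<inter> D = {}" using quotient_disj[OF equiv_perm_equiv_rel] CD(3) by blast
    then show "transpose_pairs n C \<inter> transpose_pairs n D = {}" by (auto simp: transpose_pairs_def)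
  qed (use fin classes in auto)
  also have "\<dots> = fact n * card ?Q"
  proof -
    have "card (transpose_pairs n C) = fact n" if "C \<in> ?Q" for C
    proof -
      obtain A where "C = ?R `` {A}" "A \<in> T_mats n m" using \<open>C \<in> ?Q\<close> by (rule quotientE)
      then show ?thesis by (simp only: card_transpose_pairs_class)
    qed
    then show ?thesis by simp
  qed
  finally have eq: "(\<Sum>\<sigma>\<in>sym_group n. card {A \<in> M_mats n m. perm_mat n \<sigma> * transpose_mat A = A}) =
    fact n * card ?Q" .
  show ?thesis using arg_cong[OF eq, of int] by (simp only: N_fun_def of_nat_sum)
qed


section \<open>The average over the wreath product\<close>

text \<open>Orbit counting for the symmetric group permuting n-tuples of multisets of size m with
  sum X: the tables fixed by \<sigma> are the fixed tuples, and an orbit is a multiset of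
  multisets.\<close>

lemma sum_card_fixed_tables:
  fixes X :: "nat multiset"
  shows "(\<Sum>\<sigma>\<in>sym_group n. card (fixed_tables n (\<lambda>a. if a < n then m else 0) \<sigma> X)) =
    fact n * card (multisets_sum m n X)"
proof -
  let ?\<alpha> = "\<lambda>a. if a < n then m else 0"
  let ?I = "{..<n}"
  \<comment> \<open>With a single colour the Young subgroup is the whole symmetric group and a table
    has one row. The letters of the word are multisets, so this row is a multiset of
    multisets.\<close>
  let ?u = "\<lambda>_ :: nat. ()"
  let ?\<theta> = "\<lambda>z :: unit \<times> nat multiset. z"
  let ?Q = "\<lambda>Y. Y () \<in> multisets_sum m n X"
  have tables: "bij_betw (\<lambda>Y. Y ()) (twisted_tables ?I ?u ?\<theta> ?Q) (multisets_sum m n X)"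
    by (rule bij_betw_byWitness[where f' = "\<lambda>YY _. YY"])
      (auto simp: twisted_tables_def multisets_sum_def multisets_of_size_def)
  then have fin: "finite (twisted_tables ?I ?u ?\<theta> ?Q)"
    using bij_betw_finite by (metis finite_multisets_sum)
  have stab: "colour_stabilizer ?I ?u = sym_group n"
    by (simp add: colour_stabilizer_def sym_group_def)
  have row: "row_mset ?I ?u w () = image_mset w (mset_set ?I)" for w :: "nat \<Rightarrow> nat multiset"
    by (simp add: row_mset_def lessThan_def)
  have fin_fixed: "finite (fixed_tables n ?\<alpha> \<sigma> X)" for \<sigma>
    by (rule finite_fixed_tables) simp
  have "bij_betw (\<lambda>(\<sigma>, Y). (restrict Y ?I, \<sigma>)) (Sigma (sym_group n) (\<lambda>\<sigma>. fixed_tables n ?\<alpha> \<sigma> X))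
      (twisted_pairs ?I ?u ?\<theta> ?Q)"
  proof (rule bij_betw_byWitness[where f' = "\<lambda>(w, \<sigma>). (\<sigma>, \<lambda>a. if a < n then w a else {#})"])
    show "\<forall>z\<in>Sigma (sym_group n) (\<lambda>\<sigma>. fixed_tables n ?\<alpha> \<sigma> X).
        (\<lambda>(w, \<sigma>). (\<sigma>, \<lambda>a. if a < n then w a else {#})) ((\<lambda>(\<sigma>, Y). (restrict Y ?I, \<sigma>)) z) = z"
    proof
      fix z assume "z \<in> Sigma (sym_group n) (\<lambda>\<sigma>. fixed_tables n ?\<alpha> \<sigma> X)"
      then obtain \<sigma> Y where z: "z = (\<sigma>, Y)" and "Y \<in> fixed_tables n ?\<alpha> \<sigma> X" by auto
      then have "size (Y a) = ?\<alpha> a" for a unfolding fixed_tables_def by blast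
      then have "Y a = {#}" if "\<not> a < n" for a using that by (metis size_eq_0_iff_empty)
      then show "(\<lambda>(w, \<sigma>). (\<sigma>, \<lambda>a. if a < n then w a else {#})) ((\<lambda>(\<sigma>, Y). (restrict Y ?I, \<sigma>)) z) = z"
        by (simp add: z fun_eq_iff)
    qed
    show "\<forall>z\<in>twisted_pairs ?I ?u ?\<theta> ?Q.
        (\<lambda>(\<sigma>, Y). (restrict Y ?I, \<sigma>)) ((\<lambda>(w, \<sigma>). (\<sigma>, \<lambda>a. if a < n then w a else {#})) z) = z"
    proof
      fix z assume "z \<in> twisted_pairs ?I ?u ?\<theta> ?Q"
      then obtain w \<sigma> where z: "z = (w, \<sigma>)" and w: "w \<in> ?I \<rightarrow>\<^sub>E UNIV" by (auto simp: twisted_pairs_def)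
      have "(\<lambda>a\<in>?I. if a < n then w a else {#}) = w"
        using w by (intro ext) (auto simp: PiE_def extensional_def)
      then show "(\<lambda>(\<sigma>, Y). (restrict Y ?I, \<sigma>)) ((\<lambda>(w, \<sigma>). (\<sigma>, \<lambda>a. if a < n then w a else {#})) z) = z"
        by (simp add: z)
    qed
    show "(\<lambda>(\<sigma>, Y). (restrict Y ?I, \<sigma>)) ` Sigma (sym_group n) (\<lambda>\<sigma>. fixed_tables n ?\<alpha> \<sigma> X) \<subseteq>
        twisted_pairs ?I ?u ?\<theta> ?Q"
    proof (rule image_subsetI)
      fix z assume "z \<in> Sigma (sym_group n) (\<lambda>\<sigma>. fixed_tables n ?\<alpha> \<sigma> X)"
      then obtain \<sigma> Y where z: "z = (\<sigma>, Y)" and \<sigma>: "\<sigma> \<in> sym_group n" and Y0: "Y \<in> fixed_tables n ?\<alpha> \<sigma> X" by auto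
      have Y: "\<And>a. size (Y a) = ?\<alpha> a" "\<And>a. Y (\<sigma> a) = Y a" "(\<Sum>a<n. Y a) = X"
        using Y0 unfolding fixed_tables_def by blast+
      have img: "image_mset (restrict Y ?I) (mset_set ?I) = image_mset Y (mset_set ?I)"
        by (intro image_mset_cong) auto
      have "image_mset Y (mset_set ?I) \<in> multisets_sum m n X"
        using Y(1,3) by (auto simp: multisets_sum_def multisets_of_size_def sum_unfold_sum_mset)
      then show "(case z of (\<sigma>, Y) \<Rightarrow> (restrict Y ?I, \<sigma>)) \<in> twisted_pairs ?I ?u ?\<theta> ?Q"
        using \<sigma> sym_group_less[OF \<sigma>] Y(2) by (simp add: z twisted_pairs_def row img) (simp add: sym_group_def)
    qed
    show "(\<lambda>(w, \<sigma>). (\<sigma>, \<lambda>a. if a < n then w a else {#})) ` twisted_pairs ?I ?u ?\<theta> ?Q \<subseteq>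
        Sigma (sym_group n) (\<lambda>\<sigma>. fixed_tables n ?\<alpha> \<sigma> X)"
    proof (rule image_subsetI)
      fix z assume "z \<in> twisted_pairs ?I ?u ?\<theta> ?Q"
      then obtain w \<sigma> where z: "z = (w, \<sigma>)" and \<sigma>: "\<sigma> permutes ?I"
        and inv: "\<And>a. a < n \<Longrightarrow> w (\<sigma> a) = w a" and mem: "image_mset w (mset_set ?I) \<in> multisets_sum m n X"
        by (auto simp: twisted_pairs_def row)
      let ?Y = "\<lambda>a. if a < n then w a else {#}"
      have "size (w a) = m" if "a < n" for a
        using mem that by (auto simp: multisets_sum_def multisets_of_size_def)
      then have "size (?Y a) = ?\<alpha> a" for a by simp
      moreover have "?Y (\<sigma> a) = ?Y a" for a
        using inv[of a] permutes_in_image[OF \<sigma>, of a] by simp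
      moreover have "(\<Sum>a<n. ?Y a) = X"
      proof -
        have "(\<Sum>a<n. ?Y a) = (\<Sum>a<n. w a)" by (intro sum.cong) auto
        also have "\<dots> = X" using mem by (simp add: multisets_sum_def sum_unfold_sum_mset)
        finally show ?thesis .
      qed
      ultimately have "?Y \<in> fixed_tables n ?\<alpha> \<sigma> X" unfolding fixed_tables_def by blast
      then show "(case z of (w, \<sigma>) \<Rightarrow> (\<sigma>, \<lambda>a. if a < n then w a else {#})) \<in>
          Sigma (sym_group n) (\<lambda>\<sigma>. fixed_tables n ?\<alpha> \<sigma> X)"
        using \<sigma> by (simp add: z sym_group_def)
    qed
  qed
  then have "card (Sigma (sym_group n) (\<lambda>\<sigma>. fixed_tables n ?\<alpha> \<sigma> X)) = card (twisted_pairs ?I ?u ?\<theta> ?Q)"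
    by (rule bij_betw_same_card)
  also have "\<dots> = card (sym_group n) * card (multisets_sum m n X)"
    using card_twisted_pairs[of ?I ?\<theta> ?u ?Q] fin bij_betw_same_card[OF tables] stab by (simp add: bij_id[unfolded id_def])
  also have "card (Sigma (sym_group n) (\<lambda>\<sigma>. fixed_tables n ?\<alpha> \<sigma> X)) =
      (\<Sum>\<sigma>\<in>sym_group n. card (fixed_tables n ?\<alpha> \<sigma> X))"
    using fin_fixed by (simp add: card_SigmaI)
  finally show ?thesis by (simp add: card_sym_group)
qed

text \<open>The rows of the table become the columns of A, because then
  \<open>count (Y b) (\<sigma> a) = count (Y a) b\<close> reads A(\<sigma> a, b) = A(b, a), the
  entrywise form of \<sigma>A^T = A.\<close>

lemma card_symmetric_tables_N_fun:
  assumes \<sigma>: "\<sigma> \<in> sym_group n"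
  shows "int (card (symmetric_tables (\<lambda>a. if a < n then m else 0) \<sigma>)) = N_fun n m \<sigma>"
proof -
  let ?\<alpha> = "\<lambda>a. if a < n then m else 0"
  let ?S = "{A \<in> M_mats n m. perm_mat n \<sigma> * transpose_mat A = A}"
  let ?col = "\<lambda>A a i. if i < n \<and> a < n then A $$ (i, a) else 0 :: nat"
  have out: "\<sigma> a < n \<longleftrightarrow> a < n" for a
    using \<sigma> permutes_in_image[of \<sigma> "{..<n}" a] by (simp add: sym_group_def)
  have out': "\<sigma> a = a" if "\<not> a < n" for a
    using \<sigma> permutes_not_in[of \<sigma> "{..<n}" a] that by (simp add: sym_group_def)
  have zero: "count (Y a) b = 0" if "Y \<in> symmetric_tables ?\<alpha> \<sigma>" "\<not> a < n \<or> \<not> b < n" for Y a b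
  proof -
    have Y: "\<And>a. size (Y a) = ?\<alpha> a" "\<And>a b. count (Y b) (\<sigma> a) = count (Y a) b"
      using that(1) unfolding symmetric_tables_def by blast+
    have empty: "Y c = {#}" if "\<not> c < n" for c using Y(1)[of c] that by simp
    show ?thesis using that(2) empty[of a] empty[of b] Y(2)[of b a] by (cases "a < n") auto
  qed
  have col: "count (Abs_multiset (?col A a)) = ?col A a" "set_mset (Abs_multiset (?col A a)) \<subseteq> {..<n}" for A a
    using count_Abs_multiset_bounded[of n "?col A a"] by auto
  have "bij_betw (\<lambda>Y. mat n n (\<lambda>(i, j). count (Y j) i)) (symmetric_tables ?\<alpha> \<sigma>) ?S"
  proof (rule bij_betw_byWitness[where f' = "\<lambda>A a. Abs_multiset (?col A a)"])
    show "\<forall>Y\<in>symmetric_tables ?\<alpha> \<sigma>. (\<lambda>a. Abs_multiset (?col (mat n n (\<lambda>(i, j). count (Y j) i)) a)) = Y"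
    proof
      fix Y assume Y: "Y \<in> symmetric_tables ?\<alpha> \<sigma>"
      have "?col (mat n n (\<lambda>(i, j). count (Y j) i)) a = count (Y a)" for a
        using zero[OF Y] by (auto simp: fun_eq_iff)
      then show "(\<lambda>a. Abs_multiset (?col (mat n n (\<lambda>(i, j). count (Y j) i)) a)) = Y"
        by (simp add: count_inverse)
    qed
    show "\<forall>A\<in>?S. mat n n (\<lambda>(i, j). count (Abs_multiset (?col A j)) i) = A"
    proof
      fix A assume "A \<in> ?S"
      then have "A \<in> carrier_mat n n" by (simp add: M_mats_def)
      then show "mat n n (\<lambda>(i, j). count (Abs_multiset (?col A j)) i) = A"
        by (subst mat_eq_iff[of _ n]) (simp_all add: col(1))
    qed
    show "(\<lambda>Y. mat n n (\<lambda>(i, j). count (Y j) i)) ` symmetric_tables ?\<alpha> \<sigma> \<subseteq> ?S"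
    proof (rule image_subsetI)
      fix Y assume Y0: "Y \<in> symmetric_tables ?\<alpha> \<sigma>"
      then have Y: "\<And>a. size (Y a) = ?\<alpha> a" "\<And>a b. count (Y b) (\<sigma> a) = count (Y a) b"
        unfolding symmetric_tables_def by blast+
      let ?A = "mat n n (\<lambda>(i, j). count (Y j) i)"
      have "set_mset (Y a) \<subseteq> {..<n}" for a
      proof
        fix b assume "b \<in># Y a"
        then have "count (Y a) b \<noteq> 0" by (simp add: count_eq_zero_iff)
        then have "\<not> (\<not> a < n \<or> \<not> b < n)" using zero[OF Y0, of a b] by (rule contrapos_nn)
        then show "b \<in> {..<n}" by simp
      qed
      then have cols: "(\<Sum>i<n. count (Y a) i) = m" if "a < n" for a
        using size_eq_sum_count[of "Y a" n] Y(1)[of a] that by simp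
      have rows: "(\<Sum>j<n. count (Y j) i) = m" if "i < n" for i
      proof -
        \<comment> \<open>Row i = \<sigma> k of A coincides with column k by the twisted symmetry,
          so the row sums are inherited from the column sums.\<close>
        let ?k = "inv_into UNIV \<sigma> i"
        have k: "?k < n" using sym_group_less[OF sym_group_inv[OF \<sigma>] that] .
        have "(\<Sum>j<n. count (Y j) i) = (\<Sum>j<n. count (Y ?k) j)"
          using Y(2)[of _ ?k] by (simp add: sym_group_inv_simps(1)[OF \<sigma>])
        then show ?thesis using cols[OF k] by simp
      qed
      have "?A \<in> M_mats n m" using rows cols by (simp add: M_mats_def)
      moreover have "perm_mat n \<sigma> * transpose_mat ?A = ?A"
        using Y(2) by (subst perm_mat_times_transpose_iff[OF \<sigma>]) (simp_all add: out)
      ultimately show "?A \<in> ?S" by simp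
    qed
    show "(\<lambda>A a. Abs_multiset (?col A a)) ` ?S \<subseteq> symmetric_tables ?\<alpha> \<sigma>"
    proof (rule image_subsetI)
      fix A assume A: "A \<in> ?S"
      then have M: "A \<in> M_mats n m" and car: "A \<in> carrier_mat n n" by (auto simp: M_mats_def)
      have eq: "A $$ (\<sigma> i, j) = A $$ (j, i)" if "i < n" "j < n" for i j
        using A perm_mat_times_transpose_iff[OF \<sigma> car] that by simp
      have "size (Abs_multiset (?col A a)) = ?\<alpha> a" for a
      proof -
        have "size (Abs_multiset (?col A a)) = (\<Sum>i<n. ?col A a i)"
          using size_eq_sum_count[OF col(2)[where A = A and a = a]] by (simp add: col(1))
        also have "\<dots> = ?\<alpha> a" using M by (simp add: M_mats_def)
        finally show ?thesis .
      qed
      moreover have "?col A b (\<sigma> a) = ?col A a b" for a b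
        using eq[of a b] by (simp add: out)
      ultimately show "(\<lambda>a. Abs_multiset (?col A a)) \<in> symmetric_tables ?\<alpha> \<sigma>"
        by (simp add: symmetric_tables_def col(1))
    qed
  qed
  then show ?thesis by (simp add: N_fun_def bij_betw_same_card)
qed

lemma card_block:
  assumes "m \<ge> 1"
  shows "card {p \<in> {..<n * m}. p div m = a} = (if a < n then m else 0)"
proof (cases "a < n")
  case True
  then have "a * m + m \<le> n * m" by (metis Suc_leI add.commute mult_Suc mult_le_mono1)
  have "{p \<in> {..<n * m}. p div m = a} = {a * m..<a * m + m}"
  proof (intro equalityI subsetI)
    fix p assume "p \<in> {p \<in> {..<n * m}. p div m = a}"
    then show "p \<in> {a * m..<a * m + m}"
      using assms dividend_less_div_times[of m p] div_times_less_eq_dividend[of p m] by auto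
  next
    fix p assume p: "p \<in> {a * m..<a * m + m}"
    then have "p div m = a" by (intro div_nat_eqI) (auto simp: mult.commute add.commute)
    then show "p \<in> {p \<in> {..<n * m}. p div m = a}" using p \<open>a * m + m \<le> n * m\<close> by simp
  qed
  then show ?thesis using True by simp
next
  case False
  have "p div m < n" if "p < n * m" for p using that by (simp add: less_mult_imp_div_less)
  then show ?thesis using False by auto
qed

text \<open>Positions are coloured by their block, so b is the order of the base group and the
  cosets over \<sigma> make up the wreath product. Summing power sums over it gives b n! times the
  series, and summing their values under L gives b times the sum of the N^m(\<sigma>); division by b
  n! leaves the average.\<close>

lemma schur_expansion_multiset_series:
  assumes m: "m \<ge> 1"
  shows "schur_expansion (n * m) (multiset_series m n) (1 / fact n * of_int (\<Sum>\<sigma>\<in>sym_group n. N_fun n m \<sigma>))"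
proof -
  define N where "N = n * m"
  define u where "u p = p div m" for p
  define b where "b = card (colour_stabilizer {..<N} u)"
  let ?\<alpha> = "\<lambda>a. if a < n then m else 0"
  have b: "b > 0" unfolding b_def by (rule card_colour_stabilizer_pos) simp
  have u: "u p < n" if "p < N" for p using that by (simp add: u_def N_def less_mult_imp_div_less)
  have \<alpha>: "(\<lambda>a. card {p \<in> {..<N}. u p = a}) = ?\<alpha>"
    by (rule ext) (simp only: N_def u_def card_block[OF m])
  have bij: "bij \<sigma>" if "\<sigma> \<in> sym_group n" for \<sigma> using that permutes_bij by (auto simp: sym_group_def)
  have exp: "schur_expansion N (\<Sum>h\<in>colour_coset N u \<sigma>. perm_series N h) (of_nat b * of_int (N_fun n m \<sigma>))"
    if \<sigma>: "\<sigma> \<in> sym_group n" for \<sigma>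
  proof -
    have "schur_expansion N (\<Sum>h\<in>colour_coset N u \<sigma>. perm_series N h)
        (\<Sum>h\<in>colour_coset N u \<sigma>. of_nat (square_roots N h))"
      by (rule schur_expansion_sum, rule schur_expansion_perm_series) (simp add: colour_coset_def)
    moreover have "(\<Sum>h\<in>colour_coset N u \<sigma>. square_roots N h) = b * card (symmetric_tables ?\<alpha> \<sigma>)"
      using sum_square_roots_coset[OF bij[OF \<sigma>] u] by (simp only: \<alpha> b_def)
    then have "(\<Sum>h\<in>colour_coset N u \<sigma>. rat_of_nat (square_roots N h)) = of_nat b * of_int (N_fun n m \<sigma>)"
      by (simp flip: of_nat_sum card_symmetric_tables_N_fun[OF \<sigma>])
    ultimately show ?thesis by simp
  qed
  have "(\<Sum>\<sigma>\<in>sym_group n. \<Sum>h\<in>colour_coset N u \<sigma>. perm_series N h) =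
      mscale (of_nat b * fact n) (multiset_series m n)"
  proof (rule mser_eqI)
    fix X :: "nat multiset"
    have "mcoeff (\<Sum>\<sigma>\<in>sym_group n. \<Sum>h\<in>colour_coset N u \<sigma>. perm_series N h) X =
        (\<Sum>\<sigma>\<in>sym_group n. of_nat (b * card (fixed_tables n ?\<alpha> \<sigma> X)))"
      unfolding mcoeff_sum
    proof (rule sum.cong)
      fix \<sigma> assume \<sigma>: "\<sigma> \<in> sym_group n"
      show "(\<Sum>h\<in>colour_coset N u \<sigma>. mcoeff (perm_series N h) X) = of_nat (b * card (fixed_tables n ?\<alpha> \<sigma> X))"
        using sum_perm_series_coset[OF bij[OF \<sigma>] u, where X = X] by (simp only: \<alpha> b_def)
    qed simp
    also have "\<dots> = of_nat (b * (\<Sum>\<sigma>\<in>sym_group n. card (fixed_tables n ?\<alpha> \<sigma> X)))"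
      by (simp add: sum_distrib_left)
    also have "\<dots> = mcoeff (mscale (of_nat b * fact n) (multiset_series m n)) X"
      unfolding sum_card_fixed_tables by (simp add: multiset_series.rep_eq)
    finally show "mcoeff (\<Sum>\<sigma>\<in>sym_group n. \<Sum>h\<in>colour_coset N u \<sigma>. perm_series N h) X =
        mcoeff (mscale (of_nat b * fact n) (multiset_series m n)) X" .
  qed
  moreover have "schur_expansion N (\<Sum>\<sigma>\<in>sym_group n. \<Sum>h\<in>colour_coset N u \<sigma>. perm_series N h)
      (\<Sum>\<sigma>\<in>sym_group n. of_nat b * of_int (N_fun n m \<sigma>))"
    by (rule schur_expansion_sum) (rule exp)
  ultimately have "schur_expansion N (mscale (of_nat b * fact n) (multiset_series m n))
      (of_nat b * of_int (\<Sum>\<sigma>\<in>sym_group n. N_fun n m \<sigma>))"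
    by (simp add: sum_distrib_left)
  then have "schur_expansion N (mscale (1 / (of_nat b * fact n)) (mscale (of_nat b * fact n) (multiset_series m n)))
      (1 / (of_nat b * fact n) * (of_nat b * of_int (\<Sum>\<sigma>\<in>sym_group n. N_fun n m \<sigma>)))"
    by (rule schur_expansion_scale)
  then show ?thesis using b by (simp add: N_def)
qed

lemma sum_plethysm_coeff:
  assumes "m \<ge> 1"
  shows "(\<Sum>\<nu>\<in>partitions (n * m). plethysm_coeff n m \<nu>) = 1 / fact n * of_int (\<Sum>\<sigma>\<in>sym_group n. N_fun n m \<sigma>)"
proof -
  note expansion = schur_expansion_multiset_series[OF assms, of n]
  have "(\<forall>\<nu>. \<nu> \<notin> partitions (n * m) \<longrightarrow> plethysm_coeff n m \<nu> = 0) \<and>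
      multiset_series m n = (\<Sum>\<nu>\<in>partitions (n * m). mscale (plethysm_coeff n m \<nu>) (schur \<nu>))"
    unfolding plethysm_coeff_def plethysm_schur_row
    using theI'[OF schur_expansion_unique(1)[OF expansion]] .
  then show ?thesis by (rule schur_expansion_unique(2)[OF expansion])
qed

theorem theorem1p4:
  fixes n m :: nat
  assumes "n \<ge> 1" and "m \<ge> 1"
  shows "(of_rat (\<Sum>\<nu>\<in>partitions (n * m). plethysm_coeff n m \<nu>) :: complex)
           = char_inner (sym_group n) (\<lambda>_. 1) (\<lambda>\<sigma>. of_int (N_fun n m \<sigma>))
       \<and> char_inner (sym_group n) (\<lambda>_. 1) (\<lambda>\<sigma>. of_int (N_fun n m \<sigma>))
           = of_nat (card (T_mats n m // perm_equiv_rel n m))"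
proof -
  \<comment> \<open>The values of N^m are integers, so complex conjugation does nothing.\<close>
  have inner: "char_inner (sym_group n) (\<lambda>_. 1) (\<lambda>\<sigma>. of_int (N_fun n m \<sigma>)) =
      1 / fact n * of_int (\<Sum>\<sigma>\<in>sym_group n. N_fun n m \<sigma>)"
    by (simp add: char_inner_def card_sym_group)
  have fact: "of_rat (fact n) = (fact n :: complex)"
    using of_rat_of_nat_eq[of "fact n"] by simp
  have conv: "of_rat (1 / fact n * of_int k) = (1 / fact n * of_int k :: complex)" for k
    by (simp add: of_rat_mult of_rat_divide fact)
  show ?thesis
  proof
    show "(of_rat (\<Sum>\<nu>\<in>partitions (n * m). plethysm_coeff n m \<nu>) :: complex) =
        char_inner (sym_group n) (\<lambda>_. 1) (\<lambda>\<sigma>. of_int (N_fun n m \<sigma>))"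
      by (simp only: sum_plethysm_coeff[OF assms(2)] conv inner)
    show "char_inner (sym_group n) (\<lambda>_. 1) (\<lambda>\<sigma>. of_int (N_fun n m \<sigma>)) =
        of_nat (card (T_mats n m // perm_equiv_rel n m))"
      by (simp add: inner sum_N_fun del: of_int_sum)
  qed
qed

end
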